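(* Let $L=p_0(x)+p_1(x)\partial_x+\dots+p_k(x)\partial_x^k$ be a linear differential operator of order $k$ with polynomial coefficients $p_i\in\mathbb{Q}[x]$. Let $f\in\mathcal{C}^k(\left]-1,1\right[)$ be such that at least one of the following two hypotheses holds: (H) the integral $\displaystyle\int_{-1}^1\frac{f^{(k)}(x)}{\sqrt{1-x^2}}\,dx$ is convergent; (H') the integral $\displaystyle\int_{-1}^1\frac{(1-x^2)^kf^{(k)}(x)}{\sqrt{1-x^2}}\,dx$ is convergent and $(1-x^2)^i$ divides $p_i(x)$ for $i=0,\dots,k$. Then $f$ admits a Chebyshev expansion $\sum^\star u_nT_n$, $L\cdot f$ admits a Chebyshev expansion $\sum^\star v_nT_n$, and the sequences $(u_n)$ and $(v_n)$ are related by $P\cdot u_n=Q\cdot v_n$ for any pair $(P,Q)$ of recurrence operators in $\mathbb{Q}(n)\langle S,S^{-1};S\rangle$, $Q\neq 0$, such that $Q^{-1}P=\varphi(L)$. In particular, if $L\cdot f=0$, then the Chebyshev coefficients of $f$ satisfy $P\cdot u_n=0$ for any numerator $P$ of $\varphi(L)$.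
   Context: Chebyshev expansions. $T_n$ denotes the Chebyshev polynomial of the first kind, $T_n(\cos\theta)=\cos(n\theta)$, with $T_{-n}=T_n$. A function $g$ on $]-1,1[$ admits a Chebyshev expansion $\sum^\star c_nT_n$ when the integrals $c_n=\frac{2}{\pi}\int_{-1}^1\frac{g(x)T_n(x)}{\sqrt{1-x^2}}\,dx$ converge (as improper integrals) for all $n\in\mathbb{N}$; these $c_n$ are its Chebyshev coefficients. (The symbol $\sum^\star$ indicates that the series is $\frac{c_0}{2}+\sum_{n\ge1}c_nT_n$; no convergence of the series is asserted.) The sequence is extended to $n\in\mathbb{Z}$ by the same formula, so $c_{-n}=c_n$. Operators. $\mathbb{Q}[x]\langle\partial_x;\mathrm{Id},d/dx\rangle$ is the ring of linear differential operators, with $\partial_x x=x\partial_x+1$, acting on functions by $\partial_x\cdot f=f'$. $\mathbb{Q}(n)\langle S,S^{-1};S\rangle$ is the ring of Laurent polynomials in $S$ with coefficients in $\mathbb{Q}(n)$ written on the left, with $SS^{-1}=S^{-1}S=1$ and $S\,a(n)=a(n+1)\,S$ for $a\in\mathbb{Q}(n)$. It acts on sequences indexed by $\mathbb{Z}$ by $S\cdot u_n=u_{n+1}$ and $a(n)\cdot u_n=a(n)u_n$; an identity $P\cdot u_n=Q\cdot v_n$ is understood at the integers $n$ at which no coefficient of $P$ or $Q$ has a pole. Fractions. The ring $\mathbb{Q}(n)\langle S,S^{-1};S\rangle$ is an Ore domain; its skew field of fractions consists of the left fractions $Q^{-1}P$, $Q\ne0$. A numerator of a fraction $F$ is any $P$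 for which there is a nonzero $Q$ with $F=Q^{-1}P$. Morphism. $\varphi$ is the $\mathbb{Q}$-algebra morphism from $\mathbb{Q}[x]\langle\partial_x;\mathrm{Id},d/dx\rangle$ to this skew field of fractions defined by $\varphi(x)=X:=\frac12(S+S^{-1})$ and $\varphi(\partial_x)=D:=(S^{-1}-S)^{-1}(2n)$. *)

theory Defs
  imports "HOL-Analysis.Analysis" "HOL-Computational_Algebra.Computational_Algebra"
    "HOL-Computational_Algebra.Field_as_Ring"
begin

section \<open>The skew field of left fractions of an Ore domain\<close>

class left_ore_domain = ring_1_no_zero_divisors +
  assumes left_ore: "b \<noteq> 0 \<Longrightarrow> \<exists>c d. c \<noteq> 0 \<and> c * a = d * b"

lemma ore_nz:
  fixes a b c d :: "'a::ring_1_no_zero_divisors"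
  assumes "a * b = c * d" "a \<noteq> 0" "b \<noteq> 0"
  shows "c \<noteq> 0"
  using assms by auto

definition lfractrel :: "'a::left_ore_domain \<times> 'a \<Rightarrow> 'a \<times> 'a \<Rightarrow> bool" where
  "lfractrel x y \<longleftrightarrow> fst x \<noteq> 0 \<and> fst y \<noteq> 0 \<and>
     (\<exists>a b. a \<noteq> 0 \<and> a * fst x = b * fst y \<and> a * snd x = b * snd y)"

lemma symp_lfractrel: "symp lfractrel"
proof (rule sympI)
  fix x y :: "'a \<times> 'a"
  assume "lfractrel x y"
  then obtain a b where *: "fst x \<noteq> 0" "fst y \<noteq> 0" "a \<noteq> 0" "a * fst x = b * fst y" "a * snd x = b * snd y"
    by (auto simp: lfractrel_def)
  then have "b \<noteq> 0" by auto
  with * show "lfractrel y x" unfolding lfractrel_def by metis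
qed

lemma transp_lfractrel: "transp lfractrel"
proof (rule transpI)
  fix x y z :: "'a \<times> 'a"
  assume "lfractrel x y" "lfractrel y z"
  then obtain a b c d where *: "fst x \<noteq> 0" "fst y \<noteq> 0" "fst z \<noteq> 0"
    "a \<noteq> 0" "a * fst x = b * fst y" "a * snd x = b * snd y"
    "c \<noteq> 0" "c * fst y = d * fst z" "c * snd y = d * snd z"
    by (auto simp: lfractrel_def)
  obtain e f where ef: "e \<noteq> 0" "e * b = f * c" using left_ore[OF \<open>c \<noteq> 0\<close>] by blast
  have "(e * a) * fst x = (f * d) * fst z" "(e * a) * snd x = (f * d) * snd z"
    using * ef by (metis mult.assoc)+
  moreover have "e * a \<noteq> 0" using * ef by simp
  ultimately show "lfractrel x z" using * unfolding lfractrel_def by blast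
qed

quotient_type (overloaded) 'a lfract = "'a::left_ore_domain \<times> 'a" / partial: lfractrel
proof (rule part_equivpI)
  show "\<exists>x::'a \<times> 'a. lfractrel x x"
    by (rule exI[of _ "(1, 0)"]) (auto simp: lfractrel_def intro!: exI[of _ 1])
qed (rule symp_lfractrel transp_lfractrel)+

text \<open>\<open>lfrac q p\<close> is the fraction \<open>q\<^sup>-\<^sup>1 p\<close>.\<close>

lift_definition lfrac :: "'a::left_ore_domain \<Rightarrow> 'a \<Rightarrow> 'a lfract"
  is "\<lambda>q p. if q = 0 then (1, 0) else (q, p)"
  by (auto simp: lfractrel_def intro: exI[of _ 1])

lemma lfrac_cases:
  obtains q p where "q \<noteq> 0" "x = lfrac q p"
  by transfer (auto simp: lfractrel_def)

lemma lfrac_eq_iff: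
  assumes "q \<noteq> 0" "q' \<noteq> 0"
  shows "lfrac q p = lfrac q' p' \<longleftrightarrow> (\<exists>a b. a \<noteq> 0 \<and> a * q = b * q' \<and> a * p = b * p')"
  using assms by transfer (auto simp: lfractrel_def)

lemma lfrac_cancel: "a \<noteq> 0 \<Longrightarrow> q \<noteq> 0 \<Longrightarrow> lfrac (a * q) (a * p) = lfrac q p"
  by (subst lfrac_eq_iff) (auto intro: exI[of _ 1])

lemma lfrac_unique: "q \<noteq> 0 \<Longrightarrow> lfrac q p = lfrac q p' \<longleftrightarrow> p = p'"
  by (auto simp: lfrac_eq_iff)

lemma lfrac_common:
  obtains q p p' where "q \<noteq> 0" "x = lfrac q p" "y = lfrac q p'"
proof -
  obtain a b where 1: "a \<noteq> 0" "x = lfrac a b" by (rule lfrac_cases)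
  obtain c d where 2: "c \<noteq> 0" "y = lfrac c d" by (rule lfrac_cases)
  obtain e f where 3: "e \<noteq> 0" "e * a = f * c" using left_ore[OF \<open>c \<noteq> 0\<close>] by blast
  then have "f \<noteq> 0" using 1 by (blast dest: ore_nz)
  show ?thesis
  proof (rule that[of "e * a" "e * b" "f * d"])
    show "e * a \<noteq> 0" using 1(1) 3(1) by simp
    show "x = lfrac (e * a) (e * b)" using 1 3(1) by (simp add: lfrac_cancel)
    show "y = lfrac (e * a) (f * d)" using 2 3 \<open>f \<noteq> 0\<close> by (simp add: lfrac_cancel)
  qed
qed

lemma lfrac_chain:
  assumes "p \<noteq> 0"
  obtains c r where "c \<noteq> 0" "y = lfrac (c * p) r"
proof -
  obtain a b where 1: "a \<noteq> 0" "y = lfrac a b" by (rule lfrac_cases)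
  obtain c d where 2: "c \<noteq> 0" "c * p = d * a" using left_ore[OF \<open>a \<noteq> 0\<close>] by blast
  then have "d \<noteq> 0" using assms by auto
  then show ?thesis using that[of c "d * b"] 1 2 by (simp add: lfrac_cancel)
qed

definition lfract_of :: "'a::left_ore_domain \<Rightarrow> 'a lfract" where
  "lfract_of a = lfrac 1 a"

instantiation lfract :: (left_ore_domain) "{zero, one, plus, minus, uminus, times, inverse}"
begin

definition zero_lfract :: "'a lfract" where "0 = lfrac 1 0"

definition one_lfract :: "'a lfract" where "1 = lfrac 1 1"

definition plus_lfract :: "'a lfract \<Rightarrow> 'a lfract \<Rightarrow> 'a lfract" where
  "x + y = (THE z. \<exists>q p p'. q \<noteq> 0 \<and> x = lfrac q p \<and> y = lfrac q p' \<and> z = lfrac q (p + p'))"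

definition uminus_lfract :: "'a lfract \<Rightarrow> 'a lfract" where
  "- x = (THE z. \<exists>q p. q \<noteq> 0 \<and> x = lfrac q p \<and> z = lfrac q (- p))"

definition minus_lfract :: "'a lfract \<Rightarrow> 'a lfract \<Rightarrow> 'a lfract" where
  "x - y = x + (- y :: 'a lfract)"

text \<open>Any product can be brought into the form \<open>(q\<^sup>-\<^sup>1 p) (p\<^sup>-\<^sup>1 r) = q\<^sup>-\<^sup>1 r\<close>
  using the Ore condition.\<close>

definition times_lfract :: "'a lfract \<Rightarrow> 'a lfract \<Rightarrow> 'a lfract" where
  "x * y = (if x = 0 then 0 else
     (THE z. \<exists>q p r. q \<noteq> 0 \<and> p \<noteq> 0 \<and> x = lfrac q p \<and> y = lfrac p r \<and> z = lfrac q r))"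

definition inverse_lfract :: "'a lfract \<Rightarrow> 'a lfract" where
  "inverse x = (if x = 0 then 0 else
     (THE z. \<exists>q p. q \<noteq> 0 \<and> p \<noteq> 0 \<and> x = lfrac q p \<and> z = lfrac p q))"

definition divide_lfract :: "'a lfract \<Rightarrow> 'a lfract \<Rightarrow> 'a lfract" where
  "x div y = x * inverse (y :: 'a lfract)"

instance ..

end

lemma lfrac_eq_0_iff: "q \<noteq> 0 \<Longrightarrow> lfrac q p = 0 \<longleftrightarrow> p = 0"
  unfolding zero_lfract_def
  by (subst lfrac_eq_iff) (auto intro!: exI[of _ 1])

lemma lfrac_add:
  assumes "q \<noteq> 0"
  shows "lfrac q p + lfrac q p' = lfrac q (p + p')"
  unfolding plus_lfract_def
proof (rule the_equality)
  show "\<exists>q1 p1 p1'. q1 \<noteq> 0 \<and> lfrac q p = lfrac q1 p1 \<and> lfrac q p' = lfrac q1 p1'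
    \<and> lfrac q (p + p') = lfrac q1 (p1 + p1')" using assms by blast
next
  fix z
  assume "\<exists>q1 p1 p1'. q1 \<noteq> 0 \<and> lfrac q p = lfrac q1 p1 \<and> lfrac q p' = lfrac q1 p1'
    \<and> z = lfrac q1 (p1 + p1')"
  then obtain q1 p1 p1' where 1: "q1 \<noteq> 0" "lfrac q p = lfrac q1 p1" "lfrac q p' = lfrac q1 p1'"
    and z: "z = lfrac q1 (p1 + p1')" by blast
  obtain a b where 2: "a \<noteq> 0" "a * q = b * q1" using left_ore[OF \<open>q1 \<noteq> 0\<close>] by blast
  then have b: "b \<noteq> 0" using assms by (blast dest: ore_nz)
  have nz: "a * q \<noteq> 0" using 2(1) assms by simp
  have "lfrac (a * q) (a * p) = lfrac (a * q) (b * p1)"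
    using 1 2 b assms by (metis lfrac_cancel)
  then have e1: "a * p = b * p1" using nz by (simp add: lfrac_unique)
  have "lfrac (a * q) (a * p') = lfrac (a * q) (b * p1')"
    using 1 2 b assms by (metis lfrac_cancel)
  then have e2: "a * p' = b * p1'" using nz by (simp add: lfrac_unique)
  have "a * (p + p') = b * (p1 + p1')" using e1 e2 by (simp add: distrib_left)
  then have "lfrac q (p + p') = lfrac q1 (p1 + p1')"
    using 2 assms 1 by (subst lfrac_eq_iff) auto
  then show "z = lfrac q (p + p')" using z by simp
qed

lemma lfrac_uminus:
  assumes "q \<noteq> 0"
  shows "- lfrac q p = lfrac q (- p)"
  unfolding uminus_lfract_def
proof (rule the_equality)
  show "\<exists>q1 p1. q1 \<noteq> 0 \<and> lfrac q p = lfrac q1 p1 \<and> lfrac q (- p) = lfrac q1 (- p1)"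
    using assms by blast
next
  fix z
  assume "\<exists>q1 p1. q1 \<noteq> 0 \<and> lfrac q p = lfrac q1 p1 \<and> z = lfrac q1 (- p1)"
  then obtain q1 p1 where 1: "q1 \<noteq> 0" "lfrac q p = lfrac q1 p1" and z: "z = lfrac q1 (- p1)" by blast
  then obtain a b where "a \<noteq> 0" "a * q = b * q1" "a * p = b * p1" using assms by (auto simp: lfrac_eq_iff)
  then have "lfrac q (- p) = lfrac q1 (- p1)" using assms 1 by (subst lfrac_eq_iff) auto
  then show "z = lfrac q (- p)" using z by simp
qed

text \<open>\<open>lf_act y p r\<close> says \<open>p y = r\<close>.\<close>

definition lf_act :: "'a::left_ore_domain lfract \<Rightarrow> 'a \<Rightarrow> 'a \<Rightarrow> bool" where
  "lf_act y p r \<longleftrightarrow> (if p = 0 then r = 0 else y = lfrac p r)"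

lemma lf_act_lfrac:
  assumes "a \<noteq> 0"
  shows "lf_act (lfrac a b) p r \<longleftrightarrow> (\<exists>c d. c \<noteq> 0 \<and> c * p = d * a \<and> c * r = d * b)"
proof (cases "p = 0")
  case True
  then show ?thesis using assms by (auto simp: lf_act_def intro: exI[of _ 1])
next
  case False
  have "lf_act (lfrac a b) p r \<longleftrightarrow> lfrac p r = lfrac a b" using False by (auto simp: lf_act_def)
  then show ?thesis using False assms by (simp add: lfrac_eq_iff)
qed

lemma lf_act_add:
  assumes "lf_act y p r" "lf_act y p' r'"
  shows "lf_act y (p + p') (r + r')"
proof -
  obtain a b where y: "a \<noteq> 0" "y = lfrac a b" by (rule lfrac_cases)
  obtain c d where 1: "c \<noteq> 0" "c * p = d * a" "c * r = d * b" using assms y by (auto simp: lf_act_lfrac)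
  obtain c' d' where 2: "c' \<noteq> 0" "c' * p' = d' * a" "c' * r' = d' * b" using assms y by (auto simp: lf_act_lfrac)
  obtain e f where 3: "e \<noteq> 0" "e * c = f * c'" using left_ore[OF \<open>c' \<noteq> 0\<close>] by blast
  have "(e * c) * (p + p') = e * (c * p) + f * (c' * p')" by (metis 3(2) distrib_left mult.assoc)
  also have "\<dots> = (e * d + f * d') * a" using 1 2 by (simp add: algebra_simps)
  finally have A: "(e * c) * (p + p') = (e * d + f * d') * a" .
  have "(e * c) * (r + r') = e * (c * r) + f * (c' * r')" by (metis 3(2) distrib_left mult.assoc)
  also have "\<dots> = (e * d + f * d') * b" using 1 2 by (simp add: algebra_simps)
  finally have B: "(e * c) * (r + r') = (e * d + f * d') * b" .
  have "e * c \<noteq> 0" using 1 3(1) by simp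
  then show ?thesis using A B y lf_act_lfrac[OF y(1)] by blast
qed

lemma lf_act_ex: "\<exists>c r. c \<noteq> 0 \<and> lf_act y (c * p) r"
  by (cases "p = 0") (auto simp: lf_act_def intro: exI[of _ 1] elim: lfrac_chain[where p = p and y = y])

lemma lf_act_scale: "c \<noteq> 0 \<Longrightarrow> lf_act y p r \<Longrightarrow> lf_act y (c * p) (c * r)"
  by (auto simp: lf_act_def lfrac_cancel)

lemma lfrac_mult_nz:
  assumes "q \<noteq> 0" "p \<noteq> 0"
  shows "lfrac q p * lfrac p r = lfrac q r"
proof -
  have "(THE z. \<exists>q1 p1 r1. q1 \<noteq> 0 \<and> p1 \<noteq> 0 \<and> lfrac q p = lfrac q1 p1 \<and> lfrac p r = lfrac p1 r1
     \<and> z = lfrac q1 r1) = lfrac q r"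
  proof (rule the_equality)
    show "\<exists>q1 p1 r1. q1 \<noteq> 0 \<and> p1 \<noteq> 0 \<and> lfrac q p = lfrac q1 p1 \<and> lfrac p r = lfrac p1 r1
     \<and> lfrac q r = lfrac q1 r1" using assms by blast
  next
    fix z
    assume "\<exists>q1 p1 r1. q1 \<noteq> 0 \<and> p1 \<noteq> 0 \<and> lfrac q p = lfrac q1 p1 \<and> lfrac p r = lfrac p1 r1
     \<and> z = lfrac q1 r1"
    then obtain q1 p1 r1 where 1: "q1 \<noteq> 0" "p1 \<noteq> 0" "lfrac q p = lfrac q1 p1" "lfrac p r = lfrac p1 r1"
      and z: "z = lfrac q1 r1" by blast
    obtain a b where 2: "a \<noteq> 0" "a * q = b * q1" "a * p = b * p1"
      using 1 assms by (auto simp: lfrac_eq_iff)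
    have b: "b \<noteq> 0" using 2 assms by (blast dest: ore_nz)
    have nz: "a * p \<noteq> 0" using 2(1) assms by simp
    have "lfrac (a * p) (a * r) = lfrac (a * p) (b * r1)"
      using 1 2 b assms by (metis lfrac_cancel)
    then have "a * r = b * r1" using nz by (simp add: lfrac_unique)
    then have "lfrac q r = lfrac q1 r1" using 2 1 assms by (subst lfrac_eq_iff) auto
    then show "z = lfrac q r" using z by simp
  qed
  then show ?thesis using assms by (simp add: times_lfract_def lfrac_eq_0_iff)
qed

lemma lfrac_mult:
  assumes "q \<noteq> 0" "lf_act y p r"
  shows "lfrac q p * y = lfrac q r"
proof (cases "p = 0")
  case True
  then have "lfrac q p = 0" "r = 0" using assms by (auto simp: lf_act_def lfrac_eq_0_iff)
  then show ?thesis using assms by (simp add: times_lfract_def lfrac_eq_0_iff)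
next
  case False
  then show ?thesis using assms by (simp add: lf_act_def lfrac_mult_nz)
qed

lemma lfrac_inverse:
  assumes "q \<noteq> 0" "p \<noteq> 0"
  shows "inverse (lfrac q p) = lfrac p q"
proof -
  have "(THE z. \<exists>q1 p1. q1 \<noteq> 0 \<and> p1 \<noteq> 0 \<and> lfrac q p = lfrac q1 p1 \<and> z = lfrac p1 q1) = lfrac p q"
  proof (rule the_equality)
    show "\<exists>q1 p1. q1 \<noteq> 0 \<and> p1 \<noteq> 0 \<and> lfrac q p = lfrac q1 p1 \<and> lfrac p q = lfrac p1 q1"
      using assms by blast
  next
    fix z
    assume "\<exists>q1 p1. q1 \<noteq> 0 \<and> p1 \<noteq> 0 \<and> lfrac q p = lfrac q1 p1 \<and> z = lfrac p1 q1"
    then obtain q1 p1 where 1: "q1 \<noteq> 0" "p1 \<noteq> 0" "lfrac q p = lfrac q1 p1" "z = lfrac p1 q1" by blast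
    then obtain a b where "a \<noteq> 0" "a * q = b * q1" "a * p = b * p1" using assms by (auto simp: lfrac_eq_iff)
    then have "lfrac p q = lfrac p1 q1" using 1 assms by (subst lfrac_eq_iff) auto
    then show "z = lfrac p q" using 1 by simp
  qed
  then show ?thesis using assms by (simp add: inverse_lfract_def lfrac_eq_0_iff)
qed

lemma lfrac_common3:
  obtains q p p' p'' where "q \<noteq> 0" "x = lfrac q p" "y = lfrac q p'" "z = lfrac q p''"
proof -
  obtain q p p' where 1: "q \<noteq> 0" "x = lfrac q p" "y = lfrac q p'" by (rule lfrac_common)
  obtain c r where 2: "c \<noteq> 0" "z = lfrac (c * q) r" using lfrac_chain[OF 1(1)] by blast
  show ?thesis
    by (rule that[of "c * q" "c * p" "c * p'" r]) (use 1 2 in \<open>auto simp: lfrac_cancel\<close>)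
qed

lemma lf_act_mult:
  assumes "lf_act y p r" "lf_act z r s"
  shows "lf_act (y * z) p s"
proof (cases "p = 0")
  case True
  then show ?thesis using assms by (auto simp: lf_act_def)
next
  case False
  then have "y * z = lfrac p s" using assms lfrac_mult[of p z r s] by (simp add: lf_act_def)
  then show ?thesis using False by (simp add: lf_act_def)
qed

instance lfract :: (left_ore_domain) division_ring
proof
  fix x y z :: "'a lfract"
  show "x + y + z = x + (y + z)"
    by (rule lfrac_common3[of x y z]) (simp add: lfrac_add add.assoc)
  show "x + y = y + x"
    by (rule lfrac_common[of x y]) (simp add: lfrac_add add.commute)
  have z: "0 = lfrac q 0" if "q \<noteq> 0" for q :: 'a
    using lfrac_eq_0_iff[OF that, of 0] by simp
  show "0 + x = x"
    by (rule lfrac_cases[of x]) (simp add: lfrac_add z)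
  show "- x + x = 0"
    by (rule lfrac_cases[of x]) (simp add: lfrac_add lfrac_uminus flip: z)
  show "x - y = x + - y" by (simp add: minus_lfract_def)
  show "x * y * z = x * (y * z)"
  proof -
    obtain q p where 1: "q \<noteq> 0" "x = lfrac q p" by (rule lfrac_cases)
    obtain c r where 2: "c \<noteq> 0" "lf_act y (c * p) r" using lf_act_ex by blast
    obtain d s where 3: "d \<noteq> 0" "lf_act z (d * r) s" using lf_act_ex by blast
    have 4: "lf_act y (d * c * p) (d * r)" using lf_act_scale[OF 3(1) 2(2)] by (simp add: mult.assoc)
    have 5: "x = lfrac (d * c * q) (d * c * p)" "d * c * q \<noteq> 0" using 1 2 3 by (auto simp: lfrac_cancel)
    have "x * y * z = lfrac (d * c * q) s"
      using lfrac_mult[OF 5(2) 4] lfrac_mult[OF 5(2) 3(2)] 5(1) by simp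
    also have "\<dots> = x * (y * z)"
      using lfrac_mult[OF 5(2) lf_act_mult[OF 4 3(2)]] 5(1) by simp
    finally show ?thesis .
  qed
  show "1 * x = x"
  proof -
    obtain q p where 1: "q \<noteq> 0" "x = lfrac q p" by (rule lfrac_cases)
    have "1 = lfrac q q" using 1 lfrac_cancel[of q 1 1] by (simp add: one_lfract_def)
    then have "1 * x = lfrac q q * lfrac q p" using 1 by (simp only:)
    then show ?thesis using 1 by (simp add: lfrac_mult_nz)
  qed
  show "x * 1 = x"
  proof -
    obtain q p where 1: "q \<noteq> 0" "x = lfrac q p" by (rule lfrac_cases)
    have "lf_act 1 p p" using lfrac_cancel[of p 1 1] by (simp add: one_lfract_def lf_act_def)
    then show ?thesis using 1 lfrac_mult by blast
  qed
  show "(x + y) * z = x * z + y * z"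
  proof -
    obtain q p p' where 1: "q \<noteq> 0" "x = lfrac q p" "y = lfrac q p'" by (rule lfrac_common)
    obtain c r where 2: "c \<noteq> 0" "lf_act z (c * p) r" using lf_act_ex by blast
    obtain d s where 3: "d \<noteq> 0" "lf_act z (d * (c * p')) s" using lf_act_ex by blast
    have 4: "lf_act z (d * (c * p)) (d * r)" using lf_act_scale[OF 3(1) 2(2)] .
    have 5: "x = lfrac (d * (c * q)) (d * (c * p))" "y = lfrac (d * (c * q)) (d * (c * p'))"
       "d * (c * q) \<noteq> 0" using 1 2 3 by (auto simp: lfrac_cancel)
    show ?thesis
      by (simp add: 5(1,2) lfrac_add[OF 5(3)] lfrac_mult[OF 5(3) 4] lfrac_mult[OF 5(3) 3(2)]
         lfrac_mult[OF 5(3) lf_act_add[OF 4 3(2)]])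
  qed
  show "x * (y + z) = x * y + x * z"
  proof (cases "x = 0")
    case True
    have "(0::'a lfract) + 0 = 0" using lfrac_add[of "1::'a" 0 0] by (simp add: zero_lfract_def)
    with True show ?thesis by (simp add: times_lfract_def)
  next
    case False
    obtain q p where 1: "q \<noteq> 0" "x = lfrac q p" by (rule lfrac_cases)
    then have p: "p \<noteq> 0" using False by (auto simp: lfrac_eq_0_iff)
    obtain c r where 2: "c \<noteq> 0" "y = lfrac (c * p) r" using lfrac_chain[OF p] by blast
    have cp: "c * p \<noteq> 0" using 2 p by simp
    obtain d s where 3: "d \<noteq> 0" "z = lfrac (d * (c * p)) s" using lfrac_chain[OF cp] by blast
    have dcp: "d * (c * p) \<noteq> 0" "d * (c * q) \<noteq> 0" using 1 2 3 p by auto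
    have 4: "x = lfrac (d * (c * q)) (d * (c * p))" "y = lfrac (d * (c * p)) (d * r)"
      using 1 2 3 cp by (auto simp: lfrac_cancel)
    show ?thesis using 3 dcp by (simp add: 4 lfrac_add lfrac_mult_nz)
  qed
  show "(0::'a lfract) \<noteq> 1" using lfrac_eq_0_iff[of 1 "1::'a"] by (auto simp: one_lfract_def)
  have one: "lfrac q q = 1" if "q \<noteq> 0" for q :: 'a
    using lfrac_cancel[OF that, of 1 1] by (simp add: one_lfract_def)
  show "inverse x * x = 1" if "x \<noteq> 0"
    by (rule lfrac_cases[of x]) (use that in \<open>auto simp: lfrac_eq_0_iff lfrac_inverse lfrac_mult_nz one\<close>)
  show "x * inverse x = 1" if "x \<noteq> 0"
    by (rule lfrac_cases[of x]) (use that in \<open>auto simp: lfrac_eq_0_iff lfrac_inverse lfrac_mult_nz one\<close>)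
  show "x div y = x * inverse y" by (simp add: divide_lfract_def)
  show "inverse (0::'a lfract) = 0" by (simp add: inverse_lfract_def)
qed

lemma lfract_of_0 [simp]: "lfract_of 0 = 0"
  by (simp add: lfract_of_def zero_lfract_def)

lemma lfract_of_1 [simp]: "lfract_of 1 = 1"
  by (simp add: lfract_of_def one_lfract_def)

lemma lfract_of_add: "lfract_of (a + b) = lfract_of a + lfract_of b"
  by (simp add: lfract_of_def lfrac_add)

lemma lfract_of_uminus: "lfract_of (- a) = - lfract_of a"
  by (simp add: lfract_of_def lfrac_uminus)

lemma lfract_of_diff: "lfract_of (a - b) = lfract_of a - lfract_of b"
  using lfract_of_add[of a "- b"] by (simp add: lfract_of_uminus)

lemma lfract_of_mult: "lfract_of (a * b) = lfract_of a * lfract_of b"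
proof -
  have "lf_act (lfrac 1 b) a (a * b)"
    using lfrac_cancel[of a 1 b] by (auto simp: lf_act_def)
  then show ?thesis by (simp add: lfract_of_def lfrac_mult)
qed

lemma lfract_of_eq_iff [simp]: "lfract_of a = lfract_of b \<longleftrightarrow> a = b"
  by (simp add: lfract_of_def lfrac_unique)

lemma lfract_of_eq_0_iff [simp]: "lfract_of a = 0 \<longleftrightarrow> a = 0"
  using lfract_of_eq_iff[of a 0] by (simp del: lfract_of_eq_iff)

lemma lfrac_conv: "q \<noteq> 0 \<Longrightarrow> lfrac q p = inverse (lfract_of q) * lfract_of p"
  by (simp add: lfract_of_def lfrac_inverse lfrac_mult_nz)

section \<open>Recurrence operators\<close>

text \<open>The field \<open>\<rat>(n)\<close>; the variable \<open>n\<close> is \<open>to_fract [:0, 1:]\<close>.\<close>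

type_synonym ratfun = "rat poly fract"

definition shift_poly :: "int \<Rightarrow> rat poly \<Rightarrow> rat poly" where
  "shift_poly i p = p \<circ>\<^sub>p [:of_int i, 1:]"

lemma shift_poly_simps [simp]:
  "shift_poly i 0 = 0" "shift_poly i 1 = 1"
  "shift_poly i (p + q) = shift_poly i p + shift_poly i q"
  "shift_poly i (p * q) = shift_poly i p * shift_poly i q"
  "shift_poly i (- p) = - shift_poly i p"
  by (simp_all add: shift_poly_def pcompose_add pcompose_mult pcompose_uminus pcompose_1)

lemma shift_poly_0 [simp]: "shift_poly 0 p = p"
  by (simp add: shift_poly_def)

lemma shift_poly_shift_poly [simp]: "shift_poly i (shift_poly j p) = shift_poly (i + j) p"
  by (simp add: shift_poly_def pcompose_pCons algebra_simps flip: pcompose_assoc)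

lemma shift_poly_eq_0_iff [simp]: "shift_poly i p = 0 \<longleftrightarrow> p = 0"
proof
  assume "shift_poly i p = 0"
  then have "shift_poly (- i) (shift_poly i p) = 0" by (simp del: shift_poly_shift_poly)
  then show "p = 0" by simp
qed simp

text \<open>\<open>shift i a\<close> is \<open>a(n + i)\<close>.\<close>

definition shift :: "int \<Rightarrow> ratfun \<Rightarrow> ratfun" where
  "shift i a = Fract (shift_poly i (fst (quot_of_fract a))) (shift_poly i (snd (quot_of_fract a)))"

lemma shift_Fract:
  assumes "q \<noteq> 0"
  shows "shift i (Fract p q) = Fract (shift_poly i p) (shift_poly i q)"
proof -
  obtain a b where ab: "quot_of_fract (Fract p q) = (a, b)" by (cases "quot_of_fract (Fract p q)")
  have b: "b \<noteq> 0" using snd_quot_of_fract_nonzero[of "Fract p q"] ab by simp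
  have "Fract a b = Fract p q" using Fract_quot_of_fract[of "Fract p q"] ab by simp
  then have "a * q = p * b" using b assms by (simp add: eq_fract)
  then have "shift_poly i a * shift_poly i q = shift_poly i p * shift_poly i b"
    by (metis shift_poly_simps(4))
  then show ?thesis using b assms by (simp add: shift_def ab eq_fract)
qed

lemma shift_0 [simp]: "shift 0 a = a"
  by (cases a) (simp add: shift_Fract)

lemma shift_shift [simp]: "shift i (shift j a) = shift (i + j) a"
  by (cases a) (simp add: shift_Fract)

lemma shift_zero [simp]: "shift i 0 = 0"
  by (simp add: Zero_fract_def shift_Fract)

lemma shift_one [simp]: "shift i 1 = 1"
  by (simp add: One_fract_def shift_Fract)

lemma shift_add [simp]: "shift i (a + b) = shift i a + shift i b"
  by (cases a; cases b) (simp add: shift_Fract)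

lemma shift_mult [simp]: "shift i (a * b) = shift i a * shift i b"
  by (cases a; cases b) (simp add: shift_Fract)

lemma shift_uminus [simp]: "shift i (- a) = - shift i a"
  by (cases a) (simp add: shift_Fract)

lemma shift_eq_0_iff [simp]: "shift i a = 0 \<longleftrightarrow> a = 0"
proof
  assume "shift i a = 0"
  then have "shift (- i) (shift i a) = 0" by (simp del: shift_shift)
  then show "a = 0" by simp
qed simp

lemma shift_sum: "shift i (sum f A) = (\<Sum>x\<in>A. shift i (f x))"
  by (induction A rule: infinite_finite_induct) auto

text \<open>The ring \<open>\<rat>(n)\<langle>S, S\<^sup>-\<^sup>1; S\<rangle>\<close>; \<open>rcoeff P i\<close> is the left coefficient of \<open>S\<^sup>i\<close>.\<close>

typedef recop = "{f :: int \<Rightarrow> ratfun. finite {i. f i \<noteq> 0}}"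
  morphisms rcoeff Abs_recop
  by (rule exI[of _ "\<lambda>_. 0"]) simp

definition rsupp :: "recop \<Rightarrow> int set" where
  "rsupp P = {i. rcoeff P i \<noteq> 0}"

lemma finite_rsupp [simp, intro]: "finite (rsupp P)"
  using rcoeff[of P] by (simp add: rsupp_def)

lemma rcoeff_Abs: "finite {i. f i \<noteq> 0} \<Longrightarrow> rcoeff (Abs_recop f) = f"
  by (simp add: Abs_recop_inverse)

lemma rcoeff_Abs_on: "finite A \<Longrightarrow> (\<And>i. i \<notin> A \<Longrightarrow> f i = 0) \<Longrightarrow> rcoeff (Abs_recop f) = f"
  by (rule rcoeff_Abs) (metis (mono_tags, lifting) finite_subset mem_Collect_eq subsetI)

lemma not_in_rsupp: "i \<notin> rsupp P \<longleftrightarrow> rcoeff P i = 0"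
  by (simp add: rsupp_def)

lemma recop_eqI: "(\<And>i. rcoeff P i = rcoeff Q i) \<Longrightarrow> P = Q"
  by (metis ext rcoeff_inverse)

instantiation recop :: "{zero, one, plus, minus, uminus, times}"
begin

definition zero_recop :: recop where "0 = Abs_recop (\<lambda>_. 0)"

definition one_recop :: recop where "1 = Abs_recop (\<lambda>i. if i = 0 then 1 else 0)"

definition plus_recop :: "recop \<Rightarrow> recop \<Rightarrow> recop" where
  "P + Q = Abs_recop (\<lambda>i. rcoeff P i + rcoeff Q i)"

definition uminus_recop :: "recop \<Rightarrow> recop" where
  "- P = Abs_recop (\<lambda>i. - rcoeff P i)"

definition minus_recop :: "recop \<Rightarrow> recop \<Rightarrow> recop" where
  "P - Q = P + (- Q :: recop)"

text \<open>\<open>(a S\<^sup>i) (b S\<^sup>j) = a b(n + i) S\<^bsup>i + j\<^esup>\<close>\<close>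

definition times_recop :: "recop \<Rightarrow> recop \<Rightarrow> recop" where
  "P * Q = Abs_recop (\<lambda>m. \<Sum>i | rcoeff P i \<noteq> 0. rcoeff P i * shift i (rcoeff Q (m - i)))"

instance ..

end

lemma rcoeff_0 [simp]: "rcoeff 0 i = 0"
  by (simp add: zero_recop_def rcoeff_Abs)

lemma rcoeff_1: "rcoeff 1 i = (if i = 0 then 1 else 0)"
  unfolding one_recop_def by (subst rcoeff_Abs_on[of "{0}"]) auto

lemma rcoeff_add [simp]: "rcoeff (P + Q) i = rcoeff P i + rcoeff Q i"
  unfolding plus_recop_def by (subst rcoeff_Abs_on[of "rsupp P \<union> rsupp Q"]) (auto simp: not_in_rsupp)

lemma rcoeff_uminus [simp]: "rcoeff (- P) i = - rcoeff P i"
  unfolding uminus_recop_def by (subst rcoeff_Abs_on[of "rsupp P"]) (auto simp: not_in_rsupp)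

lemma rcoeff_diff [simp]: "rcoeff (P - Q) i = rcoeff P i - rcoeff Q i"
  by (simp add: minus_recop_def)

lemma rcoeff_mult_rsupp: "rcoeff (P * Q) m = (\<Sum>i\<in>rsupp P. rcoeff P i * shift i (rcoeff Q (m - i)))"
proof -
  let ?f = "\<lambda>m. \<Sum>i\<in>rsupp P. rcoeff P i * shift i (rcoeff Q (m - i))"
  have "rcoeff (Abs_recop ?f) = ?f"
  proof (rule rcoeff_Abs_on)
    show "finite ((\<lambda>(i, j). i + j) ` (rsupp P \<times> rsupp Q))" by simp
    fix m assume m: "m \<notin> (\<lambda>(i, j). i + j) ` (rsupp P \<times> rsupp Q)"
    show "?f m = 0"
    proof (rule sum.neutral, rule ballI)
      fix i assume i: "i \<in> rsupp P"
      have "m - i \<notin> rsupp Q"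
      proof
        assume "m - i \<in> rsupp Q"
        then have "(\<lambda>(i, j). i + j) (i, m - i) \<in> (\<lambda>(i, j). i + j) ` (rsupp P \<times> rsupp Q)"
          using i by blast
        then show False using m by simp
      qed
      then show "rcoeff P i * shift i (rcoeff Q (m - i)) = 0" by (simp add: not_in_rsupp)
    qed
  qed
  then show ?thesis unfolding times_recop_def rsupp_def by simp
qed

lemma rcoeff_mult:
  assumes "finite A" "rsupp P \<subseteq> A"
  shows "rcoeff (P * Q) m = (\<Sum>i\<in>A. rcoeff P i * shift i (rcoeff Q (m - i)))"
  unfolding rcoeff_mult_rsupp
  by (rule sum.mono_neutral_left) (use assms in \<open>auto simp: rsupp_def\<close>)

lemma rsupp_mult: "rsupp (P * Q) \<subseteq> (\<lambda>(i, j). i + j) ` (rsupp P \<times> rsupp Q)"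
proof
  fix m assume "m \<in> rsupp (P * Q)"
  then have "(\<Sum>i\<in>rsupp P. rcoeff P i * shift i (rcoeff Q (m - i))) \<noteq> 0"
    by (simp add: rsupp_def[of "P * Q"] rcoeff_mult_rsupp)
  then obtain i where "i \<in> rsupp P" "rcoeff P i * shift i (rcoeff Q (m - i)) \<noteq> 0"
    by (meson sum.neutral)
  then have "i \<in> rsupp P" "m - i \<in> rsupp Q" by (auto simp: rsupp_def)
  then have "(\<lambda>(i, j). i + j) (i, m - i) \<in> (\<lambda>(i, j). i + j) ` (rsupp P \<times> rsupp Q)" by blast
  then show "m \<in> (\<lambda>(i, j). i + j) ` (rsupp P \<times> rsupp Q)" by simp
qed

lemma recop_mult_assoc: "(P * Q) * R = P * (Q * (R :: recop))"
proof (rule recop_eqI)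
  fix m
  let ?C = "(\<lambda>(i, j). i + j) ` (rsupp P \<times> rsupp Q)"
  have "rcoeff ((P * Q) * R) m = (\<Sum>l\<in>?C. rcoeff (P * Q) l * shift l (rcoeff R (m - l)))"
    by (rule rcoeff_mult) (simp, rule rsupp_mult)
  also have "\<dots> = (\<Sum>l\<in>?C. \<Sum>i\<in>rsupp P. rcoeff P i * (shift i (rcoeff Q (l - i)) * shift l (rcoeff R (m - l))))"
    by (simp add: rcoeff_mult_rsupp sum_distrib_right mult.assoc)
  also have "\<dots> = (\<Sum>i\<in>rsupp P. \<Sum>l\<in>?C. rcoeff P i * (shift i (rcoeff Q (l - i)) * shift l (rcoeff R (m - l))))"
    by (rule sum.swap)
  also have "\<dots> = (\<Sum>i\<in>rsupp P. rcoeff P i * (\<Sum>l\<in>?C. shift i (rcoeff Q (l - i)) * shift l (rcoeff R (m - l))))"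
    by (simp add: sum_distrib_left)
  also have "\<dots> = (\<Sum>i\<in>rsupp P. rcoeff P i * shift i (rcoeff (Q * R) (m - i)))"
  proof (rule sum.cong[OF refl], rule arg_cong[where f = "\<lambda>x. _ * x"])
    fix i assume i: "i \<in> rsupp P"
    have "(\<Sum>l\<in>?C. shift i (rcoeff Q (l - i)) * shift l (rcoeff R (m - l))) =
          (\<Sum>l\<in>(\<lambda>j. i + j) ` rsupp Q. shift i (rcoeff Q (l - i)) * shift l (rcoeff R (m - l)))"
    proof (rule sum.mono_neutral_right)
      show "finite ?C" by simp
      show "(\<lambda>j. i + j) ` rsupp Q \<subseteq> ?C" using i by force
      show "\<forall>l\<in>?C - (\<lambda>j. i + j) ` rsupp Q. shift i (rcoeff Q (l - i)) * shift l (rcoeff R (m - l)) = 0"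
      proof
        fix l assume l: "l \<in> ?C - (\<lambda>j. i + j) ` rsupp Q"
        have "l - i \<notin> rsupp Q"
        proof
          assume "l - i \<in> rsupp Q"
          then have "i + (l - i) \<in> (\<lambda>j. i + j) ` rsupp Q" by (rule imageI)
          with l show False by simp
        qed
        then show "shift i (rcoeff Q (l - i)) * shift l (rcoeff R (m - l)) = 0"
          by (simp add: not_in_rsupp)
      qed
    qed
    also have "\<dots> = (\<Sum>j\<in>rsupp Q. shift i (rcoeff Q j) * shift (i + j) (rcoeff R (m - (i + j))))"
      by (subst sum.reindex) (auto simp: inj_on_def)
    also have "\<dots> = shift i (rcoeff (Q * R) (m - i))"
      by (simp add: rcoeff_mult_rsupp shift_sum diff_diff_eq)
    finally show "(\<Sum>l\<in>?C. shift i (rcoeff Q (l - i)) * shift l (rcoeff R (m - l))) =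
      shift i (rcoeff (Q * R) (m - i))" .
  qed
  also have "\<dots> = rcoeff (P * (Q * R)) m" by (simp add: rcoeff_mult_rsupp)
  finally show "rcoeff ((P * Q) * R) m = rcoeff (P * (Q * R)) m" .
qed

lemma recop_eq_0_iff: "P = (0 :: recop) \<longleftrightarrow> rsupp P = {}"
  by (auto simp: rsupp_def intro: recop_eqI)

lemma rcoeff_mult_top:
  assumes "\<And>i. i \<in> rsupp P \<Longrightarrow> i \<le> M" "\<And>i. i \<in> rsupp Q \<Longrightarrow> i \<le> N"
  shows "rcoeff (P * Q) (M + N) = rcoeff P M * shift M (rcoeff Q N)"
proof -
  have "rcoeff (P * Q) (M + N) = (\<Sum>i\<in>insert M (rsupp P). rcoeff P i * shift i (rcoeff Q (M + N - i)))"
    by (rule rcoeff_mult) auto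
  also have "\<dots> = (\<Sum>i\<in>{M}. rcoeff P i * shift i (rcoeff Q (M + N - i)))"
  proof (rule sum.mono_neutral_right)
    show "\<forall>i\<in>insert M (rsupp P) - {M}. rcoeff P i * shift i (rcoeff Q (M + N - i)) = 0"
    proof
      fix i assume "i \<in> insert M (rsupp P) - {M}"
      then have "i < M" using assms(1)[of i] by auto
      then have "M + N - i \<notin> rsupp Q" using assms(2)[of "M + N - i"] by auto
      then show "rcoeff P i * shift i (rcoeff Q (M + N - i)) = 0" by (simp add: not_in_rsupp)
    qed
  qed auto
  finally show ?thesis by simp
qed

instance recop :: ring_1
proof
  fix P Q R :: recop
  show "P * Q * R = P * (Q * R)" by (rule recop_mult_assoc)
  show "P + Q + R = P + (Q + R)" by (rule recop_eqI) (simp add: add.assoc)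
  show "P + Q = Q + P" by (rule recop_eqI) (simp add: add.commute)
  show "0 + P = P" by (rule recop_eqI) simp
  show "- P + P = 0" by (rule recop_eqI) simp
  show "P - Q = P + - Q" by (simp add: minus_recop_def)
  show "1 * P = P"
  proof (rule recop_eqI)
    fix m
    have "rcoeff (1 * P) m = (\<Sum>i\<in>{0}. rcoeff 1 i * shift i (rcoeff P (m - i)))"
      by (rule rcoeff_mult) (auto simp: rsupp_def rcoeff_1 split: if_splits)
    then show "rcoeff (1 * P) m = rcoeff P m" by (simp add: rcoeff_1)
  qed
  show "P * 1 = P"
  proof (rule recop_eqI)
    fix m
    have "rcoeff (P * 1) m = (\<Sum>i\<in>insert m (rsupp P). rcoeff P i * shift i (rcoeff 1 (m - i)))"
      by (rule rcoeff_mult) auto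
    also have "\<dots> = (\<Sum>i\<in>insert m (rsupp P). if i = m then rcoeff P i else 0)"
      by (rule sum.cong) (auto simp: rcoeff_1)
    finally show "rcoeff (P * 1) m = rcoeff P m" by simp
  qed
  show "(P + Q) * R = P * R + Q * R"
  proof (rule recop_eqI)
    fix m
    let ?A = "rsupp P \<union> rsupp Q"
    have "rcoeff ((P + Q) * R) m = (\<Sum>i\<in>?A. rcoeff (P + Q) i * shift i (rcoeff R (m - i)))"
      by (rule rcoeff_mult) (simp, auto simp: rsupp_def)
    also have "\<dots> = (\<Sum>i\<in>?A. rcoeff P i * shift i (rcoeff R (m - i))) +
      (\<Sum>i\<in>?A. rcoeff Q i * shift i (rcoeff R (m - i)))"
      by (simp add: distrib_right sum.distrib)
    also have "\<dots> = rcoeff (P * R) m + rcoeff (Q * R) m"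
      by (simp add: rcoeff_mult[of ?A])
    finally show "rcoeff ((P + Q) * R) m = rcoeff (P * R + Q * R) m" by simp
  qed
  show "P * (Q + R) = P * Q + P * R"
    by (rule recop_eqI) (simp add: rcoeff_mult_rsupp distrib_left sum.distrib)
  show "(0::recop) \<noteq> 1"
  proof
    assume "(0::recop) = 1"
    then have "rcoeff 0 0 = rcoeff 1 0" by simp
    then show False by (simp add: rcoeff_1 del: rcoeff_0) (simp add: rcoeff_0)
  qed
qed

instance recop :: ring_1_no_zero_divisors
proof
  fix P Q :: recop
  show "P * Q \<noteq> 0" if "P \<noteq> 0" "Q \<noteq> 0"
  proof
    assume PQ: "P * Q = 0"
    have ne: "rsupp P \<noteq> {}" "rsupp Q \<noteq> {}" using that by (auto simp: recop_eq_0_iff)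
    have "rcoeff (P * Q) (Max (rsupp P) + Max (rsupp Q)) =
        rcoeff P (Max (rsupp P)) * shift (Max (rsupp P)) (rcoeff Q (Max (rsupp Q)))"
      by (rule rcoeff_mult_top) auto
    moreover have "Max (rsupp P) \<in> rsupp P" "Max (rsupp Q) \<in> rsupp Q" using ne by auto
    then have "rcoeff P (Max (rsupp P)) \<noteq> 0" "rcoeff Q (Max (rsupp Q)) \<noteq> 0"
      by (simp_all only: not_in_rsupp[symmetric] not_not)
    ultimately show False using PQ by simp
  qed
qed

text \<open>The monomial \<open>a S\<^sup>i\<close>\<close>

definition rmonom :: "ratfun \<Rightarrow> int \<Rightarrow> recop" where
  "rmonom a i = Abs_recop (\<lambda>j. if j = i then a else 0)"

lemma rcoeff_rmonom: "rcoeff (rmonom a i) j = (if j = i then a else 0)"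
  unfolding rmonom_def by (subst rcoeff_Abs_on[of "{i}"]) auto

lemma rcoeff_rmonom_mult: "rcoeff (rmonom a i * P) m = a * shift i (rcoeff P (m - i))"
proof -
  have "rcoeff (rmonom a i * P) m = (\<Sum>j\<in>{i}. rcoeff (rmonom a i) j * shift j (rcoeff P (m - j)))"
    by (rule rcoeff_mult) (auto simp: rsupp_def rcoeff_rmonom split: if_splits)
  then show ?thesis by (simp add: rcoeff_rmonom)
qed

lemma rmonom_mult: "rmonom a i * rmonom b j = rmonom (a * shift i b) (i + j)"
  by (rule recop_eqI) (auto simp: rcoeff_rmonom_mult rcoeff_rmonom)

lemma rmonom_add: "rmonom a i + rmonom b i = rmonom (a + b) i"
  by (rule recop_eqI) (auto simp: rcoeff_rmonom)

lemma rmonom_uminus: "- rmonom a i = rmonom (- a) i"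
  by (rule recop_eqI) (auto simp: rcoeff_rmonom)

lemma rmonom_1_0: "rmonom 1 0 = 1"
  by (rule recop_eqI) (auto simp: rcoeff_rmonom rcoeff_1)

lemma rmonom_0 [simp]: "rmonom 0 i = 0"
  by (rule recop_eqI) (auto simp: rcoeff_rmonom)

lemma rmonom_eq_0_iff [simp]: "rmonom a i = 0 \<longleftrightarrow> a = 0"
  by (metis rcoeff_rmonom rcoeff_0 rmonom_0)

subsection \<open>Right Euclidean division and the Ore condition\<close>

lemma recop_div:
  fixes B :: recop
  assumes h: "rcoeff B h \<noteq> 0" and B: "rsupp B \<subseteq> {h - int w..h}"
  shows "rsupp A \<subseteq> {l..<l + int m} \<Longrightarrow> \<exists>Q R l'. A = Q * B + R \<and> rsupp R \<subseteq> {l'..<l' + int w}"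
proof (induction m arbitrary: A)
  case 0
  then have "rsupp A = {}" by simp
  then show ?case by (intro exI[of _ 0] exI[of _ A]) auto
next
  case (Suc m)
  show ?case
  proof (cases "Suc m \<le> w")
    case True
    then have "rsupp A \<subseteq> {l..<l + int w}" using Suc.prems by force
    then show ?thesis by (intro exI[of _ 0] exI[of _ A] exI[of _ l]) auto
  next
    case False
    define t where "t = l + int m"
    define a where "a = rcoeff A t / shift (t - h) (rcoeff B h)"
    define A' where "A' = A - rmonom a (t - h) * B"
    have c: "rcoeff A' j = rcoeff A j - a * shift (t - h) (rcoeff B (j - (t - h)))" for j
      by (simp add: A'_def rcoeff_rmonom_mult)
    have "rsupp A' \<subseteq> {l..<l + int m}"
    proof
      fix j assume j: "j \<in> rsupp A'"
      show "j \<in> {l..<l + int m}"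
      proof (rule ccontr)
        assume "j \<notin> {l..<l + int m}"
        then consider "j = t" | "j < l \<or> j > t" by (force simp: t_def)
        then show False
        proof cases
          case 1
          then have "rcoeff A' j = 0" using h by (simp add: c a_def)
          then show False using j by (simp add: rsupp_def)
        next
          case 2
          have "j \<notin> rsupp A" using 2 Suc.prems by (force simp: t_def)
          moreover have "j - (t - h) \<notin> rsupp B"
            using 2 B False by (force simp: t_def)
          ultimately have "rcoeff A' j = 0" by (simp add: c not_in_rsupp)
          then show False using j by (simp add: rsupp_def)
        qed
      qed
    qed
    then obtain Q R l' where "A' = Q * B + R" and R: "rsupp R \<subseteq> {l'..<l' + int w}"
      using Suc.IH by blast
    then have "A = (Q + rmonom a (t - h)) * B + R"
      by (simp add: A'_def distrib_right) (metis add.assoc add.commute diff_add_cancel)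
    with R show ?thesis by blast
  qed
qed

lemma recop_ore:
  fixes A B :: recop
  assumes "B \<noteq> 0"
  shows "\<exists>C D. C \<noteq> 0 \<and> C * A = D * B"
proof -
  have "\<exists>C D. C \<noteq> 0 \<and> C * A = D * B" if "rsupp B \<subseteq> {l..<l + int w}" "B \<noteq> 0" for w l A B
    using that
  proof (induction w arbitrary: A B l rule: less_induct)
    case (less w)
    have ne: "rsupp B \<noteq> {}" using less.prems by (simp add: recop_eq_0_iff)
    define h where "h = Max (rsupp B)"
    have h: "h \<in> rsupp B" using ne by (simp add: h_def)
    have hw: "l \<le> h" "h < l + int w" using h less.prems(1) by auto
    define v where "v = nat (h - l)"
    have v: "v < w" using hw by (simp add: v_def)
    have B: "rsupp B \<subseteq> {h - int v..h}"
      using less.prems(1) hw by (auto simp: v_def h_def)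
    obtain k m where A: "rsupp A \<subseteq> {k..<k + int m}"
    proof (cases "rsupp A = {}")
      case True
      then show ?thesis using that[of 0 0] by simp
    next
      case False
      have "rsupp A \<subseteq> {Min (rsupp A)..Max (rsupp A)}" by auto
      also have "\<dots> \<subseteq> {Min (rsupp A)..<Min (rsupp A) + int (nat (Max (rsupp A) - Min (rsupp A) + 1))}"
        by auto
      finally show ?thesis using that by blast
    qed
    obtain Q R l' where Q: "A = Q * B + R" and R: "rsupp R \<subseteq> {l'..<l' + int v}"
      using recop_div[OF _ B A] h by (auto simp: rsupp_def)
    show ?case
    proof (cases "R = 0")
      case True
      then show ?thesis using Q by (intro exI[of _ 1] exI[of _ Q]) simp
    next
      case False
      then obtain C D where CD: "C \<noteq> 0" "C * B = D * R" using less.IH[OF v R] by blast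
      have "C * B \<noteq> 0" using CD(1) less.prems(2) by simp
      then have "D \<noteq> 0" using CD(2) by auto
      moreover have "D * A = (D * Q + C) * B"
        using Q CD(2) by (simp add: distrib_left distrib_right mult.assoc)
      ultimately show ?thesis by blast
    qed
  qed
  note * = this
  show ?thesis
  proof (rule *[OF _ assms])
    show "rsupp B \<subseteq> {Min (rsupp B)..<Min (rsupp B) + int (nat (Max (rsupp B) - Min (rsupp B) + 1))}"
    proof
      fix i assume i: "i \<in> rsupp B"
      then have "Min (rsupp B) \<le> i" "i \<le> Max (rsupp B)" by auto
      then show "i \<in> {Min (rsupp B)..<Min (rsupp B) + int (nat (Max (rsupp B) - Min (rsupp B) + 1))}" by auto
    qed
  qed
qed

instance recop :: left_ore_domain
  by standard (rule recop_ore)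

section \<open>Differential operators\<close>

text \<open>The differential operator \<open>p\<^sub>0 + p\<^sub>1 \<partial>\<^sub>x + \<dots> + p\<^sub>k \<partial>\<^sub>x\<^sup>k\<close> is represented by the polynomial
  with coefficients \<open>p\<^sub>0, \<dots>, p\<^sub>k\<close>; only the product differs.
  \<open>dx_mult M\<close> is \<open>\<partial>\<^sub>x M\<close>, from \<open>\<partial>\<^sub>x p = p \<partial>\<^sub>x + p'\<close>.\<close>

definition dx_mult :: "rat poly poly \<Rightarrow> rat poly poly" where
  "dx_mult M = pCons 0 M + map_poly pderiv M"

definition diff_mult :: "rat poly poly \<Rightarrow> rat poly poly \<Rightarrow> rat poly poly" where
  "diff_mult L M = (\<Sum>i\<le>degree L. smult (coeff L i) ((dx_mult ^^ i) M))"

lemma dx_mult_add: "dx_mult (M + N) = dx_mult M + dx_mult N"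
  by (rule poly_eqI) (simp add: dx_mult_def coeff_map_poly pderiv_add coeff_pCons split: nat.split)

lemma dx_mult_0 [simp]: "dx_mult 0 = 0"
  by (simp add: dx_mult_def)

lemma dx_mult_smult: "dx_mult (smult p M) = smult p (dx_mult M) + smult (pderiv p) M"
  by (rule poly_eqI)
    (simp add: dx_mult_def coeff_map_poly pderiv_mult coeff_pCons algebra_simps split: nat.split)

lemma dx_mult_pow_add: "(dx_mult ^^ i) (M + N) = (dx_mult ^^ i) M + (dx_mult ^^ i) N"
  by (induction i) (simp_all add: dx_mult_add)

lemma dx_mult_pow_0 [simp]: "(dx_mult ^^ i) 0 = 0"
  by (induction i) simp_all

lemma diff_mult_le:
  assumes "degree L \<le> n"
  shows "diff_mult L M = (\<Sum>i\<le>n. smult (coeff L i) ((dx_mult ^^ i) M))"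
  unfolding diff_mult_def
  by (rule sum.mono_neutral_left) (use assms in \<open>auto simp: coeff_eq_0\<close>)

lemma diff_mult_0_left [simp]: "diff_mult 0 M = 0"
  by (simp add: diff_mult_def)

lemma diff_mult_pCons: "diff_mult (pCons p L) M = smult p M + diff_mult L (dx_mult M)"
proof -
  have "diff_mult (pCons p L) M =
      (\<Sum>i\<le>Suc (degree L). smult (coeff (pCons p L) i) ((dx_mult ^^ i) M))"
    by (rule diff_mult_le) (rule degree_pCons_le)
  also have "\<dots> = smult p M + (\<Sum>i\<le>degree L. smult (coeff L i) ((dx_mult ^^ i) (dx_mult M)))"
    by (simp add: sum.atMost_Suc_shift funpow_swap1 del: sum.atMost_Suc)
  finally show ?thesis by (simp add: diff_mult_def)
qed

lemma diff_mult_add_left: "diff_mult (L + L') M = diff_mult L M + diff_mult L' M"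
proof -
  let ?n = "max (degree L) (degree L')"
  have "degree (L + L') \<le> ?n" by (rule degree_add_le) auto
  then show ?thesis
    by (simp add: diff_mult_le[where n = ?n] smult_add_left sum.distrib)
qed

lemma diff_mult_add_right: "diff_mult L (M + M') = diff_mult L M + diff_mult L M'"
  by (simp add: diff_mult_def dx_mult_pow_add smult_add_right sum.distrib)

lemma diff_mult_smult_left: "diff_mult (smult p L) M = smult p (diff_mult L M)"
  by (induction L arbitrary: M) (simp_all add: diff_mult_pCons smult_add_right)

lemma dx_mult_pCons: "dx_mult (pCons p L) = pCons (pderiv p) (pCons p L + map_poly pderiv L)"
  by (simp add: dx_mult_def map_poly_pCons)

lemma dx_mult_diff_mult: "dx_mult (diff_mult L M) = diff_mult (dx_mult L) M"
proof (induction L arbitrary: M)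
  case 0
  then show ?case by simp
next
  case (pCons p L)
  have "dx_mult (diff_mult (pCons p L) M) =
      smult p (dx_mult M) + smult (pderiv p) M + diff_mult (dx_mult L) (dx_mult M)"
    by (simp add: diff_mult_pCons dx_mult_add dx_mult_smult pCons.IH)
  also have "diff_mult (dx_mult L) (dx_mult M) =
      diff_mult L (dx_mult (dx_mult M)) + diff_mult (map_poly pderiv L) (dx_mult M)"
    by (simp add: dx_mult_def[of L] diff_mult_add_left diff_mult_pCons)
  finally show ?case
    by (simp add: dx_mult_pCons diff_mult_pCons diff_mult_add_left algebra_simps)
qed

lemma diff_mult_assoc: "diff_mult (diff_mult L M) N = diff_mult L (diff_mult M N)"
  by (induction L arbitrary: M)
    (simp_all add: diff_mult_pCons diff_mult_add_left diff_mult_smult_left dx_mult_diff_mult)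

lemma dx_mult_monom: "dx_mult (monom 1 i) = monom 1 (Suc i)"
  by (simp add: dx_mult_def map_poly_monom monom_Suc)

lemma dx_mult_pow_1: "(dx_mult ^^ i) 1 = monom 1 i"
  by (induction i) (simp_all add: dx_mult_monom)

lemma diff_mult_1_right: "diff_mult L 1 = L"
  using poly_as_sum_of_monoms[of L]
  by (simp add: diff_mult_def dx_mult_pow_1 smult_monom)

lemma diff_mult_1_left: "diff_mult 1 M = M"
  using diff_mult_pCons[of 1 0 M] one_pCons[where 'a = "rat poly"] by simp

text \<open>The ring \<open>\<rat>[x]\<langle>\<partial>\<^sub>x; Id, d/dx\<rangle>\<close>\<close>

typedef diffop = "UNIV :: rat poly poly set"
  morphisms dop_poly Abs_diffop
  by simp

setup_lifting type_definition_diffop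

instantiation diffop :: ring_1
begin

lift_definition zero_diffop :: diffop is 0 .
lift_definition one_diffop :: diffop is 1 .
lift_definition plus_diffop :: "diffop \<Rightarrow> diffop \<Rightarrow> diffop" is "(+)" .
lift_definition minus_diffop :: "diffop \<Rightarrow> diffop \<Rightarrow> diffop" is "(-)" .
lift_definition uminus_diffop :: "diffop \<Rightarrow> diffop" is uminus .
lift_definition times_diffop :: "diffop \<Rightarrow> diffop \<Rightarrow> diffop" is diff_mult .

instance
proof
  fix a b c :: diffop
  show "a * b * c = a * (b * c)" by transfer (rule diff_mult_assoc)
  show "1 * a = a" by transfer (rule diff_mult_1_left)
  show "a * 1 = a" by transfer (rule diff_mult_1_right)
  show "(a + b) * c = a * c + b * c" by transfer (rule diff_mult_add_left)
  show "a * (b + c) = a * b + a * c" by transfer (rule diff_mult_add_right)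
  show "(0::diffop) \<noteq> 1" by transfer simp
qed (transfer; simp add: algebra_simps; fail)+

end

definition dop_of_poly :: "rat poly \<Rightarrow> diffop" where
  "dop_of_poly p = Abs_diffop [:p:]"

definition dx :: diffop where
  "dx = Abs_diffop [:0, 1:]"

definition dop_coeff :: "diffop \<Rightarrow> nat \<Rightarrow> rat poly" where
  "dop_coeff L = coeff (dop_poly L)"

definition dop_order :: "diffop \<Rightarrow> nat" where
  "dop_order L = degree (dop_poly L)"

lemma dop_poly_of_poly: "dop_poly (dop_of_poly p) = [:p:]"
  by (simp add: dop_of_poly_def Abs_diffop_inverse)

lemma dop_poly_dx: "dop_poly dx = [:0, 1:]"
  by (simp add: dx_def Abs_diffop_inverse)

lemmas dop_poly_simps =
  zero_diffop.rep_eq one_diffop.rep_eq plus_diffop.rep_eq times_diffop.rep_eq dop_poly_of_poly dop_poly_dx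

lemma dx_dop_of_poly: "dx * dop_of_poly p = dop_of_poly p * dx + dop_of_poly (pderiv p)"
  by (simp add: diff_mult_pCons dx_mult_pCons dop_poly_simps flip: dop_poly_inject)

lemma dop_of_poly_add: "dop_of_poly (p + q) = dop_of_poly p + dop_of_poly q"
  by (simp add: dop_poly_simps flip: dop_poly_inject)

lemma dop_of_poly_mult: "dop_of_poly (p * q) = dop_of_poly p * dop_of_poly q"
  by (simp add: diff_mult_pCons dop_poly_simps flip: dop_poly_inject)

lemma dop_poly_dx_power: "dop_poly (dx ^ i) = monom 1 i"
proof (induction i)
  case 0
  then show ?case by (simp add: one_diffop.rep_eq)
next
  case (Suc i)
  have "dop_poly (dx ^ Suc i) = diff_mult [:0, 1:] (dop_poly (dx ^ i))"
    by (simp add: dop_poly_simps)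
  then show ?case by (simp add: diff_mult_pCons Suc dx_mult_monom)
qed

lemma dop_poly_sum: "dop_poly (sum g A) = (\<Sum>i\<in>A. dop_poly (g i))"
  by (induction A rule: infinite_finite_induct) (simp_all add: zero_diffop.rep_eq plus_diffop.rep_eq)

lemma dop_coeff_sum:
  "dop_coeff (\<Sum>i\<le>k. dop_of_poly (p i) * dx ^ i) j = (if j \<le> k then p j else 0)"
proof -
  have "dop_poly (dop_of_poly q * dx ^ i) = monom q i" for q i
    by (simp add: dop_poly_simps dop_poly_dx_power diff_mult_pCons smult_monom)
  then have "dop_coeff (\<Sum>i\<le>k. dop_of_poly (p i) * dx ^ i) j = (\<Sum>i\<le>k. if i = j then p i else 0)"
    by (simp add: dop_coeff_def dop_poly_sum coeff_sum)
  then show ?thesis by simp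
qed

definition dop_apply :: "diffop \<Rightarrow> (real \<Rightarrow> real) \<Rightarrow> real \<Rightarrow> real" where
  "dop_apply L f x =
     (\<Sum>i\<le>dop_order L. poly (map_poly of_rat (dop_coeff L i)) x * (deriv ^^ i) f x)"

text \<open>\<open>f \<in> C\<^sup>k(S)\<close> for an open set \<open>S\<close>, where \<open>deriv\<close> depends only on the values of \<open>f\<close> on \<open>S\<close>\<close>

definition Ck_on :: "nat \<Rightarrow> (real \<Rightarrow> real) \<Rightarrow> real set \<Rightarrow> bool" where
  "Ck_on k f S \<longleftrightarrow>
     (\<forall>i<k. (deriv ^^ i) f differentiable_on S) \<and> continuous_on S ((deriv ^^ k) f)"

section \<open>The morphism into the skew field of fractions\<close>

definition rS :: recop where "rS = rmonom 1 1"

definition rSinv :: recop where "rSinv = rmonom 1 (- 1)"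

definition rfun :: "ratfun \<Rightarrow> recop" where "rfun a = rmonom a 0"

definition rconst :: "rat \<Rightarrow> recop" where "rconst c = rfun (to_fract [:c:])"

definition rn :: recop where "rn = rfun (to_fract [:0, 1:])"

lemma rS_rSinv: "rS * rSinv = 1" "rSinv * rS = 1"
  by (simp_all add: rS_def rSinv_def rmonom_mult rmonom_1_0)

lemma rS_rfun: "rS * rfun a = rfun (shift 1 a) * rS"
  by (simp add: rS_def rfun_def rmonom_mult)

definition cheb_X :: "recop lfract" where
  "cheb_X = lfract_of (rconst (1 / 2) * (rS + rSinv))"

definition cheb_D :: "recop lfract" where
  "cheb_D = inverse (lfract_of (rSinv - rS)) * lfract_of (2 * rn)"

definition cheb_poly_X :: "rat poly \<Rightarrow> recop lfract" where
  "cheb_poly_X p = (\<Sum>j\<le>degree p. lfract_of (rconst (coeff p j)) * cheb_X ^ j)"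

text \<open>\<open>\<phi>\<close> is given on the normal form \<open>\<Sum> p\<^sub>i(x) \<partial>\<^sub>x\<^sup>i\<close>; the lemmas \<open>cheb_phi_*\<close> below show that it is
  the \<open>\<rat>\<close>-algebra morphism with \<open>x \<mapsto> X\<close> and \<open>\<partial>\<^sub>x \<mapsto> D\<close>.\<close>

definition cheb_phi :: "diffop \<Rightarrow> recop lfract" where
  "cheb_phi L = (\<Sum>i\<le>dop_order L. cheb_poly_X (dop_coeff L i) * cheb_D ^ i)"

lemma shift_const [simp]: "shift i (to_fract [:c:]) = to_fract [:c:]"
  by (simp add: to_fract_def shift_Fract shift_poly_def pcompose_1)

lemma shift_n: "shift i (to_fract [:0, 1:]) = to_fract [:of_int i, 1:]"
  by (simp add: to_fract_def shift_Fract shift_poly_def pcompose_pCons pcompose_1)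

lemma rconst_central: "rconst c * P = P * rconst c"
proof (rule recop_eqI)
  fix m
  have "rcoeff (P * rconst c) m =
      (\<Sum>i\<in>insert m (rsupp P). rcoeff P i * shift i (rcoeff (rconst c) (m - i)))"
    by (rule rcoeff_mult) auto
  also have "\<dots> = (\<Sum>i\<in>insert m (rsupp P). if i = m then rcoeff P i * to_fract [:c:] else 0)"
    by (rule sum.cong) (auto simp: rconst_def rfun_def rcoeff_rmonom)
  also have "\<dots> = rcoeff (rconst c * P) m"
    by (simp add: rconst_def rfun_def rcoeff_rmonom_mult mult.commute)
  finally show "rcoeff (rconst c * P) m = rcoeff (P * rconst c) m" by simp
qed

lemma rconst_hom:
  "rconst 0 = 0" "rconst 1 = 1" "rconst (a + b) = rconst a + rconst b" "rconst (a * b) = rconst a * rconst b"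
  by (simp_all add: rconst_def rfun_def rmonom_mult rmonom_add rmonom_1_0 one_pCons[symmetric] mult.commute
      flip: to_fract_add to_fract_mult)

abbreviation (input) lconst :: "rat \<Rightarrow> recop lfract" where "lconst c \<equiv> lfract_of (rconst c)"

lemma lconst_X: "lconst c * cheb_X = cheb_X * lconst c"
  by (simp add: cheb_X_def rconst_central flip: lfract_of_mult)

lemma commutes_inverse:
  fixes a b :: "'a::division_ring"
  assumes "a * b = b * a"
  shows "a * inverse b = inverse b * a"
proof (cases "b = 0")
  case False
  have "a * inverse b = inverse b * (b * a) * inverse b" using False by (simp flip: mult.assoc)
  also have "\<dots> = inverse b * (a * b) * inverse b" by (simp add: assms)
  also have "\<dots> = inverse b * a" using False by (simp add: mult.assoc)
  finally show ?thesis .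
qed simp

lemma lconst_D: "lconst c * cheb_D = cheb_D * lconst c"
proof -
  have 1: "lconst c * inverse (lfract_of (rSinv - rS)) = inverse (lfract_of (rSinv - rS)) * lconst c"
    by (rule commutes_inverse) (simp add: rconst_central flip: lfract_of_mult)
  have 2: "lconst c * lfract_of (2 * rn) = lfract_of (2 * rn) * lconst c"
    by (simp only: rconst_central flip: lfract_of_mult)
  show ?thesis unfolding cheb_D_def
    by (metis (no_types, lifting) 1 2 mult.assoc)
qed

lemma rSinv_minus_rS_nz: "rSinv - rS \<noteq> 0"
proof
  assume "rSinv - rS = 0"
  then have "rcoeff (rSinv - rS) 1 = 0" by simp
  then show False by (simp add: rS_def rSinv_def rcoeff_rmonom)
qed

lemma cheb_D_X: "cheb_D * cheb_X = cheb_X * cheb_D + 1"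
proof -
  let ?E = "rSinv - rS" and ?Y = "rconst (1 / 2) * (rS + rSinv)"
  have E: "lfract_of ?E \<noteq> 0" using rSinv_minus_rS_nz by simp
  have comm: "?E * ?Y = ?Y * ?E"
  proof -
    have "?E * ?Y = rconst (1 / 2) * (?E * (rS + rSinv))"
      by (metis rconst_central mult.assoc)
    also have "?E * (rS + rSinv) = (rS + rSinv) * ?E"
      by (simp add: algebra_simps rS_rSinv)
    finally show ?thesis by (simp add: mult.assoc)
  qed
  have nS: "rn * rS = rmonom (to_fract [:0, 1:]) 1" "rn * rSinv = rmonom (to_fract [:0, 1:]) (- 1)"
    "rS * rn = rmonom (to_fract [:1, 1:]) 1" "rSinv * rn = rmonom (to_fract [:-1, 1:]) (- 1)"
    by (simp_all add: rn_def rS_def rSinv_def rfun_def rmonom_mult shift_n)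
  have a: "rn * (rS + rSinv) = (rS + rSinv) * rn + (rSinv - rS)"
    unfolding distrib_left distrib_right nS
    by (simp add: recop_eqI rcoeff_rmonom rS_def rSinv_def flip: to_fract_1 to_fract_add to_fract_diff)
      (rule recop_eqI, simp add: rcoeff_rmonom one_pCons flip: to_fract_1 to_fract_add to_fract_diff)
  have two: "2 * rconst (1 / 2) = 1"
    using rconst_hom(3)[of "1/2" "1/2"] by (simp add: rconst_hom mult_2)
  have key: "2 * rn * ?Y = ?Y * (2 * rn) + ?E"
  proof -
    have "2 * rn * ?Y = 2 * rconst (1/2) * (rn * (rS + rSinv))"
      by (metis rconst_central mult.assoc)
    also have "\<dots> = rn * (rS + rSinv)" by (simp add: two)
    also have "\<dots> = (rS + rSinv) * rn + ?E" by (rule a)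
    also have "(rS + rSinv) * rn = 2 * rconst (1/2) * ((rS + rSinv) * rn)" by (simp add: two)
    also have "\<dots> = ?Y * (2 * rn)" by (simp add: mult_2 algebra_simps)
    finally show ?thesis .
  qed
  have "lfract_of ?E * (cheb_D * cheb_X) = lfract_of (2 * rn * ?Y)"
    unfolding cheb_D_def cheb_X_def lfract_of_mult using E by (simp flip: mult.assoc)
  also have "\<dots> = lfract_of ?Y * lfract_of (2 * rn) + lfract_of ?E"
    unfolding key by (simp only: lfract_of_add lfract_of_mult)
  also have "lfract_of (2 * rn) = lfract_of ?E * cheb_D"
    unfolding cheb_D_def using E by (simp flip: mult.assoc)
  also have "lfract_of ?Y * (lfract_of ?E * cheb_D) = lfract_of ?E * (cheb_X * cheb_D)"
    unfolding cheb_X_def by (metis comm lfract_of_mult mult.assoc)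
  finally have "lfract_of ?E * (cheb_D * cheb_X) = lfract_of ?E * (cheb_X * cheb_D + 1)"
    by (simp add: distrib_left)
  then show ?thesis using E by simp
qed

lemma cheb_poly_X_le:
  assumes "degree p \<le> n"
  shows "cheb_poly_X p = (\<Sum>j\<le>n. lconst (coeff p j) * cheb_X ^ j)"
  unfolding cheb_poly_X_def
  by (rule sum.mono_neutral_left) (use assms in \<open>auto simp: coeff_eq_0 rconst_hom\<close>)

lemma cheb_poly_X_0 [simp]: "cheb_poly_X 0 = 0"
  by (simp add: cheb_poly_X_def rconst_hom)

lemma cheb_poly_X_pCons: "cheb_poly_X (pCons c p) = lconst c + cheb_poly_X p * cheb_X"
proof -
  have "cheb_poly_X (pCons c p) = (\<Sum>j\<le>Suc (degree p). lconst (coeff (pCons c p) j) * cheb_X ^ j)"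
    by (rule cheb_poly_X_le) (rule degree_pCons_le)
  also have "\<dots> = lconst c + cheb_poly_X p * cheb_X"
    by (simp add: sum.atMost_Suc_shift cheb_poly_X_def sum_distrib_right mult.assoc power_commutes
        del: sum.atMost_Suc)
  finally show ?thesis .
qed

lemma cheb_poly_X_add: "cheb_poly_X (p + q) = cheb_poly_X p + cheb_poly_X q"
proof -
  have "degree (p + q) \<le> max (degree p) (degree q)" by (rule degree_add_le) auto
  then show ?thesis
    by (simp add: cheb_poly_X_le[where n = "max (degree p) (degree q)"] rconst_hom lfract_of_add
        distrib_right sum.distrib)
qed

lemma cheb_poly_X_smult: "cheb_poly_X (smult c p) = lconst c * cheb_poly_X p"
  by (induction p) (simp_all add: cheb_poly_X_pCons rconst_hom lfract_of_mult distrib_left mult.assoc)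

lemma cheb_poly_X_X: "cheb_poly_X p * cheb_X = cheb_X * cheb_poly_X p"
  by (induction p) (simp_all add: cheb_poly_X_pCons distrib_left distrib_right lconst_X mult.assoc)

lemma cheb_poly_X_X': "cheb_poly_X p * (cheb_X * y) = cheb_X * (cheb_poly_X p * y)"
  by (metis cheb_poly_X_X mult.assoc)

lemma cheb_poly_X_mult: "cheb_poly_X (p * q) = cheb_poly_X p * cheb_poly_X q"
  by (induction p)
    (simp_all add: cheb_poly_X_pCons cheb_poly_X_add cheb_poly_X_smult rconst_hom distrib_right mult.assoc
      cheb_poly_X_X cheb_poly_X_X')

lemma cheb_D_poly_X: "cheb_D * cheb_poly_X p = cheb_poly_X p * cheb_D + cheb_poly_X (pderiv p)"
proof (induction p)
  case 0
  then show ?case by simp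
next
  case (pCons c p)
  have "cheb_D * cheb_poly_X (pCons c p) = lconst c * cheb_D + (cheb_D * cheb_poly_X p) * cheb_X"
    by (simp add: cheb_poly_X_pCons distrib_left mult.assoc lconst_D)
  also have "\<dots> = lconst c * cheb_D + cheb_poly_X p * (cheb_D * cheb_X) + cheb_poly_X (pderiv p) * cheb_X"
    by (simp add: pCons.IH distrib_right mult.assoc)
  also have "\<dots> = (lconst c + cheb_poly_X p * cheb_X) * cheb_D + (cheb_poly_X p + cheb_poly_X (pderiv p) * cheb_X)"
    by (simp add: cheb_D_X distrib_left distrib_right mult.assoc)
  also have "\<dots> = cheb_poly_X (pCons c p) * cheb_D + cheb_poly_X (pderiv (pCons c p))"
    by (simp add: pderiv_pCons cheb_poly_X_pCons cheb_poly_X_add rconst_hom)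
  finally show ?case .
qed

definition cheb_phi_poly :: "rat poly poly \<Rightarrow> recop lfract" where
  "cheb_phi_poly L = (\<Sum>i\<le>degree L. cheb_poly_X (coeff L i) * cheb_D ^ i)"

lemma cheb_phi_conv: "cheb_phi L = cheb_phi_poly (dop_poly L)"
  by (simp add: cheb_phi_def cheb_phi_poly_def dop_order_def dop_coeff_def)

lemma cheb_phi_poly_le:
  assumes "degree L \<le> n"
  shows "cheb_phi_poly L = (\<Sum>i\<le>n. cheb_poly_X (coeff L i) * cheb_D ^ i)"
  unfolding cheb_phi_poly_def
  by (rule sum.mono_neutral_left) (use assms in \<open>auto simp: coeff_eq_0\<close>)

lemma cheb_phi_poly_0 [simp]: "cheb_phi_poly 0 = 0"
  by (simp add: cheb_phi_poly_def)

lemma cheb_phi_poly_pCons: "cheb_phi_poly (pCons p L) = cheb_poly_X p + cheb_phi_poly L * cheb_D"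
proof -
  have "cheb_phi_poly (pCons p L) = (\<Sum>j\<le>Suc (degree L). cheb_poly_X (coeff (pCons p L) j) * cheb_D ^ j)"
    by (rule cheb_phi_poly_le) (rule degree_pCons_le)
  also have "\<dots> = cheb_poly_X p + cheb_phi_poly L * cheb_D"
    by (simp add: sum.atMost_Suc_shift cheb_phi_poly_def sum_distrib_right mult.assoc power_commutes
        del: sum.atMost_Suc)
  finally show ?thesis .
qed

lemma cheb_phi_poly_add: "cheb_phi_poly (L + M) = cheb_phi_poly L + cheb_phi_poly M"
proof -
  have "degree (L + M) \<le> max (degree L) (degree M)" by (rule degree_add_le) auto
  then show ?thesis
    by (simp add: cheb_phi_poly_le[where n = "max (degree L) (degree M)"] cheb_poly_X_add
        distrib_right sum.distrib)
qed

lemma cheb_phi_poly_smult: "cheb_phi_poly (smult p L) = cheb_poly_X p * cheb_phi_poly L"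
  by (induction L) (simp_all add: cheb_phi_poly_pCons cheb_poly_X_mult distrib_left mult.assoc)

lemma cheb_phi_poly_dx_mult: "cheb_phi_poly (dx_mult L) = cheb_D * cheb_phi_poly L"
proof (induction L)
  case 0
  then show ?case by simp
next
  case (pCons p L)
  have "dx_mult L = pCons 0 L + map_poly pderiv L" by (simp add: dx_mult_def)
  then have "cheb_D * cheb_phi_poly L = cheb_phi_poly L * cheb_D + cheb_phi_poly (map_poly pderiv L)"
    using pCons.IH by (simp add: cheb_phi_poly_add cheb_phi_poly_pCons)
  then have "cheb_D * (cheb_phi_poly L * cheb_D) =
      cheb_phi_poly L * cheb_D * cheb_D + cheb_phi_poly (map_poly pderiv L) * cheb_D"
    by (metis distrib_right mult.assoc)
  then show ?case
    by (simp add: dx_mult_pCons cheb_phi_poly_pCons cheb_phi_poly_add distrib_left distrib_right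
        cheb_D_poly_X algebra_simps)
qed

lemma cheb_phi_poly_mult: "cheb_phi_poly (diff_mult L M) = cheb_phi_poly L * cheb_phi_poly M"
  by (induction L arbitrary: M)
    (simp_all add: diff_mult_pCons cheb_phi_poly_pCons cheb_phi_poly_add cheb_phi_poly_smult
      cheb_phi_poly_dx_mult distrib_right mult.assoc)

lemma cheb_phi_add: "cheb_phi (L + M) = cheb_phi L + cheb_phi M"
  by (simp add: cheb_phi_conv plus_diffop.rep_eq cheb_phi_poly_add)

lemma cheb_phi_mult: "cheb_phi (L * M) = cheb_phi L * cheb_phi M"
  by (simp add: cheb_phi_conv times_diffop.rep_eq cheb_phi_poly_mult)

lemma cheb_phi_const: "cheb_phi (dop_of_poly [:c:]) = lfract_of (rconst c)"
  by (simp add: cheb_phi_conv dop_poly_simps cheb_phi_poly_pCons cheb_poly_X_pCons)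

lemma cheb_phi_1: "cheb_phi 1 = 1"
  using cheb_phi_const[of 1] by (simp add: rconst_hom cheb_phi_conv dop_poly_simps one_diffop.rep_eq one_pCons)

lemma cheb_phi_x: "cheb_phi (dop_of_poly [:0, 1:]) = cheb_X"
  by (simp add: cheb_phi_conv dop_poly_simps cheb_phi_poly_pCons cheb_poly_X_pCons rconst_hom)

lemma cheb_phi_dx: "cheb_phi dx = cheb_D"
  by (simp add: cheb_phi_conv dop_poly_simps cheb_phi_poly_pCons cheb_poly_X_pCons rconst_hom one_pCons)

section \<open>Action of recurrence operators on sequences\<close>

definition ratfun_pole :: "ratfun \<Rightarrow> int \<Rightarrow> bool" where
  "ratfun_pole a n \<longleftrightarrow> poly (snd (quot_of_fract a)) (of_int n) = 0"

definition ratfun_eval :: "ratfun \<Rightarrow> int \<Rightarrow> rat" where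
  "ratfun_eval a n = poly (fst (quot_of_fract a)) (of_int n) / poly (snd (quot_of_fract a)) (of_int n)"

lemma ratfun_Fract:
  assumes "poly q (of_int n) \<noteq> 0"
  shows "\<not> ratfun_pole (Fract p q) n" "ratfun_eval (Fract p q) n = poly p (of_int n) / poly q (of_int n)"
proof -
  obtain a b where ab: "quot_of_fract (Fract p q) = (a, b)" by (cases "quot_of_fract (Fract p q)")
  have "b \<noteq> 0" using snd_quot_of_fract_nonzero[of "Fract p q"] ab by simp
  have "q \<noteq> 0" using assms by auto
  have "coprime a b" using coprime_quot_of_fract[of "Fract p q"] ab by simp
  have "Fract a b = Fract p q" using Fract_quot_of_fract[of "Fract p q"] ab by simp
  then have eq: "a * q = p * b" using \<open>b \<noteq> 0\<close> \<open>q \<noteq> 0\<close> by (simp add: eq_fract)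
  then have "b dvd a * q" by simp
  then have "b dvd q" using \<open>coprime a b\<close> by (simp add: coprime_commute coprime_dvd_mult_right_iff)
  then obtain c where "q = b * c" by (elim dvdE)
  then have b: "poly b (of_int n) \<noteq> 0" using assms by auto
  then show "\<not> ratfun_pole (Fract p q) n" by (simp add: ratfun_pole_def ab)
  have "poly a (of_int n) * poly q (of_int n) = poly p (of_int n) * poly b (of_int n)"
    using eq by (metis poly_mult)
  then show "ratfun_eval (Fract p q) n = poly p (of_int n) / poly q (of_int n)"
    using b assms by (simp add: ratfun_eval_def ab field_simps)
qed

text \<open>\<open>P \<cdot> u\<^sub>n = Q \<cdot> v\<^sub>n\<close> is only meaningful for \<open>n\<close> at which both \<open>P\<close> and \<open>Q\<close> are regular. This remains
  necessary when \<open>v = 0\<close> and only \<open>P\<close> is of interest: \<open>1\<close> is a numerator of \<open>\<phi>(\<partial>\<^sub>x\<^sup>2)\<close>, the denominator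
  having poles at \<open>-1, 0, 1\<close>, and \<open>f(x) = x\<close> satisfies \<open>\<partial>\<^sub>x\<^sup>2 \<cdot> f = 0\<close> although \<open>u\<^sub>1 \<noteq> 0\<close>.\<close>

definition rec_regular_at :: "recop \<Rightarrow> int \<Rightarrow> bool" where
  "rec_regular_at P n \<longleftrightarrow> (\<forall>i. \<not> ratfun_pole (rcoeff P i) n)"

definition rec_apply :: "recop \<Rightarrow> (int \<Rightarrow> real) \<Rightarrow> int \<Rightarrow> real" where
  "rec_apply P u n = (\<Sum>i | rcoeff P i \<noteq> 0. of_rat (ratfun_eval (rcoeff P i) n) * u (n + i))"

section \<open>Chebyshev expansions\<close>

fun cheb_poly :: "nat \<Rightarrow> real poly" where
  "cheb_poly 0 = 1"
| "cheb_poly (Suc 0) = [:0, 1:]"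
| "cheb_poly (Suc (Suc n)) = [:0, 2:] * cheb_poly (Suc n) - cheb_poly n"

definition cheb_T :: "int \<Rightarrow> real \<Rightarrow> real" where
  "cheb_T n x = poly (cheb_poly (nat \<bar>n\<bar>)) x"

lemma cheb_poly_cos: "poly (cheb_poly n) (cos t) = cos (real n * t)"
proof (induction n rule: cheb_poly.induct)
  case (3 n)
  have 1: "real (Suc (Suc n)) * t = real (Suc n) * t + t" "real n * t = real (Suc n) * t - t"
    by (simp_all add: algebra_simps)
  have "poly (cheb_poly (Suc (Suc n))) (cos t) = 2 * cos t * cos (real (Suc n) * t) - cos (real n * t)"
    using 3 by simp
  also have "\<dots> = cos (real (Suc (Suc n)) * t)"
    unfolding 1 cos_add cos_diff by (simp add: algebra_simps)
  finally show ?case .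
qed simp_all

lemma cheb_T_cos: "cheb_T n (cos t) = cos (of_int n * t)"
proof (cases "n \<ge> 0")
  case True
  then show ?thesis by (simp add: cheb_T_def cheb_poly_cos)
next
  case False
  then have "real (nat \<bar>n\<bar>) * t = - (of_int n * t)" by simp
  then show ?thesis by (simp only: cheb_T_def cheb_poly_cos cos_minus)
qed

text \<open>Improper integral over \<open>]-1, 1[\<close>: both endpoints are approached independently, and only
  conditional convergence is required.\<close>

definition has_improper_integral :: "(real \<Rightarrow> real) \<Rightarrow> real \<Rightarrow> bool" where
  "has_improper_integral g I \<longleftrightarrow>
     (\<forall>a b. - 1 < a \<longrightarrow> a \<le> b \<longrightarrow> b < 1 \<longrightarrow> g integrable_on {a..b}) \<and>
     ((\<lambda>(a, b). integral {a..b} g) \<longlongrightarrow> I) (at_right (- 1) \<times>\<^sub>F at_left 1)"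

definition improper_convergent :: "(real \<Rightarrow> real) \<Rightarrow> bool" where
  "improper_convergent g \<longleftrightarrow> (\<exists>I. has_improper_integral g I)"

definition improper_integral :: "(real \<Rightarrow> real) \<Rightarrow> real" where
  "improper_integral g = (THE I. has_improper_integral g I)"

lemma has_improper_integral_unique:
  assumes "has_improper_integral g I" "has_improper_integral g J"
  shows "I = J"
proof (rule tendsto_unique)
  show "at_right (- 1 :: real) \<times>\<^sub>F at_left (1 :: real) \<noteq> bot"
    by (simp add: prod_filter_eq_bot)
qed (use assms in \<open>auto simp: has_improper_integral_def\<close>)

lemma improper_integral_eq: "has_improper_integral g I \<Longrightarrow> improper_integral g = I"
  unfolding improper_integral_def by (blast intro: has_improper_integral_unique)

definition cheb_integrand :: "(real \<Rightarrow> real) \<Rightarrow> int \<Rightarrow> real \<Rightarrow> real" where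
  "cheb_integrand g n x = g x * cheb_T n x / sqrt (1 - x\<^sup>2)"

definition admits_cheb_expansion :: "(real \<Rightarrow> real) \<Rightarrow> bool" where
  "admits_cheb_expansion g \<longleftrightarrow> (\<forall>n::nat. improper_convergent (cheb_integrand g (int n)))"

definition cheb_coeff :: "(real \<Rightarrow> real) \<Rightarrow> int \<Rightarrow> real" where
  "cheb_coeff g n = 2 / pi * improper_integral (cheb_integrand g n)"

end

theory Submission
  imports Defs
begin

text \<open>Put \<open>w = (1 - x\<^sup>2)\<^bsup>-1/2\<^esup>\<close> and \<open>E = S\<^sup>-\<^sup>1 - S\<close>. The coefficients of
  \<open>\<phi>(L) E\<^bsup>2k\<^esup>\<close> are polynomials in \<open>n\<close>, so \<open>P E\<^bsup>2k\<^esup> = Q \<phi>(L) E\<^bsup>2k\<^esup>\<close> may be evaluated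
  at every \<open>n\<close> at which \<open>P\<close> and \<open>Q\<close> are regular. Applied to \<open>T\<^sub>n\<close>, on which \<open>E\<^sup>2\<close> acts as \<open>-4(1 - x\<^sup>2)\<close>, it says that the
  formal adjoint of \<open>L\<close> maps \<open>w (Q \<cdot> T\<^sub>n)\<close> to \<open>w (P \<cdot> T\<^sub>n)\<close>. It remains to see that no boundary terms
  survive in the repeated integration by parts of \<open>(L \<cdot> f) w (Q \<cdot> T\<^sub>n)\<close>. The functions
  multiplying the derivatives of \<open>f\<close> in these terms have half-integer exponents at \<open>\<plusminus>1\<close>; since the
  final result \<open>w (P \<cdot> T\<^sub>n)\<close> has no worse singularity than \<open>w\<close>, they are all multiples of
  \<open>(1 - x\<^sup>2)\<^bsup>1/2\<^esup>\<close> under (H), and have an additional factor \<open>(1 - x\<^sup>2)\<^sup>m\<close> in front of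
  \<open>f\<^bsup>(m)\<^esup>\<close> under (H'); this beats the growth of \<open>f\<^bsup>(m)\<^esup>\<close> for \<open>m < k\<close>.\<close>

section \<open>Evaluation of rational functions at integers\<close>

lemma ratfun_regular_cases:
  assumes "\<not> ratfun_pole a n"
  obtains p q where "a = Fract p q" "poly q (of_int n) \<noteq> 0" "q \<noteq> 0"
  using assms Fract_quot_of_fract[of a] unfolding ratfun_pole_def
  by (metis poly_0)

lemma ratfun_eval_0 [simp]: "ratfun_eval 0 n = 0"
  by (simp add: ratfun_eval_def)

lemma ratfun_pole_0 [simp]: "\<not> ratfun_pole 0 n"
  by (simp add: ratfun_pole_def)

lemma ratfun_to_fract [simp]:
  "\<not> ratfun_pole (to_fract p) n" "ratfun_eval (to_fract p) n = poly p (of_int n)"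
  by (simp_all add: ratfun_pole_def ratfun_eval_def quot_of_fract_to_fract)

lemma ratfun_1 [simp]: "\<not> ratfun_pole 1 n" "ratfun_eval 1 n = 1"
  using ratfun_to_fract[of 1 n] by simp_all

text \<open>Poles refer to the reduced fraction; by \<open>ratfun_Fract\<close> any representation
  whose denominator is nonzero at \<open>n\<close> gives the same value, so the unreduced
  denominator \<open>q * s\<close> suffices.\<close>

lemma ratfun_add:
  assumes "\<not> ratfun_pole a n" "\<not> ratfun_pole b n"
  shows "\<not> ratfun_pole (a + b) n" "ratfun_eval (a + b) n = ratfun_eval a n + ratfun_eval b n"
proof -
  obtain p q where a: "a = Fract p q" "poly q (of_int n) \<noteq> 0" "q \<noteq> 0"
    using assms(1) by (rule ratfun_regular_cases)
  obtain r s where b: "b = Fract r s" "poly s (of_int n) \<noteq> 0" "s \<noteq> 0"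
    using assms(2) by (rule ratfun_regular_cases)
  have "a + b = Fract (p * s + r * q) (q * s)" using a b by simp
  moreover have "poly (q * s) (of_int n) \<noteq> 0" using a b by simp
  ultimately show "\<not> ratfun_pole (a + b) n"
    "ratfun_eval (a + b) n = ratfun_eval a n + ratfun_eval b n"
    using a b by (simp_all add: ratfun_Fract add_frac_eq)
qed

lemma ratfun_mult:
  assumes "\<not> ratfun_pole a n" "\<not> ratfun_pole b n"
  shows "\<not> ratfun_pole (a * b) n" "ratfun_eval (a * b) n = ratfun_eval a n * ratfun_eval b n"
proof -
  obtain p q where a: "a = Fract p q" "poly q (of_int n) \<noteq> 0" "q \<noteq> 0"
    using assms(1) by (rule ratfun_regular_cases)
  obtain r s where b: "b = Fract r s" "poly s (of_int n) \<noteq> 0" "s \<noteq> 0"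
    using assms(2) by (rule ratfun_regular_cases)
  have "a * b = Fract (p * r) (q * s)" using a b by simp
  moreover have "poly (q * s) (of_int n) \<noteq> 0" using a b by simp
  ultimately show "\<not> ratfun_pole (a * b) n"
    "ratfun_eval (a * b) n = ratfun_eval a n * ratfun_eval b n"
    using a b by (simp_all add: ratfun_Fract)
qed

lemma ratfun_uminus:
  assumes "\<not> ratfun_pole a n"
  shows "\<not> ratfun_pole (- a) n" "ratfun_eval (- a) n = - ratfun_eval a n"
proof -
  have "- a = to_fract (- 1) * a" by simp
  moreover have "ratfun_eval (to_fract (- 1)) n = - 1" by (subst ratfun_to_fract) simp
  ultimately show "\<not> ratfun_pole (- a) n" "ratfun_eval (- a) n = - ratfun_eval a n"
    using ratfun_mult[OF ratfun_to_fract(1)[of "- 1"] assms] by (metis, metis mult_minus1)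
qed

lemma ratfun_shift:
  assumes "\<not> ratfun_pole a (n + i)"
  shows "\<not> ratfun_pole (shift i a) n" "ratfun_eval (shift i a) n = ratfun_eval a (n + i)"
proof -
  obtain p q where a: "a = Fract p q" "poly q (of_int (n + i)) \<noteq> 0" "q \<noteq> 0"
    using assms(1) by (rule ratfun_regular_cases)
  have s: "shift i a = Fract (shift_poly i p) (shift_poly i q)" using a by (simp add: shift_Fract)
  have e: "poly (shift_poly i r) (of_int n) = poly r (of_int (n + i))" for r
    by (simp add: shift_poly_def poly_pcompose add.commute)
  show "\<not> ratfun_pole (shift i a) n" "ratfun_eval (shift i a) n = ratfun_eval a (n + i)"
    using a(2) unfolding s by (simp_all add: ratfun_Fract e a(1) del: of_int_add)
qed

lemma ratfun_sum:
  assumes "\<And>x. x \<in> A \<Longrightarrow> \<not> ratfun_pole (g x) n"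
  shows "\<not> ratfun_pole (sum g A) n \<and> ratfun_eval (sum g A) n = (\<Sum>x\<in>A. ratfun_eval (g x) n)"
  using assms by (induction A rule: infinite_finite_induct) (auto simp: ratfun_add)

section \<open>Recurrence operators acting on sequences of polynomials\<close>

text \<open>Polynomial values in place of numbers: on the sequence of the T_n the action yields
  identities between polynomials in x, which integration later turns into identities for
  \<open>rec_apply\<close>.\<close>

definition rec_act :: "recop \<Rightarrow> (int \<Rightarrow> real poly) \<Rightarrow> int \<Rightarrow> real poly" where
  "rec_act P y n = (\<Sum>i\<in>rsupp P. smult (of_rat (ratfun_eval (rcoeff P i) n)) (y (n + i)))"

text \<open>Evaluating \<open>P * Q\<close> at \<open>n\<close> involves the coefficients of
  \<open>Q\<close> at all shifted points n + i, so regularity of \<open>Q\<close> at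
  \<open>n\<close> alone would not suffice.\<close>

definition entire :: "recop \<Rightarrow> bool" where
  "entire P \<longleftrightarrow> (\<forall>n. rec_regular_at P n)"

lemma smult_sum_right: "smult c (sum g A) = (\<Sum>x\<in>A. smult c (g x))"
  by (induction A rule: infinite_finite_induct) (simp_all add: smult_add_right)

lemma rec_act_on:
  assumes "finite A" "rsupp P \<subseteq> A"
  shows "rec_act P y n = (\<Sum>i\<in>A. smult (of_rat (ratfun_eval (rcoeff P i) n)) (y (n + i)))"
  unfolding rec_act_def
  by (rule sum.mono_neutral_left) (use assms in \<open>auto simp: not_in_rsupp\<close>)

lemma rec_regular_add:
  "rec_regular_at P n \<Longrightarrow> rec_regular_at Q n \<Longrightarrow> rec_regular_at (P + Q) n"
  by (simp add: rec_regular_at_def ratfun_add)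

lemma rec_regular_mult:
  assumes "rec_regular_at P n" "entire Q"
  shows "rec_regular_at (P * Q) n"
  unfolding rec_regular_at_def rcoeff_mult_rsupp
  using assms by (auto simp: rec_regular_at_def entire_def ratfun_mult ratfun_shift
    intro!: ratfun_sum[THEN conjunct1])

lemma rec_act_add:
  assumes "rec_regular_at P n" "rec_regular_at Q n"
  shows "rec_act (P + Q) y n = rec_act P y n + rec_act Q y n"
proof -
  let ?A = "rsupp P \<union> rsupp Q"
  have "rsupp (P + Q) \<subseteq> ?A" by (auto simp: rsupp_def)
  then show ?thesis
    using assms
    by (simp add: rec_act_on[of ?A] rec_regular_at_def ratfun_add of_rat_add smult_add_left sum.distrib)
qed

text \<open>At \<open>n\<close> the coefficient of S^l in \<open>P * Q\<close> is the sum over i of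
  p_i(n) q_{l-i}(n + i); exchanging the sums and putting l = i + j gives the composition.\<close>

lemma rec_act_mult:
  assumes P: "rec_regular_at P n" and Q: "entire Q"
  shows "rec_act (P * Q) y n = rec_act P (rec_act Q y) n"
proof -
  let ?C = "(\<lambda>(i, j). i + j) ` (rsupp P \<times> rsupp Q)"
  let ?e = "\<lambda>a n. of_rat (ratfun_eval a n) :: real"
  have reg: "\<not> ratfun_pole (rcoeff P i) n" "\<not> ratfun_pole (rcoeff Q i) m" for i m
    using P Q by (simp_all add: rec_regular_at_def entire_def)
  have c: "ratfun_eval (rcoeff (P * Q) l) n =
      (\<Sum>i\<in>rsupp P. ratfun_eval (rcoeff P i) n * ratfun_eval (rcoeff Q (l - i)) (n + i))" for l
    unfolding rcoeff_mult_rsupp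
    by (subst ratfun_sum[THEN conjunct2]) (simp_all add: reg ratfun_mult ratfun_shift)
  have "rec_act (P * Q) y n = (\<Sum>l\<in>?C. smult (?e (rcoeff (P * Q) l) n) (y (n + l)))"
    by (rule rec_act_on) (simp, rule rsupp_mult)
  also have "\<dots> = (\<Sum>l\<in>?C. \<Sum>i\<in>rsupp P.
      smult (?e (rcoeff P i) n) (smult (?e (rcoeff Q (l - i)) (n + i)) (y (n + l))))"
    by (simp add: c of_rat_sum of_rat_mult smult_sum)
  also have "\<dots> = (\<Sum>i\<in>rsupp P. smult (?e (rcoeff P i) n)
      (\<Sum>l\<in>?C. smult (?e (rcoeff Q (l - i)) (n + i)) (y (n + l))))"
    by (subst sum.swap) (simp add: smult_sum_right)
  also have "\<dots> = (\<Sum>i\<in>rsupp P. smult (?e (rcoeff P i) n) (rec_act Q y (n + i)))"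
  proof (rule sum.cong[OF refl], rule arg_cong[where f = "smult _"])
    fix i assume i: "i \<in> rsupp P"
    have "(\<Sum>l\<in>?C. smult (?e (rcoeff Q (l - i)) (n + i)) (y (n + l))) =
          (\<Sum>l\<in>(\<lambda>j. i + j) ` rsupp Q. smult (?e (rcoeff Q (l - i)) (n + i)) (y (n + l)))"
    proof (rule sum.mono_neutral_right)
      show "(\<lambda>j. i + j) ` rsupp Q \<subseteq> ?C" using i by force
      show "\<forall>l\<in>?C - (\<lambda>j. i + j) ` rsupp Q.
          smult (?e (rcoeff Q (l - i)) (n + i)) (y (n + l)) = 0"
      proof
        fix l assume l: "l \<in> ?C - (\<lambda>j. i + j) ` rsupp Q"
        have "l = i + (l - i)" by simp
        then have "l - i \<notin> rsupp Q" using l by blast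
        then show "smult (?e (rcoeff Q (l - i)) (n + i)) (y (n + l)) = 0"
          by (simp add: not_in_rsupp)
      qed
    qed simp
    also have "\<dots> = rec_act Q y (n + i)"
      by (subst sum.reindex) (auto simp: inj_on_def rec_act_def add.assoc)
    finally show "(\<Sum>l\<in>?C. smult (?e (rcoeff Q (l - i)) (n + i)) (y (n + l))) =
      rec_act Q y (n + i)" .
  qed
  finally show ?thesis by (simp add: rec_act_def)
qed

text \<open>The coefficients depend on \<open>n\<close> only, so a linear map acting on the variable
  x commutes with the recurrence operator.\<close>

lemma rec_act_linear:
  assumes "\<And>a b. C (a + b) = C a + C b" "\<And>c a. C (smult c a) = smult c (C a)"
  shows "rec_act P (\<lambda>n. C (y n)) n = C (rec_act P y n)"
proof -
  have "C 0 = 0" using assms(2)[of 0 0] by simp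
  then have "C (sum g A) = (\<Sum>x\<in>A. C (g x))" for g :: "int \<Rightarrow> _" and A
    by (induction A rule: infinite_finite_induct) (simp_all add: assms(1))
  then show ?thesis by (simp add: rec_act_def assms(2))
qed

lemma rec_act_rmonom: "rec_act (rmonom a i) y n = smult (of_rat (ratfun_eval a n)) (y (n + i))"
  by (subst rec_act_on[of "{i}"]) (auto simp: rsupp_def rcoeff_rmonom)

section \<open>Operators without integer poles\<close>

lemma entire_add [intro]: "entire P \<Longrightarrow> entire Q \<Longrightarrow> entire (P + Q)"
  by (simp add: entire_def rec_regular_add)

lemma entire_mult [intro]: "entire P \<Longrightarrow> entire Q \<Longrightarrow> entire (P * Q)"
  by (metis entire_def rec_regular_mult)

lemma entire_uminus [intro]: "entire P \<Longrightarrow> entire (- P)"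
  by (simp add: entire_def rec_regular_at_def ratfun_uminus)

lemma entire_diff [intro]: "entire P \<Longrightarrow> entire Q \<Longrightarrow> entire (P - Q)"
  by (metis entire_add entire_uminus diff_conv_add_uminus)

lemma entire_rmonom: "(\<And>n. \<not> ratfun_pole a n) \<Longrightarrow> entire (rmonom a i)"
  by (simp add: entire_def rec_regular_at_def rcoeff_rmonom)

lemma entire_basic [intro, simp]:
  "entire 0" "entire 1" "entire rS" "entire rSinv" "entire rn" "entire (rconst c)"
  using entire_rmonom[of 0] by (simp_all add: rS_def rSinv_def rn_def rconst_def rfun_def entire_rmonom
    flip: rmonom_1_0)

lemma entire_power [intro]: "entire P \<Longrightarrow> entire (P ^ j)"
  by (induction j) auto

lemma entire_of_nat [intro, simp]: "entire (of_nat j)"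
  by (induction j) auto

lemma rec_act_uminus:
  assumes "rec_regular_at P n"
  shows "rec_act (- P) y n = - rec_act P y n"
proof -
  have "rsupp (- P) = rsupp P" by (auto simp: rsupp_def)
  then show ?thesis using assms
    by (simp add: rec_act_def rec_regular_at_def ratfun_uminus of_rat_minus sum_negf)
qed

lemma rec_act_basic:
  "rec_act 1 y n = y n" "rec_act rS y n = y (n + 1)" "rec_act rSinv y n = y (n - 1)"
  "rec_act rn y n = smult (of_int n) (y n)" "rec_act (rconst c) y n = smult (of_rat c) (y n)"
  by (simp_all add: rS_def rSinv_def rn_def rconst_def rfun_def rec_act_rmonom flip: rmonom_1_0)

lemma entire_regular: "entire P \<Longrightarrow> rec_regular_at P n"
  by (simp add: entire_def)

lemma rec_act_entire:
  assumes "entire P" "entire Q"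
  shows "rec_act (P + Q) y n = rec_act P y n + rec_act Q y n"
    and "rec_act (P - Q) y n = rec_act P y n - rec_act Q y n"
    and "rec_act (P * Q) y = rec_act P (rec_act Q y)"
proof -
  have reg: "rec_regular_at P m" "rec_regular_at Q m" "rec_regular_at (- Q) m" for m
    using assms by (auto intro: entire_regular)
  show "rec_act (P + Q) y n = rec_act P y n + rec_act Q y n"
    by (rule rec_act_add) (rule reg)+
  have "rec_act (P - Q) y n = rec_act P y n + rec_act (- Q) y n"
    unfolding diff_conv_add_uminus by (rule rec_act_add) (rule reg)+
  also have "rec_act (- Q) y n = - rec_act Q y n"
    by (rule rec_act_uminus) (rule reg)
  finally show "rec_act (P - Q) y n = rec_act P y n - rec_act Q y n" by simp
  show "rec_act (P * Q) y = rec_act P (rec_act Q y)"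
    by (rule ext, rule rec_act_mult) (rule reg assms)+
qed

lemma rec_act_of_nat: "rec_act (of_nat j) y n = smult (of_nat j) (y n)"
proof (induction j)
  case 0
  then show ?case by (simp add: rec_act_def rsupp_def)
next
  case (Suc j)
  have "rec_act (of_nat (Suc j)) y n = rec_act 1 y n + rec_act (of_nat j) y n"
    unfolding of_nat_Suc by (rule rec_act_entire) auto
  then show ?case by (simp add: Suc rec_act_basic smult_add_left)
qed

section \<open>Clearing the denominators of the Chebyshev morphism\<close>

abbreviation rE :: recop where "rE \<equiv> rSinv - rS"

definition rX :: recop where "rX = rconst (1 / 2) * (rS + rSinv)"

definition rX_poly :: "rat poly \<Rightarrow> recop" where
  "rX_poly p = (\<Sum>j\<le>degree p. rconst (coeff p j) * rX ^ j)"

definition rstep :: "nat \<Rightarrow> recop" where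
  "rstep m = 2 * (rE * rn) + of_nat (8 * Suc m) * rX"

text \<open>\<open>cheb_rec k p = \<phi>(p\<^sub>0 + \<dots> + p\<^sub>k \<partial>\<^sub>x\<^sup>k) (S\<^sup>-\<^sup>1 - S)\<^bsup>2k\<^esup>\<close>, written in
  Horner form with the help of
  \<open>D (S\<^sup>-\<^sup>1 - S)\<^bsup>2m+2\<^esup> = (S\<^sup>-\<^sup>1 - S)\<^bsup>2m\<^esup> rstep m\<close>.
  Its coefficients are polynomials in \<open>n\<close>, hence have no poles.\<close>

fun cheb_rec :: "nat \<Rightarrow> (nat \<Rightarrow> rat poly) \<Rightarrow> recop" where
  "cheb_rec 0 p = rX_poly (p 0)"
| "cheb_rec (Suc k) p = rX_poly (p 0) * rE ^ (2 * Suc k) + cheb_rec k (p \<circ> Suc) * rstep k"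

lemma lfract_of_power: "lfract_of (P ^ j) = lfract_of P ^ j"
  by (induction j) (simp_all add: lfract_of_mult)

lemma lfract_of_sum: "lfract_of (sum g A) = (\<Sum>x\<in>A. lfract_of (g x))"
  by (induction A rule: infinite_finite_induct) (simp_all add: lfract_of_add)

lemma cheb_X_rX: "cheb_X = lfract_of rX"
  by (simp add: cheb_X_def rX_def)

lemma cheb_poly_X_rX: "cheb_poly_X p = lfract_of (rX_poly p)"
  by (simp add: cheb_poly_X_def rX_poly_def lfract_of_sum lfract_of_mult lfract_of_power cheb_X_rX)

lemma rX_rE: "rX * rE = rE * rX"
proof -
  have "rX * rE = rconst (1 / 2) * ((rS + rSinv) * rE)" by (simp add: rX_def mult.assoc)
  also have "(rS + rSinv) * rE = rE * (rS + rSinv)" by (simp add: algebra_simps rS_rSinv)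
  also have "rconst (1 / 2) * \<dots> = rE * rX" by (metis rX_def rconst_central mult.assoc)
  finally show ?thesis .
qed

lemma two_rX: "2 * rX = rS + rSinv"
proof -
  have "2 * rconst (1 / 2) = 1"
    using rconst_hom(3)[of "1/2" "1/2"] by (simp add: rconst_hom mult_2)
  then show ?thesis by (simp add: rX_def flip: mult.assoc)
qed

text \<open>By S n = (n + 1) S and S^-1 n = (n - 1) S^-1, moving \<open>rn\<close> across
  \<open>rS\<close> and \<open>rSinv\<close> creates extra terms of opposite signs; for E = S^-1 - S
  they add up to S + S^-1 = 2X.\<close>

lemma rn_rE: "rn * rE = rE * rn + 2 * rX"
proof -
  have nS: "rn * rS = rmonom (to_fract [:0, 1:]) 1" "rn * rSinv = rmonom (to_fract [:0, 1:]) (- 1)"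
    "rS * rn = rmonom (to_fract [:1, 1:]) 1" "rSinv * rn = rmonom (to_fract [:-1, 1:]) (- 1)"
    by (simp_all add: rn_def rS_def rSinv_def rfun_def rmonom_mult shift_n)
  have 1: "to_fract [:1, 1:] = to_fract [:0, 1:] + (1 :: ratfun)"
    "to_fract [:-1, 1:] = to_fract [:0, 1:] - (1 :: ratfun)"
    by (simp_all add: one_pCons flip: to_fract_1 to_fract_add to_fract_diff)
  show ?thesis
    unfolding two_rX left_diff_distrib right_diff_distrib nS 1
    by (rule recop_eqI) (simp add: rcoeff_rmonom rS_def rSinv_def)
qed

text \<open>The commutator with \<open>rn\<close> is a derivation; since \<open>rX\<close> commutes
  with \<open>rE\<close>, each of the j + 1 factors contributes the same term 2 X E^j.\<close>

lemma rn_rE_power: "rn * rE ^ Suc j = rE ^ Suc j * rn + of_nat (2 * Suc j) * (rX * rE ^ j)"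
proof (induction j)
  case 0
  then show ?case by (simp add: rn_rE)
next
  case (Suc j)
  have "rn * rE ^ Suc (Suc j) = (rn * rE ^ Suc j) * rE"
    by (simp add: power_commutes mult.assoc)
  also have "\<dots> = rE ^ Suc j * (rn * rE) + of_nat (2 * Suc j) * (rX * rE ^ Suc j)"
    unfolding Suc by (simp only: distrib_right mult.assoc power_Suc2)
  also have "rE ^ Suc j * (rn * rE) = rE ^ Suc (Suc j) * rn + 2 * (rX * rE ^ Suc j)"
  proof -
    have "rE ^ Suc j * (2 * rX) = 2 * (rX * rE ^ Suc j)"
      using power_commuting_commutes[OF rX_rE[symmetric], of "Suc j"]
      by (simp only: mult_2 mult_2_right distrib_left distrib_right)
    then show ?thesis unfolding rn_rE by (simp only: distrib_left mult.assoc power_Suc2)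
  qed
  also have "\<dots> + of_nat (2 * Suc j) * (rX * rE ^ Suc j) =
      rE ^ Suc (Suc j) * rn + (2 + of_nat (2 * Suc j)) * (rX * rE ^ Suc j)"
    by (simp only: distrib_right add.assoc)
  also have "2 + of_nat (2 * Suc j) = (of_nat (2 * Suc (Suc j)) :: recop)" by simp
  finally show ?case .
qed

text \<open>Moving n across the power of E costs one factor E in the correction term, and the
  denominator of D cancels another. The constant is 2 * 2 * (2m + 2) = 8 (m + 1).\<close>

lemma cheb_D_rE_power:
  "cheb_D * lfract_of (rE ^ (2 * Suc m)) = lfract_of (rE ^ (2 * m) * rstep m)"
proof -
  let ?E = "lfract_of rE"
  have E: "?E \<noteq> 0" using rSinv_minus_rS_nz by simp
  have "2 * rn * rE ^ (2 * Suc m) = rE * (rE ^ (2 * m) * rstep m)"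
  proof -
    have X: "rE ^ j * rX = rX * rE ^ j" for j
      by (rule power_commuting_commutes[OF rX_rE[symmetric]])
    have "2 * rn * rE ^ (2 * Suc m) = 2 * (rn * rE ^ Suc (2 * m + 1))"
      by (simp add: mult.assoc)
    also have "\<dots> = rE ^ (2 * m + 2) * (2 * rn) + of_nat (8 * Suc m) * (rX * rE ^ (2 * m + 1))"
    proof -
      have "(2 :: recop) * of_nat (2 * Suc (2 * m + 1)) = of_nat (8 * Suc m)" by simp
      moreover have "2 * (Z * rn) = Z * (2 * rn)" for Z
        by (simp only: mult_2 mult_2_right distrib_left)
      ultimately show ?thesis
        unfolding rn_rE_power by (simp only: distrib_left mult.assoc[symmetric]) simp
    qed
    also have "of_nat (8 * Suc m) * (rX * rE ^ (2 * m + 1)) = rE ^ (2 * m + 1) * (of_nat (8 * Suc m) * rX)"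
      by (metis X mult_of_nat_commute mult.assoc)
    also have "rE ^ (2 * m + 2) * (2 * rn) = rE ^ (2 * m + 1) * (2 * (rE * rn))"
    proof -
      have "rE ^ (2 * m + 2) = rE ^ (2 * m + 1) * rE"
        using power_Suc2[of rE "2 * m + 1"] by (simp del: power_Suc)
      then show ?thesis by (simp only: mult.assoc mult_2 mult_2_right distrib_left)
    qed
    finally show ?thesis
      by (simp add: rstep_def distrib_left mult.assoc)
  qed
  then have "lfract_of (2 * rn) * lfract_of (rE ^ (2 * Suc m)) =
      ?E * lfract_of (rE ^ (2 * m) * rstep m)"
    by (simp only: lfract_of_mult[symmetric])
  then show ?thesis using E unfolding cheb_D_def
    by (simp add: mult.assoc) (simp flip: mult.assoc)
qed

text \<open>Horner's scheme splits the sum into p_0(X) + F D, where F belongs to the tail; rewriting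
  D E^(2k+2) makes F meet exactly E^(2k), as the induction hypothesis requires.\<close>

lemma cheb_rec:
  "(\<Sum>i\<le>k. cheb_poly_X (p i) * cheb_D ^ i) * lfract_of (rE ^ (2 * k)) = lfract_of (cheb_rec k p)"
proof (induction k arbitrary: p)
  case 0
  then show ?case by (simp add: cheb_poly_X_rX)
next
  case (Suc k)
  let ?F = "\<Sum>i\<le>k. cheb_poly_X (p (Suc i)) * cheb_D ^ i"
  have "(\<Sum>i\<le>Suc k. cheb_poly_X (p i) * cheb_D ^ i) = cheb_poly_X (p 0) + ?F * cheb_D"
    by (simp add: sum.atMost_Suc_shift sum_distrib_right mult.assoc power_commutes del: sum.atMost_Suc)
  also have "\<dots> * lfract_of (rE ^ (2 * Suc k)) =
      cheb_poly_X (p 0) * lfract_of (rE ^ (2 * Suc k)) +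
      ?F * (cheb_D * lfract_of (rE ^ (2 * Suc k)))"
    by (simp only: distrib_right mult.assoc)
  also have "?F * (cheb_D * lfract_of (rE ^ (2 * Suc k))) =
      (?F * lfract_of (rE ^ (2 * k))) * lfract_of (rstep k)"
    by (simp only: cheb_D_rE_power lfract_of_mult mult.assoc)
  also have "?F * lfract_of (rE ^ (2 * k)) = lfract_of (cheb_rec k (p \<circ> Suc))"
    using Suc[of "p \<circ> Suc"] by (simp add: comp_def)
  finally show ?case
    by (simp only: cheb_rec.simps lfract_of_add lfract_of_mult cheb_poly_X_rX)
qed

lemma entire_rX [intro, simp]: "entire rX"
  unfolding rX_def by auto

lemma entire_rE [intro, simp]: "entire rE"
  by auto

lemma entire_sum: "(\<And>x. x \<in> A \<Longrightarrow> entire (g x)) \<Longrightarrow> entire (sum g A)"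
  by (induction A rule: infinite_finite_induct) auto

lemma entire_rX_poly [intro, simp]: "entire (rX_poly p)"
  unfolding rX_poly_def by (intro entire_sum entire_mult entire_power) auto

lemma entire_rstep [intro, simp]: "entire (rstep k)"
proof -
  have "entire 2" using entire_of_nat[of 2] by simp
  then show ?thesis unfolding rstep_def
    by (intro entire_add entire_mult entire_of_nat entire_rX entire_rE entire_basic)
qed

lemma entire_cheb_rec [intro, simp]: "entire (cheb_rec k p)"
  by (induction k arbitrary: p) (auto intro!: entire_add entire_mult entire_power simp del: power_Suc)

text \<open>Multiplication by \<open>Q\<close> on the left removes the fraction, and injectivity of
  \<open>lfract_of\<close> brings the identity back into the operator ring, where it can be
  evaluated at integers.\<close>

lemma cheb_rec_eq:
  assumes "Q \<noteq> 0" "inverse (lfract_of Q) * lfract_of P = (\<Sum>i\<le>k. cheb_poly_X (p i) * cheb_D ^ i)"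
  shows "P * rE ^ (2 * k) = Q * cheb_rec k p"
proof -
  have "lfract_of P = lfract_of Q * (inverse (lfract_of Q) * lfract_of P)"
    using assms(1) by (simp flip: mult.assoc)
  then have "lfract_of (P * rE ^ (2 * k)) =
      lfract_of Q * ((\<Sum>i\<le>k. cheb_poly_X (p i) * cheb_D ^ i) * lfract_of (rE ^ (2 * k)))"
    unfolding assms(2) by (simp only: lfract_of_mult mult.assoc)
  then have "lfract_of (P * rE ^ (2 * k)) = lfract_of (Q * cheb_rec k p)"
    by (simp only: cheb_rec lfract_of_mult)
  then show ?thesis by (simp only: lfract_of_eq_iff)
qed

section \<open>Adjoint operators on weighted polynomials\<close>

definition omx2 :: "real poly" where "omx2 = [:1, 0, -1:]"

definition tau :: "int \<Rightarrow> real poly" where "tau n = cheb_poly (nat \<bar>n\<bar>)"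

abbreviation rpoly :: "rat poly \<Rightarrow> real poly" where "rpoly \<equiv> map_poly of_rat"

text \<open>With \<open>w = (1 - x\<^sup>2)\<^bsup>-1/2\<^esup>\<close> one has
  \<open>(a w / (1 - x\<^sup>2)\<^sup>k)' = (wderiv k a) w / (1 - x\<^sup>2)\<^bsup>k+1\<^esup>\<close>.\<close>

definition wderiv :: "nat \<Rightarrow> real poly \<Rightarrow> real poly" where
  "wderiv k a = omx2 * pderiv a + smult (real (2 * k + 1)) ([:0, 1:] * a)"

text \<open>\<open>adj k p a w / (1 - x\<^sup>2)\<^sup>k\<close> is the formal adjoint of \<open>p\<^sub>0 + \<dots> + p\<^sub>k \<partial>\<^sub>x\<^sup>k\<close> applied
  to \<open>a w\<close>.\<close>

fun adj :: "nat \<Rightarrow> (nat \<Rightarrow> real poly) \<Rightarrow> real poly \<Rightarrow> real poly" where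
  "adj 0 p a = p 0 * a"
| "adj (Suc k) p a = omx2 ^ Suc k * (p 0 * a) - wderiv k (adj k (p \<circ> Suc) a)"

lemma omx2_nz [simp]: "omx2 \<noteq> 0"
  by (simp add: omx2_def)

lemma poly_omx2: "poly omx2 x = 1 - x\<^sup>2"
  by (simp add: omx2_def power2_eq_square)

lemma poly_tau: "poly (tau n) (cos t) = cos (of_int n * t)"
  using cheb_T_cos[of n t] by (simp add: cheb_T_def tau_def)

lemma poly_eqI_poly:
  fixes p q :: "real poly"
  assumes "\<And>x. poly p x = poly q x"
  shows "p = q"
  using assms poly_eq_poly_eq_iff[of p q] by blast

text \<open>The cosine takes every value in [-1, 1], so a nonzero difference would have infinitely
  many roots.\<close>

lemma poly_eq_cosI:
  fixes p q :: "real poly"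
  assumes "\<And>t. poly p (cos t) = poly q (cos t)"
  shows "p = q"
proof (rule ccontr)
  assume "p \<noteq> q"
  then have "finite {x. poly (p - q) x = 0}" by (intro poly_roots_finite) simp
  moreover have "{- 1..1} \<subseteq> {x. poly (p - q) x = 0}"
  proof
    fix x :: real assume "x \<in> {- 1..1}"
    then have "cos (arccos x) = x" by simp
    then show "x \<in> {x. poly (p - q) x = 0}" using assms[of "arccos x"] by simp
  qed
  moreover have "infinite {- 1..1::real}" by (rule infinite_Icc) simp
  ultimately show False using finite_subset by blast
qed

section \<open>Trigonometric identities for Chebyshev polynomials\<close>

lemma tau_X: "tau (n + 1) + tau (n - 1) = [:0, 2:] * tau n"
  by (rule poly_eq_cosI) (simp add: poly_tau cos_add cos_diff algebra_simps)

text \<open>With x = cos t the second difference is 2 cos(nt) (cos(2t) - 1) = -4 sin^2 t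
  cos(nt).\<close>

lemma tau_E2: "tau (n - 2) - 2 * tau n + tau (n + 2) = - 4 * omx2 * tau n"
proof (rule poly_eq_cosI)
  fix t :: real
  have "cos (of_int (n - 2) * t) + cos (of_int (n + 2) * t) = 2 * cos (of_int n * t) * cos (2 * t)"
    by (simp add: algebra_simps cos_add cos_diff)
  also have "cos (2 * t) = 2 * (cos t)\<^sup>2 - 1" by (rule cos_double_cos)
  finally show "poly (tau (n - 2) - 2 * tau n + tau (n + 2)) (cos t) =
      poly (- 4 * omx2 * tau n) (cos t)"
    unfolding poly_add poly_diff poly_mult poly_tau poly_omx2 poly_numeral poly_minus by algebra
qed

text \<open>Differentiating T_n(cos t) = cos(nt) gives T_n'(cos t) sin t = n sin(nt); a further
  factor 2 sin t and the product formula for sines avoid a division by sin t.\<close>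

lemma tau_pderiv: "2 * omx2 * pderiv (tau n) = smult (of_int n) (tau (n - 1) - tau (n + 1))"
proof (rule poly_eq_cosI)
  fix t :: real
  let ?d = "poly (pderiv (tau n)) (cos t)"
  have "((\<lambda>t. poly (tau n) (cos t)) has_real_derivative ?d * - sin t) (at t)"
    by (rule DERIV_chain2[OF poly_DERIV DERIV_cos])
  moreover have "((\<lambda>t. cos (of_int n * t)) has_real_derivative - (of_int n * sin (of_int n * t))) (at t)"
    by (auto intro!: derivative_eq_intros)
  ultimately have "?d * - sin t = - (of_int n * sin (of_int n * t))"
    unfolding poly_tau by (rule DERIV_unique)
  then have d: "?d * sin t = of_int n * sin (of_int n * t)" by simp
  have "1 - (cos t)\<^sup>2 = sin t * sin t"
    using sin_cos_squared_add[of t] by (simp add: power2_eq_square)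
  then have "2 * (1 - (cos t)\<^sup>2) * ?d = of_int n * (2 * sin (of_int n * t) * sin t)"
    using d by algebra
  also have "2 * sin (of_int n * t) * sin t = cos (of_int (n - 1) * t) - cos (of_int (n + 1) * t)"
    by (simp add: algebra_simps cos_add cos_diff)
  finally show "poly (2 * omx2 * pderiv (tau n)) (cos t) =
      poly (smult (of_int n) (tau (n - 1) - tau (n + 1))) (cos t)"
    by (simp only: poly_mult poly_smult poly_diff poly_tau poly_omx2 poly_numeral)
qed

lemma wderiv_linear:
  "wderiv k (a + b) = wderiv k a + wderiv k b" "wderiv k (smult c a) = smult c (wderiv k a)"
  by (simp_all add: wderiv_def pderiv_add pderiv_smult algebra_simps smult_add_right)

lemma adj_linear:
  "adj k p (a + b) = adj k p a + adj k p b" "adj k p (smult c a) = smult c (adj k p a)"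
  by (induction k arbitrary: p)
    (simp_all add: wderiv_linear algebra_simps smult_diff_right)

section \<open>Action of the recurrence operators on T_n\<close>

lemma rec_act_rE: "rec_act rE y n = y (n - 1) - y (n + 1)"
  by (simp add: rec_act_entire rec_act_basic)

lemma rec_act_rX_tau: "rec_act rX tau n = [:0, 1:] * tau n"
proof -
  have "rec_act rX tau n = smult (1 / 2) (tau (n + 1) + tau (n - 1))"
    by (simp add: rX_def rec_act_entire rec_act_basic entire_add of_rat_divide)
  also have "\<dots> = [:0, 1:] * tau n" unfolding tau_X by (simp flip: smult_add_right)
  finally show ?thesis .
qed

lemma rec_act_rE_tau: "rec_act (rE ^ (2 * k)) tau n = smult ((- 4) ^ k) (omx2 ^ k * tau n)"
proof (induction k arbitrary: n)
  case 0
  then show ?case by (simp add: rec_act_basic)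
next
  case (Suc k)
  let ?C = "\<lambda>a. smult ((- 4) ^ k) (omx2 ^ k * a)"
  have IH: "rec_act (rE ^ (2 * k)) tau = (\<lambda>n. ?C (tau n))" using Suc by blast
  have e: "entire (rE ^ (2 * k))" by (rule entire_power[OF entire_rE])
  have "rE ^ (2 * Suc k) = rE * (rE * rE ^ (2 * k))" by simp
  then have "rec_act (rE ^ (2 * Suc k)) tau n = rec_act rE (rec_act rE (rec_act (rE ^ (2 * k)) tau)) n"
    by (simp only: rec_act_entire(3)[OF entire_rE] entire_mult entire_rE e)
  also have "\<dots> = ?C (tau (n - 2) - 2 * tau n + tau (n + 2))"
    unfolding IH rec_act_rE by (simp add: algebra_simps smult_diff_right smult_add_right)
  also have "\<dots> = smult ((- 4) ^ Suc k) (omx2 ^ Suc k * tau n)"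
    unfolding tau_E2 by (simp add: numeral_poly algebra_simps)
  finally show ?case .
qed

text \<open>E n sends T_n to n (T_{n-1} - T_{n+1}) - 2x T_n = 2 (1 - x^2) T_n' - 2x T_n. Doubling
  and adding 8 (k + 1) x T_n leaves the coefficient 8k + 4 = 4 (2k + 1) of x T_n, as in
  \<open>wderiv k\<close>.\<close>

lemma rec_act_rstep_tau: "rec_act (rstep k) tau n = 4 * wderiv k (tau n)"
proof -
  have e: "entire 2" "entire (rE * rn)" "entire (of_nat (8 * Suc k) * rX)" "entire (2 * (rE * rn))"
    using entire_of_nat[of 2] entire_mult[OF entire_rE] entire_mult[OF entire_of_nat entire_rX]
    by (simp_all only: of_nat_numeral entire_basic entire_mult)
  have 2: "rec_act 2 y n = smult 2 (y n)" for y
    using rec_act_of_nat[of 2 y n] by simp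
  have "rec_act (rE * rn) tau n =
      smult (of_int n) (tau (n - 1) - tau (n + 1)) - (tau (n + 1) + tau (n - 1))"
    unfolding rec_act_entire(3)[OF entire_rE entire_basic(5)] rec_act_rE rec_act_basic
    by (simp add: smult_add_left smult_diff_left smult_diff_right)
  also have "\<dots> = 2 * omx2 * pderiv (tau n) - [:0, 2:] * tau n"
    by (simp only: tau_pderiv tau_X)
  finally have 1: "rec_act (rE * rn) tau n = 2 * omx2 * pderiv (tau n) - [:0, 2:] * tau n" .
  have "rec_act (rstep k) tau n =
      smult 2 (rec_act (rE * rn) tau n) + smult (of_nat (8 * Suc k)) (rec_act rX tau n)"
    unfolding rstep_def
    by (simp only: rec_act_entire(1)[OF e(4,3)] rec_act_entire(3)[OF e(1,2)]
       rec_act_entire(3)[OF entire_of_nat entire_rX] 2 rec_act_of_nat)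
  also have "\<dots> = 4 * wderiv k (tau n)"
    unfolding 1 rec_act_rX_tau wderiv_def
    by (rule poly_eqI_poly) (simp add: algebra_simps)
  finally show ?thesis .
qed

lemma rec_act_rX_poly_tau: "rec_act (rX_poly p) tau n = rpoly p * tau n"
proof -
  have X: "rec_act (rX ^ j) tau n = [:0, 1:] ^ j * tau n" for j n
  proof (induction j arbitrary: n)
    case 0
    then show ?case by (simp add: rec_act_basic)
  next
    case (Suc j)
    have "rec_act (rX ^ Suc j) tau n = rec_act (rX ^ j) (\<lambda>n. [:0, 1:] * tau n) n"
      unfolding power_Suc2
      by (simp only: rec_act_entire(3)[OF entire_power entire_rX] entire_rX rec_act_rX_tau[abs_def])
    also have "\<dots> = [:0, 1:] * rec_act (rX ^ j) tau n"
      by (rule rec_act_linear) (simp_all only: distrib_left mult_smult_right)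
    finally show ?case by (simp only: Suc power_Suc mult.assoc)
  qed
  have e: "entire (rconst c * rX ^ j)" for c j
    by (intro entire_mult entire_basic entire_power entire_rX)
  have "rec_act (\<Sum>j\<in>A. rconst (coeff p j) * rX ^ j) tau n =
      (\<Sum>j\<in>A. smult (of_rat (coeff p j)) ([:0, 1:] ^ j)) * tau n" if "finite A" for A
    using that
  proof (induction A)
    case empty
    then show ?case by (simp add: rec_act_def rsupp_def)
  next
    case (insert j A)
    have "rec_act (rconst (coeff p j) * rX ^ j) tau n = smult (of_rat (coeff p j)) ([:0, 1:] ^ j * tau n)"
      using rec_act_entire(3)[OF entire_basic(6) entire_power[OF entire_rX], of "coeff p j" j tau]
      by (simp only: rec_act_basic X)
    moreover have "entire (\<Sum>j\<in>A. rconst (coeff p j) * rX ^ j)" by (rule entire_sum) (rule e)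
    ultimately show ?case using insert
      by (simp add: rec_act_entire(1)[OF e] distrib_right)
  qed
  then have "rec_act (rX_poly p) tau n =
      (\<Sum>j\<le>degree p. smult (of_rat (coeff p j)) ([:0, 1:] ^ j)) * tau n"
    unfolding rX_poly_def by blast
  also have "(\<Sum>j\<le>degree p. smult (of_rat (coeff p j)) ([:0, 1:] ^ j)) = rpoly p"
  proof -
    have "degree (rpoly p) = degree p" by (rule degree_map_poly) simp
    then show ?thesis
      using poly_as_sum_of_monoms[of "rpoly p"] by (simp add: coeff_map_poly monom_altdef)
  qed
  finally show ?thesis .
qed

text \<open>Maps in x commute with operators in n, so a product of recurrence operators acts through
  the maps in x in reversed order; this reversal produces the adjoint. Its minus sign comes from
  (-4)^k * 4 = - (-4)^(k+1).\<close>

lemma rec_act_cheb_rec_tau: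
  "rec_act (cheb_rec k p) tau n = smult ((- 4) ^ k) (adj k (\<lambda>i. rpoly (p i)) (tau n))"
proof (induction k arbitrary: p n)
  case 0
  then show ?case by (simp add: rec_act_rX_poly_tau)
next
  case (Suc k)
  let ?A = "adj k ((\<lambda>i. rpoly (p i)) \<circ> Suc)"
  have e1: "entire (rE ^ (2 * Suc k))" by (rule entire_power[OF entire_rE])
  have e2: "entire (rX_poly (p 0) * rE ^ (2 * Suc k))" "entire (cheb_rec k (p \<circ> Suc) * rstep k)"
    by (intro entire_mult entire_rX_poly e1 entire_cheb_rec entire_rstep)+
  have "rec_act (rX_poly (p 0)) (rec_act (rE ^ (2 * Suc k)) tau) n =
      rec_act (rX_poly (p 0)) (\<lambda>n. smult ((- 4) ^ Suc k) (omx2 ^ Suc k * tau n)) n"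
    by (simp only: rec_act_rE_tau[abs_def])
  also have "\<dots> = smult ((- 4) ^ Suc k) (omx2 ^ Suc k * (rpoly (p 0) * tau n))"
    by (subst rec_act_linear[where C = "\<lambda>a. smult ((- 4) ^ Suc k) (omx2 ^ Suc k * a)"])
      (simp_all add: algebra_simps smult_add_right rec_act_rX_poly_tau)
  finally have 1: "rec_act (rX_poly (p 0) * rE ^ (2 * Suc k)) tau n =
      smult ((- 4) ^ Suc k) (omx2 ^ Suc k * (rpoly (p 0) * tau n))"
    by (simp only: rec_act_entire(3)[OF entire_rX_poly e1])
  have "rec_act (cheb_rec k (p \<circ> Suc)) (rec_act (rstep k) tau) n =
      rec_act (cheb_rec k (p \<circ> Suc)) (\<lambda>n. smult 4 (wderiv k (tau n))) n"
    by (simp only: rec_act_rstep_tau[abs_def] numeral_poly[abs_def]) simp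
  also have "\<dots> = smult 4 (wderiv k (rec_act (cheb_rec k (p \<circ> Suc)) tau n))"
    by (rule rec_act_linear) (simp_all only: wderiv_linear smult_add_right smult_smult mult.commute)
  also have "\<dots> = - smult ((- 4) ^ Suc k) (wderiv k (?A (tau n)))"
    by (simp add: Suc wderiv_linear comp_def)
  finally have 2: "rec_act (cheb_rec k (p \<circ> Suc) * rstep k) tau n =
      - smult ((- 4) ^ Suc k) (wderiv k (?A (tau n)))"
    by (simp only: rec_act_entire(3)[OF entire_cheb_rec entire_rstep])
  show ?case
    by (simp only: cheb_rec.simps rec_act_entire(1)[OF e2] 1 2 adj.simps smult_diff_right)
qed

text \<open>\<open>rE ^ (2 * k)\<close> and \<open>cheb_rec k p\<close> are entire, so the identity
  of \<open>cheb_rec_eq\<close> can be applied to the T_n wherever \<open>P\<close> and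
  \<open>Q\<close> are regular; the common factor (-4)^k cancels.\<close>

lemma adj_rec_act:
  assumes "Q \<noteq> 0" "inverse (lfract_of Q) * lfract_of P = (\<Sum>i\<le>k. cheb_poly_X (p i) * cheb_D ^ i)"
    and P: "rec_regular_at P n" and Q: "rec_regular_at Q n"
  shows "adj k (\<lambda>i. rpoly (p i)) (rec_act Q tau n) = omx2 ^ k * rec_act P tau n"
proof -
  let ?A = "adj k (\<lambda>i. rpoly (p i))"
  have "smult ((- 4) ^ k) (omx2 ^ k * rec_act P tau n) = rec_act (P * rE ^ (2 * k)) tau n"
    unfolding rec_act_mult[OF P entire_power[OF entire_rE]] rec_act_rE_tau[abs_def]
    by (rule rec_act_linear[symmetric])
      (simp_all add: algebra_simps smult_add_right)
  also have "\<dots> = rec_act (Q * cheb_rec k p) tau n"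
    by (simp only: cheb_rec_eq[OF assms(1,2)])
  also have "\<dots> = smult ((- 4) ^ k) (?A (rec_act Q tau n))"
    unfolding rec_act_mult[OF Q entire_cheb_rec] rec_act_cheb_rec_tau[abs_def]
    by (rule rec_act_linear) (simp_all only: adj_linear smult_add_right smult_smult mult.commute)
  finally have "smult (inverse ((- 4) ^ k)) (smult ((- 4) ^ k) (omx2 ^ k * rec_act P tau n)) =
      smult (inverse ((- 4) ^ k)) (smult ((- 4) ^ k) (?A (rec_act Q tau n)))"
    by (rule arg_cong)
  then show ?thesis unfolding smult_smult by simp
qed

section \<open>Divisibility by powers of \<open>1 - x\<^sup>2\<close>\<close>

text \<open>x is its own inverse modulo 1 - x^2: a = (1 - x^2) a + x (x a).\<close>

lemma omx2_dvd_x_mult: "omx2 dvd [:0, 1:] * a \<Longrightarrow> omx2 dvd a"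
proof -
  assume "omx2 dvd [:0, 1:] * a"
  then have "omx2 dvd omx2 * a + [:0, 1:] * ([:0, 1:] * a)" by (rule dvd_add[OF dvd_triv_left dvd_mult])
  also have "\<dots> = a"
    by (rule poly_eqI_poly) (simp add: poly_omx2 power2_eq_square algebra_simps)
  finally show ?thesis .
qed

lemma pderiv_omx2: "pderiv omx2 = [:0, -2:]"
  by (simp add: omx2_def pderiv_pCons)

text \<open>Both sides are the numerator over (1 - x^2)^(k+2) of the derivative of a w / (1 -
  x^2)^k, the left one computed before cancelling a factor 1 - x^2.\<close>

lemma wderiv_omx2: "wderiv (Suc k) (omx2 * a) = omx2 * wderiv k a"
  by (rule poly_eqI_poly)
    (simp add: wderiv_def pderiv_mult pderiv_omx2 poly_omx2 algebra_simps)

lemma wderiv_0_omx2: "wderiv 0 (omx2 * a) = omx2 * (omx2 * pderiv a - [:0, 1:] * a)"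
  by (rule poly_eqI_poly)
    (simp add: wderiv_def pderiv_mult pderiv_omx2 poly_omx2 algebra_simps)

text \<open>The function differentiated here is a (1 - x^2)^(1/2), with derivative ((1 - x^2) a' - x
  a) w.\<close>

lemma wderiv_power_omx2:
  "wderiv k (omx2 ^ Suc k * a) = omx2 ^ Suc k * (omx2 * pderiv a - [:0, 1:] * a)"
  by (induction k) (simp_all only: wderiv_omx2 wderiv_0_omx2 power_Suc mult.assoc power_0 mult_1_left)

text \<open>The factor 1 - x^2 in front of a' restores the one that differentiating the power
  removes.\<close>

lemma wderiv_dvd: "omx2 ^ i dvd a \<Longrightarrow> omx2 ^ i dvd wderiv k a"
proof (cases i)
  case (Suc j)
  assume "omx2 ^ i dvd a"
  then obtain b where b: "a = omx2 ^ i * b" by (elim dvdE)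
  have "omx2 * pderiv (omx2 ^ i) = smult (of_nat i) (omx2 ^ i * pderiv omx2)" for i
    by (induction i) (simp_all add: pderiv_mult smult_add_left algebra_simps)
  moreover have "omx2 * pderiv a = omx2 ^ i * (omx2 * pderiv b) + b * (omx2 * pderiv (omx2 ^ i))"
    by (simp add: b pderiv_mult algebra_simps)
  ultimately have "omx2 * pderiv a = omx2 ^ i * (omx2 * pderiv b + smult (of_nat i) (pderiv omx2 * b))"
    by (simp add: algebra_simps)
  then have "omx2 ^ i dvd omx2 * pderiv a" by simp
  then show ?thesis unfolding wderiv_def
    by (rule dvd_add[OF _ dvd_smult[OF dvd_mult]]) (simp add: b)
qed simp

text \<open>The exponents of \<open>1 - x\<^sup>2\<close> in \<open>a w (1 - x\<^sup>2)\<^bsup>-N\<^esup>\<close> are half-integers, so no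
  pole can disappear under differentiation.\<close>

lemma wderiv_dvdD: "omx2 ^ Suc k dvd wderiv k a \<Longrightarrow> omx2 ^ Suc k dvd a"
proof (induction k arbitrary: a)
  case (0 a)
  then have "omx2 dvd wderiv 0 a - omx2 * pderiv a" by simp
  then show ?case by (simp add: wderiv_def omx2_dvd_x_mult)
next
  case (Suc k a)
  have "omx2 dvd omx2 ^ Suc (Suc k)" by simp
  then have "omx2 dvd wderiv (Suc k) a" using Suc.prems by (rule dvd_trans)
  then have "omx2 dvd wderiv (Suc k) a - omx2 * pderiv a" by simp
  then have "omx2 dvd smult (real (2 * Suc k + 1)) ([:0, 1:] * a)" by (simp add: wderiv_def)
  then have "omx2 dvd [:0, 1:] * a" by (rule dvd_smult_cancel) simp
  then obtain b where b: "a = omx2 * b" using omx2_dvd_x_mult by (meson dvdE)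
  then have "omx2 ^ Suc k dvd wderiv k b"
    using Suc.prems by (simp only: wderiv_omx2 power_Suc[of _ "Suc k"] dvd_mult_cancel_left omx2_nz) simp
  then have "omx2 ^ Suc k dvd b" by (rule Suc.IH)
  then show ?case by (simp add: b)
qed

text \<open>The offset \<open>j\<close> serves the induction: dropping p_0 shifts the index, so the
  tail \<open>p \<circ> Suc\<close> satisfies the hypothesis with j + 1, and \<open>wderiv\<close>
  loses no factor.\<close>

lemma adj_dvd:
  assumes "\<And>i. i \<le> k \<Longrightarrow> omx2 ^ (i + j) dvd p i"
  shows "omx2 ^ (k + j) dvd adj k p a"
  using assms
proof (induction k arbitrary: p j)
  case 0
  then show ?case by simp
next
  case (Suc k)
  have "omx2 ^ (k + Suc j) dvd adj k (p \<circ> Suc) a"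
    by (rule Suc.IH) (use Suc.prems in force)
  then have "omx2 ^ (Suc k + j) dvd wderiv k (adj k (p \<circ> Suc) a)" by (intro wderiv_dvd) simp
  moreover have "omx2 ^ (Suc k + j) dvd omx2 ^ Suc k * (p 0 * a)"
    using Suc.prems[of 0] unfolding power_add by (intro mult_dvd_mono dvd_refl dvd_mult2) simp
  ultimately show ?case by (simp only: adj.simps dvd_diff)
qed

section \<open>Improper integrals over \<open>]-1, 1[\<close> through primitives\<close>

text \<open>With convergence expressed by a primitive that has limits at both ends, integration by
  parts reduces to the product rule and to limits. For continuous \<open>g\<close> this amounts to a
  convergent improper integral.\<close>

definition has_prim :: "(real \<Rightarrow> real) \<Rightarrow> real \<Rightarrow> bool" where
  "has_prim g I \<longleftrightarrow> (\<exists>G A B. (\<forall>x\<in>{-1<..<1}. (G has_real_derivative g x) (at x)) \<and>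
     (G \<longlongrightarrow> A) (at_right (- 1)) \<and> (G \<longlongrightarrow> B) (at_left 1) \<and> I = B - A)"

lemma has_primI:
  assumes "\<And>x. x \<in> {-1<..<1} \<Longrightarrow> (G has_real_derivative g x) (at x)"
    and "(G \<longlongrightarrow> A) (at_right (- 1))" "(G \<longlongrightarrow> B) (at_left 1)"
  shows "has_prim g (B - A)"
  using assms unfolding has_prim_def by blast

lemma has_primE:
  assumes "has_prim g I"
  obtains G A B where "\<And>x. x \<in> {-1<..<1} \<Longrightarrow> (G has_real_derivative g x) (at x)"
    and "(G \<longlongrightarrow> A) (at_right (- 1))" "(G \<longlongrightarrow> B) (at_left 1)" "I = B - A"
  using assms unfolding has_prim_def by blast

lemma has_prim_cong:
  "(\<And>x. x \<in> {-1<..<1} \<Longrightarrow> g x = h x) \<Longrightarrow> has_prim g I \<longleftrightarrow> has_prim h I"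
  by (simp add: has_prim_def)

lemma has_prim_0: "has_prim (\<lambda>x. 0) 0"
  using has_primI[of "\<lambda>x. 0" "\<lambda>x. 0" 0 0] by simp

lemma has_prim_add:
  assumes "has_prim g I" "has_prim h J"
  shows "has_prim (\<lambda>x. g x + h x) (I + J)"
proof -
  obtain G A B where 1: "\<And>x. x \<in> {-1<..<1} \<Longrightarrow> (G has_real_derivative g x) (at x)"
    "(G \<longlongrightarrow> A) (at_right (- 1))" "(G \<longlongrightarrow> B) (at_left 1)" "I = B - A"
    using has_primE[OF assms(1)] by metis
  obtain H C D where 2: "\<And>x. x \<in> {-1<..<1} \<Longrightarrow> (H has_real_derivative h x) (at x)"
    "(H \<longlongrightarrow> C) (at_right (- 1))" "(H \<longlongrightarrow> D) (at_left 1)" "J = D - C"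
    using has_primE[OF assms(2)] by metis
  have "has_prim (\<lambda>x. g x + h x) ((B + D) - (A + C))"
    by (rule has_primI[where G = "\<lambda>x. G x + H x"]) (intro DERIV_add tendsto_add 1 2; assumption)+
  moreover have "(B + D) - (A + C) = I + J" by (simp add: 1(4) 2(4))
  ultimately show ?thesis by (simp only:)
qed

lemma has_prim_cmult:
  assumes "has_prim g I"
  shows "has_prim (\<lambda>x. c * g x) (c * I)"
proof -
  obtain G A B where 1: "\<And>x. x \<in> {-1<..<1} \<Longrightarrow> (G has_real_derivative g x) (at x)"
    "(G \<longlongrightarrow> A) (at_right (- 1))" "(G \<longlongrightarrow> B) (at_left 1)" "I = B - A"
    using has_primE[OF assms(1)] by metis
  have "has_prim (\<lambda>x. c * g x) (c * B - c * A)"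
    by (rule has_primI[where G = "\<lambda>x. c * G x"]) (intro DERIV_cmult tendsto_mult tendsto_const 1; assumption)+
  moreover have "c * B - c * A = c * I" by (simp add: 1(4) right_diff_distrib)
  ultimately show ?thesis by (simp only:)
qed

lemma has_prim_sum:
  assumes "\<And>i. i \<in> A \<Longrightarrow> has_prim (g i) (I i)"
  shows "has_prim (\<lambda>x. \<Sum>i\<in>A. g i x) (\<Sum>i\<in>A. I i)"
  using assms by (induction A rule: infinite_finite_induct) (simp_all add: has_prim_0 has_prim_add)

section \<open>Comparison with improper integrals\<close>

lemma has_prim_improper:
  assumes "has_prim g I"
  shows "has_improper_integral g I"
proof -
  obtain G A B where G: "\<And>x. x \<in> {-1<..<1} \<Longrightarrow> (G has_real_derivative g x) (at x)"
    "(G \<longlongrightarrow> A) (at_right (- 1))" "(G \<longlongrightarrow> B) (at_left 1)" "I = B - A"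
    using has_primE[OF assms(1)] by metis
  have int: "(g has_integral (G b - G a)) {a..b}" if "- 1 < a" "a \<le> b" "b < 1" for a b
  proof (rule fundamental_theorem_of_calculus)
    fix x assume "x \<in> {a..b}"
    then have "(G has_real_derivative g x) (at x)" using that by (intro G) auto
    then show "(G has_vector_derivative g x) (at x within {a..b})"
      by (simp add: has_real_derivative_iff_has_vector_derivative has_vector_derivative_at_within)
  qed (rule that)
  have "((\<lambda>z. G (snd z) - G (fst z)) \<longlongrightarrow> B - A) (at_right (- 1) \<times>\<^sub>F at_left 1)"
    by (intro tendsto_diff filterlim_compose[OF G(3) filterlim_snd] filterlim_compose[OF G(2) filterlim_fst])
  moreover have "\<forall>\<^sub>F z in at_right (- 1) \<times>\<^sub>F at_left 1.
      G (snd z) - G (fst z) = (case z of (a, b) \<Rightarrow> integral {a..b} g)"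
  proof -
    have "\<forall>\<^sub>F a in at_right (- 1). a \<in> {- 1<..<0::real}" "\<forall>\<^sub>F b in at_left 1. b \<in> {0<..<1::real}"
      by (rule eventually_at_right_real eventually_at_left_real; simp)+
    then show ?thesis unfolding eventually_prod_filter
      using integral_unique[OF int] by fastforce
  qed
  ultimately have "((\<lambda>(a, b). integral {a..b} g) \<longlongrightarrow> I) (at_right (- 1) \<times>\<^sub>F at_left 1)"
    unfolding G(4) by (rule Lim_transform_eventually)
  then show ?thesis using int unfolding has_improper_integral_def by blast
qed

text \<open>Freezing one variable at an admissible point gives the Cauchy criterion in the
  other.\<close>

lemma tendsto_diff_prod_filter_convergent:
  fixes G :: "real \<Rightarrow> real"
  assumes "((\<lambda>(a, b). G b - G a) \<longlongrightarrow> I) (X \<times>\<^sub>F Y)" and "X \<noteq> bot" "Y \<noteq> bot"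
  shows "\<exists>A. (G \<longlongrightarrow> A) X" and "\<exists>B. (G \<longlongrightarrow> B) Y"
proof -
  have ev: "\<exists>P Q. eventually P X \<and> eventually Q Y \<and>
      (\<forall>a b. P a \<longrightarrow> Q b \<longrightarrow> \<bar>G b - G a - I\<bar> < e / 2)" if "e > 0" for e
  proof -
    have "\<forall>\<^sub>F z in X \<times>\<^sub>F Y. dist (case z of (a, b) \<Rightarrow> G b - G a) I < e / 2"
      using assms(1) that by (intro tendstoD) auto
    then show ?thesis unfolding eventually_prod_filter by (simp add: dist_real_def)
  qed
  have "cauchy_filter (filtermap G X)" unfolding cauchy_filter_metric_filtermap
  proof (intro allI impI)
    fix e :: real assume "e > 0"
    from ev[OF this] obtain P Q where PQ: "eventually P X" "eventually Q Y"
      "\<And>a b. P a \<Longrightarrow> Q b \<Longrightarrow> \<bar>G b - G a - I\<bar> < e / 2" by blast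
    obtain b where b: "Q b" using eventually_happens'[OF assms(3) PQ(2)] by blast
    have "dist (G x) (G y) < e" if "P x" "P y" for x y
      using PQ(3)[OF that(1) b] PQ(3)[OF that(2) b] unfolding dist_real_def by linarith
    then show "\<exists>P. eventually P X \<and> (\<forall>x y. P x \<and> P y \<longrightarrow> dist (G x) (G y) < e)"
      using PQ(1) by blast
  qed
  moreover have "filtermap G X \<noteq> bot" using assms(2) by (simp add: filtermap_bot_iff)
  ultimately show "\<exists>A. (G \<longlongrightarrow> A) X"
    using complete_UNIV[where 'a = real] unfolding complete_uniform filterlim_def by auto
  have "cauchy_filter (filtermap G Y)" unfolding cauchy_filter_metric_filtermap
  proof (intro allI impI)
    fix e :: real assume "e > 0"
    from ev[OF this] obtain P Q where PQ: "eventually P X" "eventually Q Y"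
      "\<And>a b. P a \<Longrightarrow> Q b \<Longrightarrow> \<bar>G b - G a - I\<bar> < e / 2" by blast
    obtain a where a: "P a" using eventually_happens'[OF assms(2) PQ(1)] by blast
    have "dist (G x) (G y) < e" if "Q x" "Q y" for x y
      using PQ(3)[OF a that(1)] PQ(3)[OF a that(2)] unfolding dist_real_def by linarith
    then show "\<exists>P. eventually P Y \<and> (\<forall>x y. P x \<and> P y \<longrightarrow> dist (G x) (G y) < e)"
      using PQ(2) by blast
  qed
  moreover have "filtermap G Y \<noteq> bot" using assms(3) by (simp add: filtermap_bot_iff)
  ultimately show "\<exists>B. (G \<longlongrightarrow> B) Y"
    using complete_UNIV[where 'a = real] unfolding complete_uniform filterlim_def by auto
qed

text \<open>A continuous function has an antiderivative on the open interval; the joint limit of its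
  increments splits into one limit at each end.\<close>

lemma improper_convergent_has_prim:
  assumes cont: "continuous_on {-1<..<1} g" and "improper_convergent g"
  shows "\<exists>I. has_prim g I"
proof -
  obtain I where I: "((\<lambda>(a, b). integral {a..b} g) \<longlongrightarrow> I) (at_right (- 1) \<times>\<^sub>F at_left 1)"
    using assms(2) by (auto simp: improper_convergent_def has_improper_integral_def)
  have "isCont g x" if "- 1 < x" "x < 1" for x
    using cont that by (simp add: continuous_on_eq_continuous_at)
  then obtain G where "\<forall>x. - 1 < x \<longrightarrow> x < 1 \<longrightarrow> (G has_vector_derivative g x) (at x)"
    using einterval_antiderivative[of "- 1" 1 g] by (auto simp: one_ereal_def)
  then have G: "(G has_real_derivative g x) (at x)" if "x \<in> {-1<..<1}" for x
    using that by (simp add: has_real_derivative_iff_has_vector_derivative)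
  have int: "integral {a..b} g = G b - G a" if "- 1 < a" "a \<le> b" "b < 1" for a b
  proof (rule integral_unique, rule fundamental_theorem_of_calculus)
    fix x assume "x \<in> {a..b}"
    then have "(G has_real_derivative g x) (at x)" using that by (intro G) auto
    then show "(G has_vector_derivative g x) (at x within {a..b})"
      by (simp add: has_real_derivative_iff_has_vector_derivative has_vector_derivative_at_within)
  qed (rule that)
  have "\<forall>\<^sub>F z in at_right (- 1) \<times>\<^sub>F at_left 1.
      (case z of (a, b) \<Rightarrow> integral {a..b} g) = (case z of (a, b) \<Rightarrow> G b - G a)"
  proof -
    have "\<forall>\<^sub>F a in at_right (- 1). a \<in> {- 1<..<0::real}" "\<forall>\<^sub>F b in at_left 1. b \<in> {0<..<1::real}"
      by (rule eventually_at_right_real eventually_at_left_real; simp)+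
    then show ?thesis unfolding eventually_prod_filter using int by fastforce
  qed
  then have lim: "((\<lambda>(a, b). G b - G a) \<longlongrightarrow> I) (at_right (- 1) \<times>\<^sub>F at_left 1)"
    by (rule Lim_transform_eventually[OF I])
  have "\<exists>A. (G \<longlongrightarrow> A) (at_right (- 1))" "\<exists>B. (G \<longlongrightarrow> B) (at_left 1)"
    by (rule tendsto_diff_prod_filter_convergent[OF lim]; simp)+
  then show ?thesis using has_primI[OF G] by blast
qed

text \<open>The limits extend \<open>g\<close> continuously to [-1, 1], and a primitive of the
  extension is continuous up to the ends.\<close>

lemma limits_has_prim:
  assumes cont: "continuous_on {-1<..<1} g"
    and A: "(g \<longlongrightarrow> A) (at_right (- 1))" and B: "(g \<longlongrightarrow> B) (at_left 1)"
  shows "\<exists>I. has_prim g I"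
proof -
  define h where "h x = (if x \<le> - 1 then A else if x \<ge> 1 then B else g x)" for x :: real
  have ev: "\<forall>\<^sub>F x in at_right (- 1). g x = h x" "\<forall>\<^sub>F x in at_left 1. g x = h x"
    using eventually_at_right_real[of "- 1" 1] eventually_at_left_real[of "- 1" 1]
    by (auto elim!: eventually_mono simp: h_def)
  have ends: "h (- 1) = A" "h 1 = B" by (simp_all add: h_def)
  have "continuous_on {- 1..1} h"
  proof (rule continuous_on_IccI)
    show "(h \<longlongrightarrow> h (- 1)) (at_right (- 1))"
      unfolding ends by (rule Lim_transform_eventually[OF A ev(1)])
    show "(h \<longlongrightarrow> h 1) (at_left 1)"
      unfolding ends by (rule Lim_transform_eventually[OF B ev(2)])
    show "h \<midarrow>x\<rightarrow> h x" if "- 1 < x" "x < 1" for x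
    proof -
      have "g \<midarrow>x\<rightarrow> g x"
        using cont that by (simp add: continuous_on_eq_continuous_at isCont_def)
      moreover have "\<forall>\<^sub>F y in at x. g y = h y"
        using eventually_at_in_open'[of "{-1<..<1}" x] that by (auto elim!: eventually_mono simp: h_def)
      ultimately have "h \<midarrow>x\<rightarrow> g x" by (rule Lim_transform_eventually)
      then show ?thesis using that by (simp add: h_def)
    qed
  qed simp
  then obtain G where G: "\<And>x. x \<in> {- 1..1} \<Longrightarrow> (G has_vector_derivative h x) (at x within {- 1..1})"
    by (rule antiderivative_continuous) blast
  have G': "(G has_real_derivative g x) (at x)" if "x \<in> {-1<..<1}" for x
    using G[of x] that at_within_Icc_at[of "- 1" x 1]
    by (simp add: h_def has_real_derivative_iff_has_vector_derivative)
  have "continuous_on {- 1..1} G"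
    unfolding continuous_on_eq_continuous_within using G has_vector_derivative_continuous by blast
  then have "(G \<longlongrightarrow> G (- 1)) (at_right (- 1))" "(G \<longlongrightarrow> G 1) (at_left 1)"
    by (auto intro: continuous_on_Icc_at_rightD continuous_on_Icc_at_leftD)
  then show ?thesis using has_primI[OF G'] by blast
qed

lemma tendsto_poly_ends:
  "((\<lambda>x. poly r x) \<longlongrightarrow> poly r (- 1 :: real)) (at_right (- 1))"
  "((\<lambda>x. poly r x) \<longlongrightarrow> poly r (1 :: real)) (at_left 1)"
  by (rule tendsto_mono[OF _ isCont_def[THEN iffD1, OF poly_isCont]], simp add: at_within_le_at)+

lemma has_prim_mult_poly:
  assumes "has_prim h I"
  shows "\<exists>J. has_prim (\<lambda>x. h x * poly r x) J"
proof -
  obtain H A B where H: "\<And>x. x \<in> {-1<..<1} \<Longrightarrow> (H has_real_derivative h x) (at x)"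
    "(H \<longlongrightarrow> A) (at_right (- 1))" "(H \<longlongrightarrow> B) (at_left 1)"
    using has_primE[OF assms] by metis
  have contH: "continuous_on {-1<..<1} H"
    by (rule continuous_at_imp_continuous_on) (meson H(1) DERIV_isCont)
  have "\<exists>K. has_prim (\<lambda>x. H x * poly (pderiv r) x) K"
    by (rule limits_has_prim[where A = "A * poly (pderiv r) (- 1)" and B = "B * poly (pderiv r) 1"])
      (intro continuous_on_mult contH continuous_on_poly continuous_on_id tendsto_mult H tendsto_poly_ends)+
  then obtain K where K: "has_prim (\<lambda>x. H x * poly (pderiv r) x) K" ..
  have "has_prim (\<lambda>x. h x * poly r x + H x * poly (pderiv r) x) (B * poly r 1 - A * poly r (- 1))"
  proof (rule has_primI[where G = "\<lambda>x. H x * poly r x"])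
    fix x :: real assume "x \<in> {-1<..<1}"
    then show "((\<lambda>x. H x * poly r x) has_real_derivative h x * poly r x + H x * poly (pderiv r) x) (at x)"
      by (auto intro!: derivative_eq_intros H)
  qed (intro tendsto_mult H tendsto_poly_ends)+
  from has_prim_add[OF this has_prim_cmult[OF K, of "- 1"]] show ?thesis by auto
qed

section \<open>Weighted primitives\<close>

lemma sqrt_power_even: "x \<in> {-1<..<1} \<Longrightarrow> sqrt (1 - x\<^sup>2) ^ (2 * e) = (1 - x\<^sup>2) ^ e"
  by (simp add: power_mult abs_square_less_1 less_imp_le abs_less_iff)

lemma sqrt_omx2_pos: "x \<in> {-1<..<1::real} \<Longrightarrow> sqrt (1 - x\<^sup>2) > 0"
  using abs_square_less_1[of x] by (auto simp: abs_less_iff)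

lemma DERIV_sqrt_omx2:
  assumes "x \<in> {-1<..<1::real}"
  shows "((\<lambda>x. sqrt (1 - x\<^sup>2)) has_real_derivative - x / sqrt (1 - x\<^sup>2)) (at x)"
proof -
  have "1 - x\<^sup>2 > 0" using sqrt_omx2_pos[OF assms] by simp
  then show ?thesis
    by (auto intro!: derivative_eq_intros simp: field_simps)
qed

lemma tendsto_sqrt_omx2:
  "((\<lambda>x. sqrt (1 - x\<^sup>2)) \<longlongrightarrow> 0) (at_right (- 1 :: real))"
  "((\<lambda>x. sqrt (1 - x\<^sup>2)) \<longlongrightarrow> 0) (at_left (1 :: real))"
proof -
  have "((\<lambda>x::real. sqrt (1 - x\<^sup>2)) \<longlongrightarrow> sqrt (1 - a\<^sup>2)) (at a)" for a
    by (intro tendsto_intros)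
  from this[of "- 1"] this[of 1]
  show "((\<lambda>x. sqrt (1 - x\<^sup>2)) \<longlongrightarrow> 0) (at_right (- 1 :: real))"
    "((\<lambda>x. sqrt (1 - x\<^sup>2)) \<longlongrightarrow> 0) (at_left (1 :: real))"
    by (simp_all add: filterlim_at_split)
qed

text \<open>With \<open>s = (1 - x\<^sup>2)\<^bsup>1/2\<^esup>\<close> and \<open>H\<close> the primitive of \<open>g s\<^bsup>2e+1\<^esup>\<close> vanishing at the end point,
  l'Hopital's rule applies to \<open>(G - H s\<^bsup>-2e-1\<^esup>) / s\<^bsup>-2e-1\<^esup>\<close>: subtracting \<open>H s\<^bsup>-2e-1\<^esup>\<close>
  removes \<open>g\<close>, which need not be bounded by any power of \<open>s\<close>, from the derivative.\<close>

lemma weighted_limit: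
  assumes G: "\<And>x. x \<in> {-1<..<1} \<Longrightarrow> (G has_real_derivative g x) (at x)"
    and H: "\<And>x. x \<in> {-1<..<1} \<Longrightarrow> (H has_real_derivative g x * sqrt (1 - x\<^sup>2) ^ (2 * e + 1)) (at x)"
  shows "(H \<longlongrightarrow> B) (at_left 1) \<Longrightarrow> ((\<lambda>x. G x * sqrt (1 - x\<^sup>2) ^ (2 * e + 1)) \<longlongrightarrow> 0) (at_left 1)"
    and "(H \<longlongrightarrow> A) (at_right (- 1)) \<Longrightarrow> ((\<lambda>x. G x * sqrt (1 - x\<^sup>2) ^ (2 * e + 1)) \<longlongrightarrow> 0) (at_right (- 1))"
proof -
  let ?s = "\<lambda>x::real. sqrt (1 - x\<^sup>2)"
  define D where "D x = inverse (?s x ^ (2 * e + 1))" for x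
  define D' where "D' x = real (2 * e + 1) * x / ?s x ^ (2 * e + 3)" for x
  have D: "(D has_real_derivative D' x) (at x)" if "x \<in> {-1<..<1}" for x
  proof -
    note s = sqrt_omx2_pos[OF that]
    have "(D has_real_derivative - (inverse (?s x ^ (2 * e + 1)) *
        (real (2 * e + 1) * (- x / ?s x * ?s x ^ (2 * e + 1 - Suc 0))) * inverse (?s x ^ (2 * e + 1)))) (at x)"
      unfolding D_def[abs_def]
      by (rule DERIV_inverse'[OF DERIV_power[OF DERIV_sqrt_omx2[OF that]]]) (use s in simp)
    moreover have "- (inverse (t ^ (2 * e + 1)) * (real (2 * e + 1) * (- x / t * t ^ (2 * e + 1 - Suc 0))) *
        inverse (t ^ (2 * e + 1))) = real (2 * e + 1) * x / t ^ (2 * e + 3)" if "t > 0" for t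
    proof -
      have "t ^ (2 * e + 3) = t ^ (2 * e + 1) * t * t" by (simp add: power3_eq_cube power_add)
      then show ?thesis using that by (simp add: field_simps)
    qed
    ultimately show ?thesis unfolding D'_def using s by (simp only:)
  qed
  have D_top: "filterlim D at_top F"
    if "(?s \<longlongrightarrow> 0) F" "\<forall>\<^sub>F x in F. x \<in> {-1<..<1}" for F
    unfolding D_def
  proof (rule filterlim_inverse_at_top)
    show "((\<lambda>x. ?s x ^ (2 * e + 1)) \<longlongrightarrow> 0) F"
      using tendsto_power[OF that(1), of "2 * e + 1"] by simp
    show "\<forall>\<^sub>F x in F. 0 < ?s x ^ (2 * e + 1)"
      using that(2) by eventually_elim (intro zero_less_power sqrt_omx2_pos)
  qed
  define f where "f C x = G x - (H x - C) * D x" for C x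
  have f: "(f C has_real_derivative - (H x - C) * D' x) (at x)" if "x \<in> {-1<..<1}" for x C
  proof -
    have "?s x ^ (2 * e + 1) \<noteq> 0" using sqrt_omx2_pos[OF that] by simp
    from right_inverse[OF this] have gD: "g x * ?s x ^ (2 * e + 1) * D x = g x"
      unfolding D_def by (simp only: mult.assoc mult_1_right)
    have "(f C has_real_derivative
        g x - ((g x * ?s x ^ (2 * e + 1) - 0) * D x + D' x * (H x - C))) (at x)"
      unfolding f_def[abs_def]
      by (rule DERIV_diff[OF G[OF that] DERIV_mult[OF DERIV_diff[OF H[OF that] DERIV_const[of C]] D[OF that]]])
    moreover have "g x - ((g x * ?s x ^ (2 * e + 1) - 0) * D x + D' x * (H x - C)) = - (H x - C) * D' x"
      unfolding diff_zero gD by (simp add: algebra_simps)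
    ultimately show ?thesis by metis
  qed
  have fin: "((\<lambda>x. G x * ?s x ^ (2 * e + 1)) \<longlongrightarrow> 0) F"
    if "((\<lambda>x. f C x / D x) \<longlongrightarrow> 0) F" "(H \<longlongrightarrow> C) F" "\<forall>\<^sub>F x in F. x \<in> {-1<..<1}" for F C
  proof -
    have lim: "((\<lambda>x. f C x / D x + (H x - C)) \<longlongrightarrow> 0 + (C - C)) F"
      by (intro tendsto_intros that)
    have "\<forall>\<^sub>F x in F. f C x / D x + (H x - C) = G x * ?s x ^ (2 * e + 1)"
      using that(3)
    proof eventually_elim
      case (elim x)
      then have "D x \<noteq> 0" using sqrt_omx2_pos[of x] by (simp add: D_def)
      then have "f C x / D x = G x / D x - (H x - C)" by (simp add: f_def diff_divide_distrib)
      moreover have "G x / D x = G x * ?s x ^ (2 * e + 1)"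
        unfolding D_def divide_inverse inverse_inverse_eq ..
      ultimately show ?case by linarith
    qed
    from Lim_transform_eventually[OF lim this] show ?thesis by simp
  qed
  have rat: "((\<lambda>x. - (H x - C) * D' x / D' x) \<longlongrightarrow> 0) F"
    if "(H \<longlongrightarrow> C) F" "\<forall>\<^sub>F x in F. D' x \<noteq> 0" for F C
  proof -
    have lim: "((\<lambda>x. - (H x - C)) \<longlongrightarrow> - (C - C)) F" by (intro tendsto_intros that)
    have "\<forall>\<^sub>F x in F. - (H x - C) = - (H x - C) * D' x / D' x"
      using that(2) by eventually_elim simp
    from Lim_transform_eventually[OF lim this] show ?thesis by simp
  qed
  have D'_nz: "D' x \<noteq> 0" if "x \<in> {-1<..<1}" "x \<noteq> 0" for x
    using sqrt_omx2_pos[OF that(1)] that by (simp add: D'_def del: of_nat_add of_nat_mult)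
  {
    assume lim: "(H \<longlongrightarrow> B) (at_left 1)"
    \<comment> \<open>The neighbourhood stops at 0 because \<open>D'\<close> vanishes there.\<close>
    have ev: "\<forall>\<^sub>F x in at_left (1::real). x \<in> {0<..<1}" by (rule eventually_at_left_real) simp
    then have ev1: "\<forall>\<^sub>F x in at_left (1::real). x \<in> {-1<..<1}" by eventually_elim auto
    have nz: "\<forall>\<^sub>F x in at_left 1. D' x \<noteq> 0" using ev by eventually_elim (rule D'_nz; simp)
    have "((\<lambda>x. f B x / D x) \<longlongrightarrow> 0) (at_left 1)"
      by (rule lhopital_left_at_top[OF D_top[OF tendsto_sqrt_omx2(2) ev1] nz
          eventually_mono[OF ev1 f] eventually_mono[OF ev1 D] rat[OF lim nz]])
    then show "((\<lambda>x. G x * ?s x ^ (2 * e + 1)) \<longlongrightarrow> 0) (at_left 1)" by (rule fin[OF _ lim ev1])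
  next
    assume lim: "(H \<longlongrightarrow> A) (at_right (- 1))"
    have ev: "\<forall>\<^sub>F x in at_right (-1::real). x \<in> {-1<..<0}" by (rule eventually_at_right_real) simp
    then have ev1: "\<forall>\<^sub>F x in at_right (-1::real). x \<in> {-1<..<1}" by eventually_elim auto
    have nz: "\<forall>\<^sub>F x in at_right (-1). D' x \<noteq> 0" using ev by eventually_elim (rule D'_nz; simp)
    have "((\<lambda>x. f A x / D x) \<longlongrightarrow> 0) (at_right (- 1))"
      by (rule lhopital_right_at_top[OF D_top[OF tendsto_sqrt_omx2(1) ev1] nz
          eventually_mono[OF ev1 f] eventually_mono[OF ev1 D] rat[OF lim nz]])
    then show "((\<lambda>x. G x * ?s x ^ (2 * e + 1)) \<longlongrightarrow> 0) (at_right (- 1))" by (rule fin[OF _ lim ev1])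
  }
qed

text \<open>Let s = (1 - x^2)^(1/2), F = G s^(2e-1) and K = G s^(2e+1). The product rule gives K' =
  g s^(2e+1) - (2e + 1) x F, and K tends to 0 by \<open>weighted_limit\<close>. Hence the integral
  of x F converges, and so does that of F = x (x F) + K.\<close>

lemma weighted_primitive:
  assumes G: "\<And>x. x \<in> {-1<..<1} \<Longrightarrow> (G has_real_derivative g x) (at x)"
    and h: "has_prim (\<lambda>x. (1 - x\<^sup>2) ^ Suc e * g x / sqrt (1 - x\<^sup>2)) I"
  shows "((\<lambda>x. (1 - x\<^sup>2) ^ e * G x * sqrt (1 - x\<^sup>2)) \<longlongrightarrow> 0) (at_left 1)"
    and "((\<lambda>x. (1 - x\<^sup>2) ^ e * G x * sqrt (1 - x\<^sup>2)) \<longlongrightarrow> 0) (at_right (- 1))"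
    and "\<exists>J. has_prim (\<lambda>x. (1 - x\<^sup>2) ^ e * G x / sqrt (1 - x\<^sup>2)) J"
proof -
  let ?s = "\<lambda>x::real. sqrt (1 - x\<^sup>2)"
  let ?F = "\<lambda>x. (1 - x\<^sup>2) ^ e * G x / ?s x"
  have ss: "?s x * ?s x = 1 - x\<^sup>2" if "x \<in> {-1<..<1}" for x
    using sqrt_omx2_pos[OF that] by simp
  have "has_prim (\<lambda>x. g x * ?s x ^ (2 * e + 1)) I"
  proof (rule has_prim_cong[THEN iffD2, OF _ h])
    fix x :: real assume x: "x \<in> {-1<..<1}"
    have "(1 - x\<^sup>2) ^ Suc e * g x / ?s x = (?s x * ?s x) * ?s x ^ (2 * e) * g x / ?s x"
      by (simp only: ss[OF x] sqrt_power_even[OF x] power_Suc)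
    then show "g x * ?s x ^ (2 * e + 1) = (1 - x\<^sup>2) ^ Suc e * g x / ?s x"
      using sqrt_omx2_pos[OF x] by (simp del: real_sqrt_mult_self)
  qed
  then obtain H A B where H: "\<And>x. x \<in> {-1<..<1} \<Longrightarrow> (H has_real_derivative g x * ?s x ^ (2 * e + 1)) (at x)"
    "(H \<longlongrightarrow> A) (at_right (- 1))" "(H \<longlongrightarrow> B) (at_left 1)"
    by (rule has_primE) blast
  let ?K = "\<lambda>x. G x * ?s x ^ (2 * e + 1)"
  have K: "?K x = (1 - x\<^sup>2) ^ e * G x * ?s x" "?K x = (1 - x\<^sup>2) * ?F x" if "x \<in> {-1<..<1}" for x
  proof -
    show "?K x = (1 - x\<^sup>2) ^ e * G x * ?s x"
      by (simp add: sqrt_power_even[OF that])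
    also have "\<dots> = (?s x * ?s x) * ?F x" using sqrt_omx2_pos[OF that] by (simp del: real_sqrt_mult_self)
    finally show "?K x = (1 - x\<^sup>2) * ?F x" by (simp only: ss[OF that])
  qed
  have lim: "(?K \<longlongrightarrow> 0) (at_left 1)" "(?K \<longlongrightarrow> 0) (at_right (- 1))"
    by (rule weighted_limit[OF G H(1)], assumption, assumption, rule H)+
  have ev: "\<forall>\<^sub>F x in at_left 1. ?K x = (1 - x\<^sup>2) ^ e * G x * ?s x"
    "\<forall>\<^sub>F x in at_right (- 1). ?K x = (1 - x\<^sup>2) ^ e * G x * ?s x"
    by (rule eventually_mono[OF eventually_at_left_real[of "- 1"] K(1)]
        eventually_mono[OF eventually_at_right_real[of _ 1] K(1)]; simp)+
  show "((\<lambda>x. (1 - x\<^sup>2) ^ e * G x * ?s x) \<longlongrightarrow> 0) (at_left 1)"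
    "((\<lambda>x. (1 - x\<^sup>2) ^ e * G x * ?s x) \<longlongrightarrow> 0) (at_right (- 1))"
    by (rule Lim_transform_eventually[OF lim(1) ev(1)] Lim_transform_eventually[OF lim(2) ev(2)])+
  have contG: "continuous_on {-1<..<1} G"
    by (rule continuous_at_imp_continuous_on) (meson G DERIV_isCont)
  have "has_prim (\<lambda>x. real (2 * e + 1) * (x * ?F x)) ((B - 0) - (A - 0))"
  proof (rule has_primI[where G = "\<lambda>x. H x - ?K x"])
    fix x :: real assume x: "x \<in> {-1<..<1}"
    have "(?K has_real_derivative g x * ?s x ^ (2 * e + 1) +
        G x * (real (2 * e + 1) * (?s x ^ (2 * e) * (- x / ?s x)))) (at x)"
      using DERIV_mult[OF G[OF x] DERIV_power[OF DERIV_sqrt_omx2[OF x], of "2 * e + 1"]]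
      by (simp add: algebra_simps)
    from DERIV_diff[OF H(1)[OF x] this]
    show "((\<lambda>x. H x - ?K x) has_real_derivative real (2 * e + 1) * (x * ?F x)) (at x)"
      by (simp add: sqrt_power_even[OF x, symmetric] algebra_simps)
  qed (intro tendsto_diff H lim)+
  from has_prim_cmult[OF this, of "inverse (real (2 * e + 1))"]
  obtain J1 where "has_prim (\<lambda>x. inverse (real (2 * e + 1)) * (real (2 * e + 1) * (x * ?F x))) J1" ..
  moreover have "inverse (real (2 * e + 1)) * (real (2 * e + 1) * y) = y" for y by simp
  ultimately have "has_prim (\<lambda>x. x * ?F x) J1" by (simp only:)
  from has_prim_mult_poly[OF this, of "[:0, 1:]"]
  obtain J2 where "has_prim (\<lambda>x. x * ?F x * poly [:0, 1:] x) J2" ..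
  moreover have "poly [:0, 1:] x = x" for x :: real by simp
  ultimately have J2: "has_prim (\<lambda>x. x * ?F x * x) J2" by (simp only:)
  have "\<exists>J. has_prim ?K J"
    by (rule limits_has_prim[where A = 0 and B = 0]) (intro continuous_intros contG lim)+
  then obtain J3 where "has_prim ?K J3" ..
  from has_prim_add[OF J2 this] have "has_prim (\<lambda>x. x * ?F x * x + ?K x) (J2 + J3)" .
  then have "has_prim ?F (J2 + J3)"
  proof (rule has_prim_cong[THEN iffD1, rotated])
    fix x :: real assume x: "x \<in> {-1<..<1}"
    have "x * y * x + (1 - x\<^sup>2) * y = y" for y by (simp add: power2_eq_square algebra_simps)
    then show "x * ?F x * x + ?K x = ?F x" by (simp only: K(2)[OF x])
  qed
  then show "\<exists>J. has_prim ?F J" ..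
qed

section \<open>Repeated integration by parts\<close>

text \<open>In both hypotheses on \<open>f\<close> the \<open>m\<close>-th derivative is controlled with the weight
  \<open>(1 - x\<^sup>2)\<^bsup>c m\<^esup>\<close>, where \<open>c = 0\<close> under (H) and \<open>c = 1\<close> under (H').\<close>

lemma weighted_derivatives:
  assumes F: "\<And>m x. m < k \<Longrightarrow> x \<in> {-1<..<1} \<Longrightarrow> (F m has_real_derivative F (Suc m) x) (at x)"
    and c: "c \<le> 1"
    and k: "has_prim (\<lambda>x. (1 - x\<^sup>2) ^ (c * k) * F k x / sqrt (1 - x\<^sup>2)) I"
  shows "m \<le> k \<Longrightarrow> \<exists>J. has_prim (\<lambda>x. (1 - x\<^sup>2) ^ (c * m) * F m x / sqrt (1 - x\<^sup>2)) J"
    and "m < k \<Longrightarrow> ((\<lambda>x. (1 - x\<^sup>2) ^ (c * m) * F m x * sqrt (1 - x\<^sup>2)) \<longlongrightarrow> 0) (at_left 1)"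
    and "m < k \<Longrightarrow> ((\<lambda>x. (1 - x\<^sup>2) ^ (c * m) * F m x * sqrt (1 - x\<^sup>2)) \<longlongrightarrow> 0) (at_right (- 1))"
proof -
  \<comment> \<open>\<open>weighted_primitive\<close> expects one factor 1 - x^2 more on the
    derivative than on the function. For c = 1 it is already there; for c = 0 it is multiplied
    in.\<close>
  have raise: "\<exists>J. has_prim (\<lambda>x. (1 - x\<^sup>2) ^ Suc (c * m) * F (Suc m) x / sqrt (1 - x\<^sup>2)) J"
    if "has_prim (\<lambda>x. (1 - x\<^sup>2) ^ (c * Suc m) * F (Suc m) x / sqrt (1 - x\<^sup>2)) J" for m J
  proof -
    from has_prim_mult_poly[OF that, of "omx2 ^ (1 - c)"] obtain K where
      "has_prim (\<lambda>x. (1 - x\<^sup>2) ^ (c * Suc m) * F (Suc m) x / sqrt (1 - x\<^sup>2) * poly (omx2 ^ (1 - c)) x) K" ..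
    moreover have "(1 - x\<^sup>2) ^ (c * Suc m) * F (Suc m) x / sqrt (1 - x\<^sup>2) * poly (omx2 ^ (1 - c)) x =
        (1 - x\<^sup>2) ^ Suc (c * m) * F (Suc m) x / sqrt (1 - x\<^sup>2)" for x
    proof -
      have "Suc (c * m) = c * Suc m + (1 - c)" using c by simp
      then show ?thesis by (simp only: poly_power poly_omx2 power_add) simp
    qed
    ultimately show ?thesis by (simp only:) blast
  qed
  have conv: "\<exists>J. has_prim (\<lambda>x. (1 - x\<^sup>2) ^ (c * m) * F m x / sqrt (1 - x\<^sup>2)) J" if "m \<le> k" for m
    using that
  \<comment> \<open>Descending induction from k: control passes from each derivative to its
    primitive.\<close>
  proof (induction m rule: inc_induct)
    case base
    show ?case using k by blast
  next
    case (step m)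
    then obtain J where "has_prim (\<lambda>x. (1 - x\<^sup>2) ^ Suc (c * m) * F (Suc m) x / sqrt (1 - x\<^sup>2)) J"
      using raise by blast
    from weighted_primitive(3)[OF F[OF step(2)] this] show ?case by simp
  qed
  then show "m \<le> k \<Longrightarrow> \<exists>J. has_prim (\<lambda>x. (1 - x\<^sup>2) ^ (c * m) * F m x / sqrt (1 - x\<^sup>2)) J" .
  assume m: "m < k"
  obtain J where J: "has_prim (\<lambda>x. (1 - x\<^sup>2) ^ Suc (c * m) * F (Suc m) x / sqrt (1 - x\<^sup>2)) J"
    using conv[of "Suc m"] raise m by auto
  note wp = weighted_primitive[OF F[OF m] J]
  show "((\<lambda>x. (1 - x\<^sup>2) ^ (c * m) * F m x * sqrt (1 - x\<^sup>2)) \<longlongrightarrow> 0) (at_left 1)"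
    "((\<lambda>x. (1 - x\<^sup>2) ^ (c * m) * F m x * sqrt (1 - x\<^sup>2)) \<longlongrightarrow> 0) (at_right (- 1))"
    by (rule wp(1), assumption, rule wp(2), assumption)
qed

text \<open>Lagrange's identity: as the formal adjoint maps q w to r w, the integrand is the
  derivative of a sum of boundary terms F_m \<eta>_m s with polynomials \<eta>_m and s = (1 -
  x^2)^(1/2), each vanishing at the ends. The offset \<open>j\<close> counts the derivatives already
  split off, so that the weights keep matching the original orders.\<close>

lemma adjoint_boundary_terms:
  assumes "\<And>m x. m < k \<Longrightarrow> x \<in> {-1<..<1} \<Longrightarrow> (F m has_real_derivative F (Suc m) x) (at x)"
    and "\<And>m. m < k \<Longrightarrow>
      ((\<lambda>x. (1 - x\<^sup>2) ^ (c * (m + j)) * F m x * sqrt (1 - x\<^sup>2)) \<longlongrightarrow> 0) (at_left 1)"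
    and "\<And>m. m < k \<Longrightarrow>
      ((\<lambda>x. (1 - x\<^sup>2) ^ (c * (m + j)) * F m x * sqrt (1 - x\<^sup>2)) \<longlongrightarrow> 0) (at_right (- 1))"
    and c: "c \<le> 1"
    and "\<And>i. i \<le> k \<Longrightarrow> omx2 ^ (c * (i + j)) dvd p i"
    and "adj k p q = omx2 ^ k * r"
  shows "has_prim (\<lambda>x. ((\<Sum>i\<le>k. poly (p i) x * F i x) * poly q x - F 0 x * poly r x) / sqrt (1 - x\<^sup>2)) 0"
proof -
  let ?s = "\<lambda>x::real. sqrt (1 - x\<^sup>2)"
  have "\<exists>B. (\<forall>x\<in>{-1<..<1}. (B has_real_derivative
      ((\<Sum>i\<le>k. poly (p i) x * F i x) * poly q x - F 0 x * poly r x) / ?s x) (at x)) \<and>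
      (B \<longlongrightarrow> 0) (at_left 1) \<and> (B \<longlongrightarrow> 0) (at_right (- 1))"
    using assms(1-3,5,6)
  proof (induction k arbitrary: p F j r)
    case 0
    then have "r = p 0 * q" by simp
    then show ?case by (intro exI[of _ "\<lambda>x. 0"]) (simp add: algebra_simps)
  next
    case (Suc k)
    let ?A = "adj k (p \<circ> Suc) q"
    have A: "wderiv k ?A = omx2 ^ Suc k * (p 0 * q - r)"
    proof -
      have "b = a - c" if "a - b = c" for a b c :: "real poly" using that by auto
      from this[OF Suc.prems(5)[unfolded adj.simps]] show ?thesis
        by (simp only: right_diff_distrib)
    qed
    \<comment> \<open>The adjoint of the tail applied to q w has derivative (p_0 q - r) w, which is
      no more singular than w; hence it equals \<eta> s.\<close>
    have "omx2 ^ Suc k dvd ?A" by (rule wderiv_dvdD) (simp only: A dvd_triv_left)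
    then obtain \<eta> where \<eta>: "?A = omx2 ^ Suc k * \<eta>" by (elim dvdE)
    have r: "omx2 * pderiv \<eta> - [:0, 1:] * \<eta> = p 0 * q - r"
    proof -
      have "omx2 ^ Suc k * (omx2 * pderiv \<eta> - [:0, 1:] * \<eta>) = omx2 ^ Suc k * (p 0 * q - r)"
        using A by (simp only: \<eta> wderiv_power_omx2)
      then show ?thesis by (simp only: mult_cancel_left power_eq_0_iff omx2_nz) blast
    qed
    \<comment> \<open>For c = 1 the divisibility of the coefficients leaves the factor (1 - x^2)^j
      that compensates the growth of \<open>F 0\<close>.\<close>
    have "omx2 ^ (c * j) dvd \<eta>"
    proof (cases "c = 0")
      case False
      then have c1: "c = 1" using c by simp
      have "omx2 ^ (k + Suc j) dvd ?A"
      proof (rule adj_dvd)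
        fix i assume "i \<le> k"
        then show "omx2 ^ (i + Suc j) dvd (p \<circ> Suc) i" using Suc.prems(4)[of "Suc i"] c1 by simp
      qed
      then have "omx2 ^ Suc k * omx2 ^ j dvd omx2 ^ Suc k * \<eta>"
        unfolding \<eta> by (simp add: power_add mult.assoc)
      then show ?thesis by (simp only: dvd_mult_cancel_left) (simp add: c1)
    qed simp
    then obtain \<zeta> where \<zeta>: "\<eta> = omx2 ^ (c * j) * \<zeta>" by (elim dvdE)
    have "\<exists>B. (\<forall>x\<in>{-1<..<1}. (B has_real_derivative
        ((\<Sum>i\<le>k. poly ((p \<circ> Suc) i) x * (F \<circ> Suc) i x) * poly q x -
         (F \<circ> Suc) 0 x * poly (omx2 * \<eta>) x) / ?s x) (at x)) \<and>
        (B \<longlongrightarrow> 0) (at_left 1) \<and> (B \<longlongrightarrow> 0) (at_right (- 1))"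
    \<comment> \<open>The tail acts on \<open>F 1\<close>, and \<eta> s = (1 - x^2) \<eta> w, so
      \<open>omx2 * \<eta>\<close> takes the role of \<open>r\<close>.\<close>
    proof (rule Suc.IH[where j = "Suc j"])
      show "adj k (p \<circ> Suc) q = omx2 ^ k * (omx2 * \<eta>)"
        unfolding \<eta> by (simp only: power_Suc mult_ac)
      fix m assume m: "m < k"
      then have m': "Suc m < Suc k" by simp
      show "((F \<circ> Suc) m has_real_derivative (F \<circ> Suc) (Suc m) x) (at x)" if "x \<in> {-1<..<1}" for x
        using Suc.prems(1)[OF m' that] by simp
      show "((\<lambda>x. (1 - x\<^sup>2) ^ (c * (m + Suc j)) * (F \<circ> Suc) m x * ?s x) \<longlongrightarrow> 0) (at_left 1)"
        using Suc.prems(2)[OF m'] by simp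
      show "((\<lambda>x. (1 - x\<^sup>2) ^ (c * (m + Suc j)) * (F \<circ> Suc) m x * ?s x) \<longlongrightarrow> 0) (at_right (- 1))"
        using Suc.prems(3)[OF m'] by simp
    next
      fix i assume "i \<le> k"
      then show "omx2 ^ (c * (i + Suc j)) dvd (p \<circ> Suc) i" using Suc.prems(4)[of "Suc i"] by simp
    qed
    then obtain B where B: "\<And>x. x \<in> {-1<..<1} \<Longrightarrow> (B has_real_derivative
        ((\<Sum>i\<le>k. poly (p (Suc i)) x * F (Suc i) x) * poly q x -
         F (Suc 0) x * poly (omx2 * \<eta>) x) / ?s x) (at x)"
      "(B \<longlongrightarrow> 0) (at_left 1)" "(B \<longlongrightarrow> 0) (at_right (- 1))"
      unfolding comp_def by blast
    \<comment> \<open>Integrating F_1 \<eta> s by parts produces this boundary term.\<close>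
    let ?C = "\<lambda>x. F 0 x * poly \<eta> x * ?s x"
    have C: "?C x = (1 - x\<^sup>2) ^ (c * (0 + j)) * F 0 x * ?s x * poly \<zeta> x" for x
      by (simp add: \<zeta> poly_omx2)
    have "(?C \<longlongrightarrow> 0 * poly \<zeta> 1) (at_left 1)" "(?C \<longlongrightarrow> 0 * poly \<zeta> (- 1)) (at_right (- 1))"
      unfolding C by (intro tendsto_mult Suc.prems(2,3) tendsto_poly_ends; simp)+
    then have lim: "((\<lambda>x. B x + ?C x) \<longlongrightarrow> 0) (at_left 1)"
      "((\<lambda>x. B x + ?C x) \<longlongrightarrow> 0) (at_right (- 1))"
      using tendsto_add[OF B(2), of ?C 0] tendsto_add[OF B(3), of ?C 0] by simp_all
    have "((\<lambda>x. B x + ?C x) has_real_derivative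
        ((\<Sum>i\<le>Suc k. poly (p i) x * F i x) * poly q x - F 0 x * poly r x) / ?s x) (at x)"
      if x: "x \<in> {-1<..<1}" for x
    proof -
      note s = sqrt_omx2_pos[OF x]
      have ss: "?s x = poly omx2 x / ?s x" using s by (simp add: poly_omx2 real_div_sqrt)
      let ?S = "\<Sum>i\<le>k. poly (p (Suc i)) x * F (Suc i) x"
      have "((\<lambda>x. B x + ?C x) has_real_derivative
          (?S * poly q x - F (Suc 0) x * poly (omx2 * \<eta>) x) / ?s x +
          ((F (Suc 0) x * poly \<eta> x + poly (pderiv \<eta>) x * F 0 x) * ?s x +
           - x / ?s x * (F 0 x * poly \<eta> x))) (at x)"
        by (intro DERIV_add B(1) x DERIV_mult Suc.prems(1) poly_DERIV DERIV_sqrt_omx2 zero_less_Suc)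
      also have "(?S * poly q x - F (Suc 0) x * poly (omx2 * \<eta>) x) / ?s x +
          ((F (Suc 0) x * poly \<eta> x + poly (pderiv \<eta>) x * F 0 x) * ?s x +
           - x / ?s x * (F 0 x * poly \<eta> x)) =
          (?S * poly q x + F 0 x * poly (omx2 * pderiv \<eta> - [:0, 1:] * \<eta>) x) / ?s x"
      proof -
        have "(F (Suc 0) x * poly \<eta> x + poly (pderiv \<eta>) x * F 0 x) * ?s x =
            (F (Suc 0) x * poly \<eta> x + poly (pderiv \<eta>) x * F 0 x) * poly omx2 x / ?s x"
          by (subst ss) simp
        then show ?thesis by (simp add: diff_divide_distrib add_divide_distrib algebra_simps)
      qed
      also have "\<dots> = ((\<Sum>i\<le>Suc k. poly (p i) x * F i x) * poly q x - F 0 x * poly r x) / ?s x"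
        unfolding r sum.atMost_Suc_shift by (simp add: algebra_simps)
      finally show ?thesis .
    qed
    with lim show ?case by blast
  qed
  then obtain B where B: "\<And>x. x \<in> {-1<..<1} \<Longrightarrow> (B has_real_derivative
      ((\<Sum>i\<le>k. poly (p i) x * F i x) * poly q x - F 0 x * poly r x) / ?s x) (at x)"
    "(B \<longlongrightarrow> 0) (at_left 1)" "(B \<longlongrightarrow> 0) (at_right (- 1))"
    by blast
  have "has_prim (\<lambda>x. ((\<Sum>i\<le>k. poly (p i) x * F i x) * poly q x - F 0 x * poly r x) / ?s x) (0 - 0)"
    by (rule has_primI[OF B(1) B(3) B(2)])
  then show ?thesis by (simp only: diff_0_right)
qed

section \<open>Chebyshev coefficients\<close>

lemma cheb_T_tau: "cheb_T n x = poly (tau n) x"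
  by (simp add: cheb_T_def tau_def)

text \<open>Each T_m is a polynomial, so convergence of the integral of g w carries over to all
  coefficients. By linearity, \<open>P\<close> may act on T_n under the integral sign instead of on
  the coefficients.\<close>

lemma cheb_coeff_rec_apply:
  assumes "has_prim (\<lambda>x. g x / sqrt (1 - x\<^sup>2)) I"
  shows "admits_cheb_expansion g"
    and "\<exists>J. has_prim (\<lambda>x. g x * poly (rec_act P tau n) x / sqrt (1 - x\<^sup>2)) J \<and>
      rec_apply P (cheb_coeff g) n = 2 / pi * J"
proof -
  have "\<exists>J. has_prim (cheb_integrand g m) J" for m
    using has_prim_mult_poly[OF assms, of "tau m"]
    by (simp add: cheb_integrand_def[abs_def] cheb_T_tau)
  then obtain J where J: "\<And>m. has_prim (cheb_integrand g m) (J m)" by metis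
  show "admits_cheb_expansion g"
    using has_prim_improper[OF J] by (auto simp: admits_cheb_expansion_def improper_convergent_def)
  have coeff: "cheb_coeff g m = 2 / pi * J m" for m
    using improper_integral_eq[OF has_prim_improper[OF J]] by (simp add: cheb_coeff_def)
  let ?a = "\<lambda>i. of_rat (ratfun_eval (rcoeff P i) n) :: real"
  let ?K = "\<Sum>i\<in>rsupp P. ?a i * J (n + i)"
  have "has_prim (\<lambda>x. \<Sum>i\<in>rsupp P. ?a i * cheb_integrand g (n + i) x) ?K"
    by (intro has_prim_sum has_prim_cmult J)
  moreover have "(\<Sum>i\<in>rsupp P. ?a i * cheb_integrand g (n + i) x) =
      g x * poly (rec_act P tau n) x / sqrt (1 - x\<^sup>2)" for x
    by (simp add: rec_act_def poly_sum cheb_integrand_def cheb_T_tau sum_distrib_left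
        sum_divide_distrib algebra_simps)
  moreover have "rec_apply P (cheb_coeff g) n = 2 / pi * ?K"
    by (simp add: rec_apply_def rsupp_def coeff sum_distrib_left algebra_simps)
  ultimately show "\<exists>J. has_prim (\<lambda>x. g x * poly (rec_act P tau n) x / sqrt (1 - x\<^sup>2)) J \<and>
      rec_apply P (cheb_coeff g) n = 2 / pi * J" by auto
qed

lemma has_prim_unique: "has_prim g I \<Longrightarrow> has_prim g J \<Longrightarrow> I = J"
  by (meson has_prim_improper has_improper_integral_unique)

section \<open>Coefficients of L and derivatives of f\<close>

lemma rpoly_mult: "rpoly (a * b) = rpoly a * rpoly b"
  by (rule poly_eqI) (simp add: coeff_mult coeff_map_poly of_rat_sum of_rat_mult)

lemma rpoly_omx2_power: "rpoly ([:1, 0, -1:] ^ i) = omx2 ^ i"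
proof (induction i)
  case (Suc i)
  have "rpoly [:1, 0, -1:] = omx2" by (simp add: omx2_def map_poly_pCons of_rat_minus)
  then show ?case by (simp only: power_Suc rpoly_mult Suc)
qed simp

lemma Ck_on_DERIV:
  assumes "Ck_on k f {-1<..<1}" "m < k" "x \<in> {-1<..<1}"
  shows "((deriv ^^ m) f has_real_derivative (deriv ^^ Suc m) f x) (at x)"
proof -
  have "(deriv ^^ m) f differentiable at x"
    using assms by (simp add: Ck_on_def differentiable_on_eq_differentiable_at)
  then show ?thesis by (simp add: DERIV_deriv_iff_real_differentiable)
qed

lemma dop_order_sum:
  assumes "p k \<noteq> 0"
  shows "dop_order (\<Sum>i\<le>k. dop_of_poly (p i) * dx ^ i) = k"
proof (rule antisym)
  let ?L = "\<Sum>i\<le>k. dop_of_poly (p i) * dx ^ i"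
  have c: "coeff (dop_poly ?L) j = (if j \<le> k then p j else 0)" for j
    using dop_coeff_sum[of p k j] by (simp add: dop_coeff_def)
  show "dop_order ?L \<le> k" unfolding dop_order_def by (rule degree_le) (simp add: c)
  show "k \<le> dop_order ?L" unfolding dop_order_def by (rule le_degree) (simp add: c assms)
qed

theorem theorem1:
  fixes k :: nat and p :: "nat \<Rightarrow> rat poly" and L :: diffop and f :: "real \<Rightarrow> real"
  assumes "L = (\<Sum>i\<le>k. dop_of_poly (p i) * dx ^ i)"
    and "p k \<noteq> 0"
    and "Ck_on k f {-1<..<1}"
    and "improper_convergent (\<lambda>x. (deriv ^^ k) f x / sqrt (1 - x\<^sup>2)) \<or>
         (improper_convergent (\<lambda>x. (1 - x\<^sup>2) ^ k * (deriv ^^ k) f x / sqrt (1 - x\<^sup>2)) \<and>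
          (\<forall>i\<le>k. [:1, 0, -1:] ^ i dvd p i))"
  shows "admits_cheb_expansion f \<and>
    admits_cheb_expansion (dop_apply L f) \<and>
    (\<forall>P Q. Q \<noteq> 0 \<and> inverse (lfract_of Q) * lfract_of P = cheb_phi L \<longrightarrow>
       (\<forall>n. rec_regular_at P n \<and> rec_regular_at Q n \<longrightarrow>
          rec_apply P (cheb_coeff f) n = rec_apply Q (cheb_coeff (dop_apply L f)) n)) \<and>
    ((\<forall>x\<in>{-1<..<1}. dop_apply L f x = 0) \<longrightarrow>
       (\<forall>P Q. Q \<noteq> 0 \<and> inverse (lfract_of Q) * lfract_of P = cheb_phi L \<longrightarrow>
          (\<forall>n. rec_regular_at P n \<and> rec_regular_at Q n \<longrightarrow>
             rec_apply P (cheb_coeff f) n = 0)))"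
proof -
  let ?F = "\<lambda>m. (deriv ^^ m) f"
  let ?s = "\<lambda>x::real. sqrt (1 - x\<^sup>2)"
  let ?p = "\<lambda>i. rpoly (p i)"
  have order: "dop_order L = k" unfolding assms(1) using assms(2) by (rule dop_order_sum)
  have coeff: "dop_coeff L i = p i" if "i \<le> k" for i
    unfolding assms(1) using that by (simp add: dop_coeff_sum)
  have Lf: "dop_apply L f x = (\<Sum>i\<le>k. poly (?p i) x * ?F i x)" for x
    by (simp add: dop_apply_def order coeff)
  have phi: "cheb_phi L = (\<Sum>i\<le>k. cheb_poly_X (p i) * cheb_D ^ i)"
    by (simp add: cheb_phi_def order coeff)
  note DERIV = Ck_on_DERIV[OF assms(3)]
  have cont: "continuous_on {-1<..<1} (\<lambda>x. (1 - x\<^sup>2) ^ e * ?F k x / ?s x)" for e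
  proof (intro continuous_intros)
    show "continuous_on {-1<..<1} (?F k)" using assms(3) by (simp add: Ck_on_def)
    show "\<forall>x\<in>{-1<..<1}. ?s x \<noteq> 0" using sqrt_omx2_pos by (metis less_irrefl)
  qed
  \<comment> \<open>The two hypotheses are merged: c = 0 for (H), where the divisibility is trivial,
    and c = 1 for (H').\<close>
  obtain c I where c: "c \<le> 1" and I: "has_prim (\<lambda>x. (1 - x\<^sup>2) ^ (c * k) * ?F k x / ?s x) I"
    and dvd: "\<And>i. i \<le> k \<Longrightarrow> omx2 ^ (c * i) dvd ?p i"
    using assms(4)
  proof
    assume "improper_convergent (\<lambda>x. ?F k x / ?s x)"
    then have "\<exists>I. has_prim (\<lambda>x. ?F k x / ?s x) I"
      using cont[of 0] by (intro improper_convergent_has_prim) simp_all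
    then show ?thesis using that[of 0] by auto
  next
    assume *: "improper_convergent (\<lambda>x. (1 - x\<^sup>2) ^ k * ?F k x / ?s x) \<and> (\<forall>i\<le>k. [:1, 0, -1:] ^ i dvd p i)"
    then have "\<exists>I. has_prim (\<lambda>x. (1 - x\<^sup>2) ^ k * ?F k x / ?s x) I"
      using cont[of k] by (intro improper_convergent_has_prim) simp_all
    moreover have "omx2 ^ i dvd ?p i" if "i \<le> k" for i
    proof -
      have "[:1, 0, -1:] ^ i dvd p i" using * that by blast
      then obtain b where "p i = [:1, 0, -1:] ^ i * b" by (rule dvdE)
      then show ?thesis by (simp only: rpoly_mult rpoly_omx2_power dvd_triv_left)
    qed
    ultimately show ?thesis using that[of 1] by auto
  qed
  have wd: "m \<le> k \<Longrightarrow> \<exists>J. has_prim (\<lambda>x. (1 - x\<^sup>2) ^ (c * m) * ?F m x / ?s x) J"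
    "m < k \<Longrightarrow> ((\<lambda>x. (1 - x\<^sup>2) ^ (c * m) * ?F m x * ?s x) \<longlongrightarrow> 0) (at_left 1)"
    "m < k \<Longrightarrow> ((\<lambda>x. (1 - x\<^sup>2) ^ (c * m) * ?F m x * ?s x) \<longlongrightarrow> 0) (at_right (- 1))" for m
    using weighted_derivatives[where F = ?F, OF _ c I] DERIV by blast+
  \<comment> \<open>For m = 0 the weight (1 - x^2)^(c m) is 1, so the integral of f w itself
    converges.\<close>
  from wd(1)[of 0] obtain If where If: "has_prim (\<lambda>x. f x / ?s x) If" by auto
  \<comment> \<open>The weight required by the i-th derivative is supplied by
    \<open>p i\<close>.\<close>
  have "\<exists>J. has_prim (\<lambda>x. poly (?p i) x * ?F i x / ?s x) J" if i: "i \<le> k" for i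
  proof -
    obtain b where b: "?p i = omx2 ^ (c * i) * b" using dvd[OF i] by (elim dvdE)
    obtain J where "has_prim (\<lambda>x. (1 - x\<^sup>2) ^ (c * i) * ?F i x / ?s x) J"
      using wd(1)[OF i] by blast
    from has_prim_mult_poly[OF this, of b] show ?thesis
      by (simp add: b poly_omx2 algebra_simps)
  qed
  then obtain J where J: "\<And>i. i \<in> {..k} \<Longrightarrow> has_prim (\<lambda>x. poly (?p i) x * ?F i x / ?s x) (J i)"
    by (metis atMost_iff)
  have "has_prim (\<lambda>x. \<Sum>i\<le>k. poly (?p i) x * ?F i x / ?s x) (\<Sum>i\<le>k. J i)"
    by (rule has_prim_sum) (rule J)
  then have ILf: "has_prim (\<lambda>x. dop_apply L f x / ?s x) (\<Sum>i\<le>k. J i)"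
    by (simp add: Lf sum_divide_distrib)
  have main: "rec_apply P (cheb_coeff f) n = rec_apply Q (cheb_coeff (dop_apply L f)) n"
    if PQ: "Q \<noteq> 0" "inverse (lfract_of Q) * lfract_of P = cheb_phi L"
      and n: "rec_regular_at P n" "rec_regular_at Q n" for P Q n
  proof -
    let ?q = "rec_act Q tau n" and ?r = "rec_act P tau n"
    have adj: "adj k ?p ?q = omx2 ^ k * ?r"
      by (rule adj_rec_act) (use PQ n phi in auto)
    obtain A where A: "has_prim (\<lambda>x. f x * poly ?r x / ?s x) A" "rec_apply P (cheb_coeff f) n = 2 / pi * A"
      using cheb_coeff_rec_apply(2)[OF If] by blast
    obtain B where B: "has_prim (\<lambda>x. dop_apply L f x * poly ?q x / ?s x) B"
      "rec_apply Q (cheb_coeff (dop_apply L f)) n = 2 / pi * B"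
      using cheb_coeff_rec_apply(2)[OF ILf] by blast
    \<comment> \<open>The integrals of (L f) (Q T_n) w and f (P T_n) w therefore agree.\<close>
    have "has_prim (\<lambda>x. ((\<Sum>i\<le>k. poly (?p i) x * ?F i x) * poly ?q x - ?F 0 x * poly ?r x) / ?s x) 0"
      by (rule adjoint_boundary_terms[where c = c and j = 0])
        (use DERIV wd(2,3) c dvd adj in auto)
    from has_prim_add[OF this A(1)] have "has_prim (\<lambda>x. dop_apply L f x * poly ?q x / ?s x) A"
      by (simp add: Lf diff_divide_distrib)
    then have "A = B" using B(1) by (rule has_prim_unique)
    then show ?thesis by (simp add: A(2) B(2))
  qed
  \<comment> \<open>\<open>L f\<close> is known to vanish on the open interval only, which is all
    that the integrals see.\<close>
  have zero: "rec_apply Q (cheb_coeff (dop_apply L f)) n = 0"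
    if "\<forall>x\<in>{-1<..<1}. dop_apply L f x = 0" for Q n
  proof -
    obtain B where B: "has_prim (\<lambda>x. dop_apply L f x * poly (rec_act Q tau n) x / ?s x) B"
      "rec_apply Q (cheb_coeff (dop_apply L f)) n = 2 / pi * B"
      using cheb_coeff_rec_apply(2)[OF ILf] by blast
    have "has_prim (\<lambda>x. dop_apply L f x * poly (rec_act Q tau n) x / ?s x) 0"
      by (rule has_prim_cong[THEN iffD1, OF _ has_prim_0]) (simp add: that)
    then have "B = 0" using B(1) has_prim_unique by blast
    then show ?thesis using B(2) by simp
  qed
  show ?thesis
    using main zero cheb_coeff_rec_apply(1)[OF If] cheb_coeff_rec_apply(1)[OF ILf] by auto
qed

end
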